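(* Let $k\geq 2$ be a fixed integer and let $\tau_k(n)$ denote the number of representations of the positive integer $n$ as an ordered product of $k$ natural numbers. Then for every $\varepsilon>0$ and all $x\geq 2$, $$\sum_{n\leq x}\tau_k\left(\left[\frac{x}{n}\right]\right)=x\sum_{n=1}^{\infty}\frac{\tau_k(n)}{n(n+1)}+O\left(x^{9/19+\varepsilon}\right),$$ where $[t]$ denotes the greatest integer not exceeding $t$, and the implied constant depends only on $k$ and $\varepsilon$.
   Context: $\tau_k(n)=\#\{(n_1,\dots,n_k)\in\mathbb{N}^k: n_1n_2\cdots n_k=n\}$. The sum over $n\le x$ runs over positive integers. *)

theory Defs
  imports "HOL-Analysis.Analysis"
begin

definition tau :: "nat \<Rightarrow> nat \<Rightarrow> nat" where
  "tau k n = card {xs :: nat list. length xs = k \<and> (\<forall>x\<in>set xs. x \<ge> 1) \<and> prod_list xs = n}"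

end

theory Submission
  imports Defs
begin

text \<open>
  Sorting the terms by the value \<open>d\<close> of the quotient, the terms with \<open>d > x^(10/19)\<close> number at most
  \<open>x^(9/19)\<close>, and the others give the main term and, for \<open>\<delta> = 0, 1\<close>, the sums of \<open>\<tau>\<^sub>k(d) \<psi>(x/(d + \<delta>))\<close>
  with the sawtooth \<open>\<psi>\<close>.  On a dyadic block \<open>D < d \<le> 2D\<close> with \<open>D = R x^(9/19)\<close> one has to gain a factor
  \<open>R\<close> over the trivial bound.  The Fourier expansion of the sawtooth, smoothed at scale \<open>1/R\<close>, leads to
  exponential sums with phases \<open>h x/(d + \<delta>)\<close>, \<open>h \<le> 2R^2\<close>.  Splitting off the factors of \<open>d\<close> one at a time,
  either some partial product \<open>p\<close> lies between \<open>R^2\<close> and \<open>D/R^2\<close>, or one factor is larger than about \<open>D/R^4\<close>.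
  In the second case van der Corput's second derivative test applies to the sum over that factor.  In the
  first case \<open>d = m n\<close> with arbitrary coefficients and \<open>R^2 \<le> n \<le> (2D)^(1/2)\<close>: the pairs \<open>(h, n)\<close> are grouped
  according to the value of \<open>h/n\<close> into about \<open>H N/R^2\<close> classes, and after Cauchy's inequality
  the pairs with \<open>h n' = h' n\<close> are counted by the divisor bound, while for the others the sum over \<open>m\<close> is
  again treated by the second derivative test.  Up to constants, all conditions hold for
  \<open>D \<le> x^(10/19)\<close>, with equality at the end of this range.
\<close>

section \<open>Divisor bounds\<close>

text \<open>Where the exponent comes from: put y = x^(1/19) and D = R y^9. In the bilinear case the
  phase in m depends essentially on h/n alone. With about H N / R^2 classes, the pairs with h n' =
  h' n contribute about (H D / R)^2 to the squared sum, which is exactly what is allowed. In a class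
  j = |h n' - h' n| is O(R^2), instead of O(H N) without the grouping, so there are about R^2 times
  as many other pairs and each of their sums over m must save R^2. Their phases have second
  differences of order x j N / D^3, and the second derivative test saves enough if x R^6 N <= D^3
  (large j) and D N R^4 <= x (j = 1). For N^2 <= 2 D both reduce, up to constants, to R <= y, that
  is D <= x^(10/19). Choosing the smaller of the two cofactors as n is what keeps N below (2
  D)^(1/2). The case of one large factor needs x R^11 <= D^3, which is again R <= y.\<close>

lemma linear_le_powr_two:
  fixes \<epsilon> :: real assumes "\<epsilon> > 0"
  shows "real a + 1 \<le> max 1 (1 / (\<epsilon> * ln 2)) * 2 powr (real a * \<epsilon>)"
proof -
  let ?C = "max 1 (1 / (\<epsilon> * ln 2))"
  have pos: "\<epsilon> * ln 2 > 0" using assms by simp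
  have "1 \<le> ?C * (\<epsilon> * ln 2)"
    using mult_right_mono[of "1 / (\<epsilon> * ln 2)" ?C "\<epsilon> * ln 2"] pos assms by simp
  hence "real a * 1 \<le> real a * (?C * (\<epsilon> * ln 2))" by (intro mult_left_mono) auto
  hence "real a + 1 \<le> ?C * (1 + real a * \<epsilon> * ln 2)"
    by (simp add: distrib_left ac_simps add_mono)
  also have "1 + real a * \<epsilon> * ln 2 \<le> 2 powr (real a * \<epsilon>)"
    using exp_ge_add_one_self[of "real a * \<epsilon> * ln 2"] by (simp add: powr_def)
  hence "?C * (1 + real a * \<epsilon> * ln 2) \<le> ?C * 2 powr (real a * \<epsilon>)"
    by (intro mult_left_mono) auto
  finally show ?thesis .
qed

lemma card_divisors_prime_power_mult:
  fixes p m :: nat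
  assumes "prime p" "m > 0"
  shows "card {d. d dvd p ^ a * m} \<le> (a + 1) * card {d. d dvd m}"
proof -
  have fin: "finite ({..a} \<times> {d. d dvd m})" using assms by auto
  have "{d. d dvd p ^ a * m} \<subseteq> (\<lambda>(i, e). p ^ i * e) ` ({..a} \<times> {d. d dvd m})"
  proof
    fix d assume "d \<in> {d. d dvd p ^ a * m}"
    then obtain b c where bc: "d = b * c" "b dvd p ^ a" "c dvd m"
      using division_decomp by blast
    then obtain i where "i \<le> a" "b = p ^ i"
      using divides_primepow_nat[OF assms(1)] by blast
    with bc show "d \<in> (\<lambda>(i, e). p ^ i * e) ` ({..a} \<times> {d. d dvd m})" by force
  qed
  from surj_card_le[OF fin this] show ?thesis by (simp add: card_cartesian_product)
qed

text \<open>Prime powers p^a are stripped off one at a time. If p >= 2^(1/\<epsilon>), then p^(a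
  \<epsilon>) >= 2^a >= a + 1 and nothing is lost. A smaller prime costs the factor
  \<open>C1\<close> from \<open>linear_le_powr_two\<close>, once per prime, so the exponent of
  \<open>C1\<close> counts the small primes dividing n and is at most \<open>P0\<close>.\<close>

lemma divisor_bound:
  fixes \<epsilon> :: real assumes "\<epsilon> > 0"
  obtains C where "C \<ge> 1" "\<And>n. n > 0 \<Longrightarrow> real (card {d. d dvd n}) \<le> C * real n powr \<epsilon>"
proof -
  define C1 where "C1 = max 1 (1 / (\<epsilon> * ln 2))"
  define P0 where "P0 = nat \<lceil>2 powr (1 / \<epsilon>)\<rceil>"
  have C1: "C1 \<ge> 1" by (simp add: C1_def)
  let ?s = "\<lambda>n. {p. prime p \<and> p dvd n \<and> p < P0}"
  have fin: "finite (?s n)" for n by (rule finite_subset[of _ "{..<P0}"]) auto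
  have main: "real (card {d. d dvd n}) \<le> C1 ^ card (?s n) * real n powr \<epsilon>" if "n > 0" for n
    using that
  proof (induction n rule: less_induct)
    case (less n)
    show ?case
    proof (cases "n = 1")
      case True
      thus ?thesis using C1 by simp
    next
      case False
      then obtain p where p: "prime p" "p dvd n" using prime_factor_nat by blast
      obtain m where m: "n = p ^ multiplicity p n * m" "\<not> p dvd m"
        by (rule multiplicity_decompose'[of n p]) (use less.prems p in auto)
      define a where "a = multiplicity p n"
      have nm: "n = p ^ a * m" using m a_def by simp
      have m0: "m > 0" using nm less.prems by (cases m) auto
      have a0: "a > 0" using p less.prems m(2) nm by (cases a) auto
      have p2: "p \<ge> 2" using p prime_ge_2_nat by blast
      have "p ^ a > 1" using one_less_power[of p a] p2 a0 by simp
      hence "m < n" using nm m0 by simp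
      from less.IH[OF this m0]
      have IH: "real (card {d. d dvd m}) \<le> C1 ^ card (?s m) * real m powr \<epsilon>" .
      have c1: "real (card {d. d dvd n}) \<le> (real a + 1) * real (card {d. d dvd m})"
        using of_nat_mono[OF card_divisors_prime_power_mult[OF p(1) m0, of a], where ?'a = real] nm
        by (simp add: distrib_right)
      have sub: "?s m \<subseteq> ?s n" using nm by auto
      have pw: "real n powr \<epsilon> = real p powr (real a * \<epsilon>) * real m powr \<epsilon>"
      proof -
        have "real n = real p powr real a * real m" using p2 nm by (simp add: powr_realpow)
        thus ?thesis using p2 by (simp add: powr_mult powr_powr)
      qed
      have ab: "(real a + 1) * C1 ^ card (?s m) \<le> C1 ^ card (?s n) * real p powr (real a * \<epsilon>)"
      proof (cases "p < P0")
        case True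
        have "insert p (?s m) \<subseteq> ?s n" using sub True p by auto
        hence "card (insert p (?s m)) \<le> card (?s n)" using fin card_mono by blast
        hence cs: "Suc (card (?s m)) \<le> card (?s n)" using fin m(2) by simp
        have "real a + 1 \<le> C1 * 2 powr (real a * \<epsilon>)"
          unfolding C1_def using linear_le_powr_two[OF assms] .
        also have "... \<le> C1 * real p powr (real a * \<epsilon>)"
          using C1 p2 assms by (intro mult_left_mono powr_mono2) auto
        finally have "(real a + 1) * C1 ^ card (?s m) \<le> C1 * real p powr (real a * \<epsilon>) * C1 ^ card (?s m)"
          using C1 by (intro mult_right_mono) auto
        also have "... = C1 ^ Suc (card (?s m)) * real p powr (real a * \<epsilon>)" by simp
        also have "... \<le> C1 ^ card (?s n) * real p powr (real a * \<epsilon>)"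
          using C1 cs by (intro mult_right_mono power_increasing) auto
        finally show ?thesis .
      next
        case False
        hence "2 powr (1/\<epsilon>) \<le> real p" unfolding P0_def by linarith
        hence "(2 powr (1/\<epsilon>)) powr \<epsilon> \<le> real p powr \<epsilon>" using assms by (intro powr_mono2) auto
        hence two: "2 \<le> real p powr \<epsilon>" using assms by (simp add: powr_powr)
        have "a + 1 \<le> 2 ^ a" by (metis Suc_eq_plus1 Suc_leI less_exp)
        hence "real a + 1 \<le> 2 ^ a"
          using of_nat_mono[of "a + 1" "2 ^ a", where ?'a = real] by simp
        also have "... \<le> (real p powr \<epsilon>) ^ a" using two by (intro power_mono) auto
        also have "... = real p powr (real a * \<epsilon>)"
          using p2 by (subst powr_realpow[symmetric]) (auto simp: powr_powr mult.commute)
        finally have "real a + 1 \<le> real p powr (real a * \<epsilon>)" .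
        moreover have "C1 ^ card (?s m) \<le> C1 ^ card (?s n)"
          using C1 card_mono[OF fin sub] by (intro power_increasing) auto
        ultimately show ?thesis using C1 by (subst mult.commute) (intro mult_mono, auto)
      qed
      have "real (card {d. d dvd n}) \<le> (real a + 1) * (C1 ^ card (?s m) * real m powr \<epsilon>)"
        by (rule order_trans[OF c1], rule mult_left_mono[OF IH]) simp
      also have "... = ((real a + 1) * C1 ^ card (?s m)) * real m powr \<epsilon>" by simp
      also have "... \<le> (C1 ^ card (?s n) * real p powr (real a * \<epsilon>)) * real m powr \<epsilon>"
        using ab by (intro mult_right_mono) auto
      also have "... = C1 ^ card (?s n) * real n powr \<epsilon>" using pw by simp
      finally show ?thesis .
    qed
  qed
  have up: "C1 ^ card (?s n) \<le> C1 ^ P0" for n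
  proof -
    have "card (?s n) \<le> card {..<P0}" by (rule card_mono) auto
    thus ?thesis using C1 by (intro power_increasing) auto
  qed
  have "real (card {d. d dvd n}) \<le> C1 ^ P0 * real n powr \<epsilon>" if "n > 0" for n
    by (rule order_trans[OF main[OF that] mult_right_mono[OF up]]) simp
  moreover have "C1 ^ P0 \<ge> 1" using C1 by simp
  ultimately show ?thesis using that by blast
qed

section \<open>Recursion and bounds for the k-fold divisor function\<close>

lemma tau_0: "tau 0 n = (if n = 1 then 1 else 0)"
proof -
  have "{xs :: nat list. length xs = 0 \<and> (\<forall>x\<in>set xs. x \<ge> 1) \<and> prod_list xs = n}
      = (if n = 1 then {[]} else {})" by auto
  thus ?thesis by (simp add: tau_def)
qed

lemma finite_tau_lists:
  assumes "n > 0"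
  shows "finite {xs :: nat list. length xs = k \<and> (\<forall>x\<in>set xs. x \<ge> 1) \<and> prod_list xs = n}"
proof (rule finite_subset)
  show "{xs :: nat list. length xs = k \<and> (\<forall>x\<in>set xs. x \<ge> 1) \<and> prod_list xs = n}
     \<subseteq> {xs. set xs \<subseteq> {..n} \<and> length xs = k}"
  proof safe
    fix xs :: "nat list" and x assume "x \<in> set xs" "n = prod_list xs"
    hence "x dvd n" by (metis prod_list_dvd)
    thus "x \<le> prod_list xs" using assms \<open>n = prod_list xs\<close> by (auto intro: dvd_imp_le)
  qed
qed (simp add: finite_lists_length_eq)

lemma tau_Suc:
  assumes "w > 0"
  shows "tau (Suc k) w = (\<Sum>n | n dvd w. tau k (w div n))"
proof -
  let ?L = "\<lambda>k w. {xs :: nat list. length xs = k \<and> (\<forall>x\<in>set xs. x \<ge> 1) \<and> prod_list xs = w}"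
  have "?L (Suc k) w = (\<lambda>(n, xs). n # xs) ` (SIGMA n:{n. n dvd w}. ?L k (w div n))"
  proof (intro equalityI subsetI)
    fix ys assume ys: "ys \<in> ?L (Suc k) w"
    then obtain n xs where e: "ys = n # xs" by (cases ys) auto
    have "n dvd w" "n \<ge> 1" using ys e by auto
    moreover have "xs \<in> ?L k (w div n)" using ys e by auto
    ultimately show "ys \<in> (\<lambda>(n, xs). n # xs) ` (SIGMA n:{n. n dvd w}. ?L k (w div n))"
      using e by force
  next
    fix ys assume "ys \<in> (\<lambda>(n, xs). n # xs) ` (SIGMA n:{n. n dvd w}. ?L k (w div n))"
    then obtain n xs where *: "ys = n # xs" "n dvd w" "xs \<in> ?L k (w div n)" by auto
    moreover have "n \<ge> 1" using * assms by (cases n) auto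
    ultimately show "ys \<in> ?L (Suc k) w" by auto
  qed
  moreover have "inj_on (\<lambda>(n, xs). n # xs) (SIGMA n:{n. n dvd w}. ?L k (w div n))"
    by (auto simp: inj_on_def)
  ultimately have "tau (Suc k) w = card (SIGMA n:{n. n dvd w}. ?L k (w div n))"
    unfolding tau_def by (simp add: card_image)
  also have "... = (\<Sum>n | n dvd w. card (?L k (w div n)))"
  proof (rule card_SigmaI)
    show "finite {n. n dvd w}" using assms by simp
    show "\<forall>n\<in>{n. n dvd w}. finite (?L k (w div n))"
    proof
      fix n assume "n \<in> {n. n dvd w}"
      hence "w div n > 0" using assms by (auto elim!: dvdE)
      thus "finite (?L k (w div n))" by (rule finite_tau_lists)
    qed
  qed
  finally show ?thesis by (simp add: tau_def)
qed

text \<open>Stated with a uniform divisor bound \<open>\<Delta>\<close> on [1, X], so that all later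
  estimates carry powers of a single number; only at the very end is \<open>\<Delta>\<close>
  replaced by a small power of x.\<close>

lemma tau_le_power:
  fixes \<Delta> :: real
  assumes "\<And>v. v > 0 \<Longrightarrow> v \<le> X \<Longrightarrow> real (card {d. d dvd v}) \<le> \<Delta>" "0 < w" "w \<le> X" "\<Delta> \<ge> 1"
  shows "real (tau k w) \<le> \<Delta> ^ k"
  using assms(2,3)
proof (induction k arbitrary: w)
  case 0
  thus ?case by (simp add: tau_0)
next
  case (Suc k)
  have "real (tau (Suc k) w) = (\<Sum>n | n dvd w. real (tau k (w div n)))"
    using tau_Suc[OF Suc.prems(1)] by simp
  also have "... \<le> (\<Sum>n | n dvd w. \<Delta> ^ k)"
  proof (rule sum_mono)
    fix n assume "n \<in> {n. n dvd w}"
    hence "w div n > 0" using Suc.prems by (auto elim!: dvdE)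
    moreover have "w div n \<le> X" using Suc.prems div_le_dividend le_trans by blast
    ultimately show "real (tau k (w div n)) \<le> \<Delta> ^ k" by (rule Suc.IH)
  qed
  also have "... = real (card {d. d dvd w}) * \<Delta> ^ k" by simp
  also have "... \<le> \<Delta> * \<Delta> ^ k"
    using assms(1)[OF Suc.prems] assms(4) by (intro mult_right_mono) auto
  finally show ?case by simp
qed

lemma tau_bound:
  fixes \<epsilon> :: real assumes "\<epsilon> > 0"
  obtains C where "C \<ge> 1" "\<And>n. n > 0 \<Longrightarrow> real (tau k n) \<le> C * real n powr \<epsilon>"
proof -
  \<comment> \<open>Dividing by k + 1 rather than k covers k = 0 too; only e k <= \<epsilon>
    matters.\<close>
  define e where "e = \<epsilon> / (real k + 1)"
  have "e > 0" using assms by (simp add: e_def)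
  then obtain C where C: "C \<ge> 1" "\<And>n. n > 0 \<Longrightarrow> real (card {d. d dvd n}) \<le> C * real n powr e"
    using divisor_bound by blast
  have "real (tau k n) \<le> C ^ k * real n powr \<epsilon>" if "n > 0" for n
  proof -
    have n1: "real n powr e \<ge> 1" using that \<open>e > 0\<close> by (simp add: ge_one_powr_ge_zero)
    have "real (tau k n) \<le> (C * real n powr e) ^ k"
    proof (rule tau_le_power[of n])
      fix v :: nat assume v: "v > 0" "v \<le> n"
      show "real (card {d. d dvd v}) \<le> C * real n powr e"
      proof (rule order_trans[OF C(2)[OF v(1)]])
        show "C * real v powr e \<le> C * real n powr e"
          using C(1) v \<open>e > 0\<close> by (intro mult_left_mono powr_mono2) auto
      qed
    next
      show "1 \<le> C * real n powr e" using mult_mono[OF C(1) n1] C(1) by simp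
    qed (use that in auto)
    also have "... = C ^ k * real n powr (e * real k)"
      using that powr_realpow[of "real n powr e" k] by (simp add: power_mult_distrib powr_powr)
    also have "... \<le> C ^ k * real n powr \<epsilon>"
      using that assms C(1) by (intro mult_left_mono powr_mono) (auto simp: e_def field_simps)
    finally show ?thesis .
  qed
  moreover have "C ^ k \<ge> 1" using C by simp
  ultimately show ?thesis using that by blast
qed

section \<open>Van der Corput estimates\<close>

definition ee :: "real \<Rightarrow> complex" where "ee t = cis (2 * pi * t)"

lemma norm_ee [simp]: "norm (ee t) = 1" by (simp add: ee_def)
lemma ee_0 [simp]: "ee 0 = 1" by (simp add: ee_def)
lemma ee_add: "ee (s + t) = ee s * ee t" by (simp add: ee_def cis_mult ring_distribs)
lemma cnj_ee: "cnj (ee t) = ee (- t)" by (simp add: ee_def cis_cnj)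
lemma Re_ee: "Re (ee t) = cos (2 * pi * t)" by (simp add: ee_def)

lemma ee_of_int [simp]: "ee (of_int j) = 1"
  using cis_multiple_2pi[of "of_int j"] by (simp add: ee_def mult.commute mult.left_commute)

lemma one_minus_ee: "1 - ee g = - 2 * \<i> * of_real (sin (pi * g)) * cis (pi * g)"
proof -
  have "ee g = cis (pi * g) * cis (pi * g)" 
  proof -
    have "2 * pi * g = pi * g + pi * g" by simp
    thus ?thesis by (simp only: ee_def cis_mult)
  qed
  hence "1 - ee g = (cis (- (pi * g)) - cis (pi * g)) * cis (pi * g)"
    by (simp add: left_diff_distrib cis_mult)
  also have "cis (- (pi * g)) - cis (pi * g) = - 2 * \<i> * of_real (sin (pi * g))"
    by (simp add: complex_eq_iff)
  finally show ?thesis .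
qed

lemma norm_one_minus_ee: "norm (1 - ee g) = 2 * \<bar>sin (pi * g)\<bar>"
  by (simp add: one_minus_ee norm_mult)

lemma inverse_one_minus_ee:
  assumes "sin (pi * g) \<noteq> 0"
  shows "inverse (1 - ee g) = Complex (1/2) (cot (pi * g) / 2)"
proof -
  have "1 - ee g = Complex (2 * sin (pi * g) * sin (pi * g)) (- 2 * sin (pi * g) * cos (pi * g))"
    unfolding one_minus_ee by (simp add: complex_eq_iff)
  note e = this
  have "(1 - ee g) * Complex (1/2) (cot (pi * g) / 2)
      = Complex (sin (pi*g) ^ 2 + cos (pi*g)^2) 0"
    unfolding e using assms by (simp add: complex_eq_iff cot_def field_simps power2_eq_square)
  hence "(1 - ee g) * Complex (1/2) (cot (pi * g) / 2) = 1" by (simp add: one_complex.code)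
  thus ?thesis by (metis inverse_unique)
qed

lemma cot_pi_antimono:
  assumes "0 < a" "a \<le> b" "b < 1"
  shows "cot (pi * b) \<le> cot (pi * a)"
proof -
  have s: "sin (pi * a) > 0" "sin (pi * b) > 0" using assms by (auto intro!: sin_gt_zero)
  have "pi * b - pi * a < pi * 1" using assms unfolding right_diff_distrib[symmetric]
    by (intro mult_strict_left_mono) auto
  hence "sin (pi * b - pi * a) \<ge> 0" using assms
    by (intro sin_ge_zero) (auto intro: mult_left_mono)
  thus ?thesis using s by (simp add: cot_def field_simps sin_diff)
qed

text \<open>By concavity the sine lies above its chord from 0 to pi/2; the reflection of t in 1/2
  gives the other half.\<close>

lemma sin_pi_ge:
  assumes "0 \<le> \<theta>" "\<theta> \<le> t" "t \<le> 1 - \<theta>"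
  shows "sin (pi * t) \<ge> 2 * \<theta>"
proof -
  have conc: "concave_on {0..pi} sin"
  proof (rule f''_le0_imp_concave)
    show "(sin has_real_derivative cos x) (at x)" for x :: real by (rule DERIV_sin)
    show "(cos has_real_derivative - sin x) (at x)" for x :: real by (rule DERIV_cos)
    show "- sin x \<le> 0" if "x \<in> {0..pi}" for x :: real using that by (auto intro: sin_ge_zero)
  qed auto
  have *: "sin (pi * s) \<ge> 2 * s" if "0 \<le> s" "s \<le> 1/2" for s
    using concave_onD[OF conc, of "2 * s" 0 "pi/2"] that by (simp add: field_simps)
  show ?thesis
  proof (cases "t \<le> 1/2")
    case True
    thus ?thesis using *[of t] assms by auto
  next
    case False
    have "sin (pi * (1 - t)) = sin (pi * t)" by (simp add: right_diff_distrib)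
    thus ?thesis using False *[of "1 - t"] assms by auto
  qed
qed

text \<open>With \<open>\<zeta> n = 1 / (1 - ee (g n))\<close> one has \<open>ee (f n) = (ee (f n) - ee (f (n + 1))) * \<zeta> n\<close>;
  the imaginary part of \<open>\<zeta>\<close> is monotone and its real part constant, so Abel summation costs only the
  size of \<open>\<zeta>\<close>.\<close>

lemma Kusmin_Landau:
  fixes f :: "nat \<Rightarrow> real"
  assumes th: "0 < \<theta>" "\<theta> \<le> 1/2"
  assumes g: "\<And>n. a \<le> n \<Longrightarrow> n < b \<Longrightarrow> of_int j + \<theta> \<le> f (Suc n) - f n \<and> f (Suc n) - f n \<le> of_int j + 1 - \<theta>"
  assumes mono: "\<And>n. a \<le> n \<Longrightarrow> Suc n < b \<Longrightarrow> f (Suc n) - f n \<le> f (Suc (Suc n)) - f (Suc n)"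
  shows "norm (\<Sum>n=a..<b. ee (f n)) \<le> 1 / \<theta>"
proof (cases "a < b")
  case False
  thus ?thesis using th by simp
next
  case True
  define g where "g n = f (Suc n) - f n - of_int j" for n
  define z where "z n = Complex (1/2) (cot (pi * g n) / 2)" for n
  let ?s = "(\<Sum>n=a..<b - 1. norm (ee (f (Suc n)) * (z (Suc n) - z n)))"
  have gr: "\<theta> \<le> g n" "g n \<le> 1 - \<theta>" if "a \<le> n" "n < b" for n
    using assms(3)[OF that] by (auto simp: g_def)
  have cotb: "\<bar>cot (pi * g n)\<bar> \<le> 1 / (2 * \<theta>)" if "a \<le> n" "n < b" for n
  proof -
    have s: "sin (pi * \<theta>) \<ge> 2 * \<theta>" using sin_pi_ge th by simp
    have "cot (pi * \<theta>) \<le> 1 / sin (pi * \<theta>)"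
      using s th by (simp add: cot_def divide_right_mono)
    also have "... \<le> 1 / (2 * \<theta>)" using s th by (simp add: frac_le)
    finally have 1: "cot (pi * \<theta>) \<le> 1 / (2 * \<theta>)" .
    have "cot (pi * g n) \<le> cot (pi * \<theta>)"
      using gr[OF that] th by (intro cot_pi_antimono) auto
    moreover have "cot (pi * (1 - \<theta>)) \<le> cot (pi * g n)"
      using gr[OF that] th by (intro cot_pi_antimono) auto
    moreover have "cot (pi * (1 - \<theta>)) = - cot (pi * \<theta>)"
      by (simp add: cot_def right_diff_distrib)
    ultimately show ?thesis using 1 by linarith
  qed
  have eq: "ee (f n) = (ee (f n) - ee (f (Suc n))) * z n" if "a \<le> n" "n < b" for n
  proof -
    have s: "sin (pi * g n) \<noteq> 0" using gr[OF that] th sin_gt_zero[of "pi * g n"] by auto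
    have "f (Suc n) = f n + g n + of_int j" by (simp add: g_def)
    hence "ee (f (Suc n)) = ee (f n) * ee (g n)" by (simp add: ee_add)
    hence "(ee (f n) - ee (f (Suc n))) * z n = ee (f n) * ((1 - ee (g n)) * z n)"
      by (simp add: algebra_simps)
    also have "(1 - ee (g n)) * z n = 1"
    proof -
      have "1 - ee (g n) \<noteq> 0" using s unfolding one_minus_ee by simp
      thus ?thesis unfolding z_def inverse_one_minus_ee[OF s, symmetric] by simp
    qed
    finally show ?thesis by simp
  qed
  have abel: "(\<Sum>n=a..<c. ee (f n)) = ee (f a) * z a - ee (f c) * z (c - 1)
      + (\<Sum>n=a..<c - 1. ee (f (Suc n)) * (z (Suc n) - z n))"
    if "a < c" "c \<le> b" for c
    using that
  proof (induction c rule: nat_less_induct)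
    case (1 c)
    show ?case
    proof (cases "a < c - 1")
      case True
      define c' where "c' = c - 1"
      have c: "c = Suc c'" "a < c'" using True 1 by (auto simp: c'_def)
      have IH: "(\<Sum>n=a..<c'. ee (f n)) = ee (f a) * z a - ee (f c') * z (c' - 1)
      + (\<Sum>n=a..<c' - 1. ee (f (Suc n)) * (z (Suc n) - z n))"
        using 1 c by auto
      obtain c'' where c'': "c' = Suc c''" using c by (cases c') auto
      have e: "ee (f c') = (ee (f c') - ee (f (Suc c'))) * z c'" using eq[of c'] c 1 by auto
      have "a \<le> c''" using c c'' by simp
      have "(\<Sum>n=a..<c. ee (f n)) = (\<Sum>n=a..<c'. ee (f n)) + (ee (f c') - ee (f (Suc c'))) * z c'"
        using c e by simp
      also have "... = ee (f a) * z a - ee (f c) * z (c - 1)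
          + (\<Sum>n=a..<c - 1. ee (f (Suc n)) * (z (Suc n) - z n))"
        unfolding IH using c c'' \<open>a \<le> c''\<close> by (simp add: algebra_simps)
      finally show ?thesis .
    next
      case False
      hence c: "c = Suc a" using 1 by auto
      show ?thesis using eq[of a] 1 unfolding c by (simp add: algebra_simps)
    qed
  qed
  have tel: "?s
     = (\<Sum>n=a..<b - 1. cot (pi * g n) / 2 - cot (pi * g (Suc n)) / 2)"
  proof (rule sum.cong)
    fix n assume n: "n \<in> {a..<b - 1}"
    have "cot (pi * g (Suc n)) \<le> cot (pi * g n)"
    proof (intro cot_pi_antimono)
      have nb: "a \<le> n" "n < b" "Suc n < b" using n by auto
      show "0 < g n" "g (Suc n) < 1" using gr[of n] gr[of "Suc n"] nb th by auto
      show "g n \<le> g (Suc n)" using mono[of n] nb by (auto simp: g_def)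
    qed
    moreover have "z (Suc n) - z n = Complex 0 (cot (pi * g (Suc n)) / 2 - cot (pi * g n) / 2)"
      by (simp add: z_def complex_eq_iff)
    ultimately show "norm (ee (f (Suc n)) * (z (Suc n) - z n)) = cot (pi * g n) / 2 - cot (pi * g (Suc n)) / 2"
      by (simp add: norm_mult complex_norm)
  qed auto
  also have "... = cot (pi * g a) / 2 - cot (pi * g (b - 1)) / 2"
    using True sum_Suc_diff'[of a "b - 1" "\<lambda>n. - cot (pi * g n) / 2"] by simp
  also have "... \<le> 1 / (2 * \<theta>)" 
  proof -
    have "a \<le> b - 1" "b - 1 < b" using True by auto
    from cotb[OF this] cotb[of a] True show ?thesis by auto
  qed
  finally have t: "?s \<le> 1 / (2 * \<theta>)" .
  have sz: "norm (z n) \<le> 1 / (4 * \<theta>)" if "a \<le> n" "n < b" for n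
  proof -
    have sp: "sin (pi * g n) \<ge> 2 * \<theta>" using sin_pi_ge gr[OF that] th by simp
    hence "sin (pi * g n) \<noteq> 0" using th by linarith
    hence "z n = inverse (1 - ee (g n))" unfolding z_def by (simp add: inverse_one_minus_ee)
    hence "norm (z n) = 1 / (2 * sin (pi * g n))" 
      using sp th by (simp add: norm_inverse norm_one_minus_ee inverse_eq_divide norm_divide)
    also have "... \<le> 1 / (4 * \<theta>)" using sp th by (intro divide_left_mono) auto
    finally show ?thesis .
  qed
  have "norm (\<Sum>n=a..<b. ee (f n)) \<le> norm (ee (f a) * z a - ee (f b) * z (b - 1))
      + norm (\<Sum>n=a..<b - 1. ee (f (Suc n)) * (z (Suc n) - z n))"
    unfolding abel[OF True order_refl] by (rule norm_triangle_ineq)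
  also have "... \<le> (norm (ee (f a) * z a) + norm (ee (f b) * z (b - 1)))
      + ?s"
    by (intro add_mono norm_triangle_ineq4 norm_sum)
  \<comment> \<open>Two boundary terms of size |z| <= 1/(4 \<theta>), since |1 - ee g| = 2 sin (pi
    g) >= 4 \<theta>, and the total variation of the monotone imaginary part of z.\<close>
  also have "... \<le> (1 / (4 * \<theta>) + 1 / (4 * \<theta>)) + 1 / (2 * \<theta>)"
    using sz[of a] sz[of "b-1"] True t by (intro add_mono) (auto simp: norm_mult)
  also have "... = 1 / \<theta>" using th by (simp add: field_simps)
  finally show ?thesis .
qed

text \<open>Discrete form of van der Corput's second derivative test. The first differences g
  increase, so the range splits into at most \<kappa> \<mu> (b - a) + 2 intervals on which the
  integer part j of g is constant. On each of them \<open>Kusmin_Landau\<close> applies where g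
  stays at distance \<theta> from j and j + 1, and the remaining terms are counted trivially; one
  interval costs at most 4/\<theta>.\<close>

lemma second_difference_test:
  fixes f :: "nat \<Rightarrow> real"
  assumes lam: "0 < \<mu>" and kap: "1 \<le> \<kappa>"
  assumes d2: "\<And>m. a \<le> m \<Longrightarrow> m < b \<Longrightarrow>
    \<mu> \<le> f m - 2 * f (Suc m) + f (Suc (Suc m)) \<and> f m - 2 * f (Suc m) + f (Suc (Suc m)) \<le> \<kappa> * \<mu>"
  shows "norm (\<Sum>m=a..<b. ee (f m)) \<le> 4 * \<kappa> * real (b - a) * sqrt \<mu> + 8 / sqrt \<mu>"
proof (cases "a < b \<and> \<mu> \<le> 1/4")
  case False
  show ?thesis
  proof (cases "a < b")
    case True
    hence "sqrt \<mu> \<ge> sqrt (1/4)" using False by (intro real_sqrt_le_mono) auto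
    hence s: "sqrt \<mu> \<ge> 1/2" by (simp add: real_sqrt_divide)
    have "norm (\<Sum>m=a..<b. ee (f m)) \<le> (\<Sum>m=a..<b. norm (ee (f m)))" by (rule norm_sum)
    also have "... = real (b - a)" by simp
    also have "... \<le> real (b - a) * (4 * \<kappa> * sqrt \<mu>)"
      using mult_mono[of 1 "\<kappa>" 1 "4 * sqrt \<mu>"] s kap by (intro mult_le_cancel_left1[THEN iffD2]) auto
    finally show ?thesis using lam by (auto intro: add_increasing2 simp: mult_ac)
  qed (use lam kap in auto)
next
  case True
  define g where "g m = f (Suc m) - f m" for m
  have g_step: "\<mu> \<le> g (Suc m) - g m" "g (Suc m) - g m \<le> \<kappa> * \<mu>" if "a \<le> m" "m < b" for m
    using d2[OF that] by (auto simp: g_def)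
  have g_diff: "\<mu> * real (m' - m) \<le> g m' - g m \<and> g m' - g m \<le> \<kappa> * \<mu> * real (m' - m)"
    if "a \<le> m" "m \<le> m'" "m' \<le> b" for m m'
    using that(2,3)
  proof (induction m' rule: dec_induct)
    case (step k)
    have "\<mu> \<le> g (Suc k) - g k" "g (Suc k) - g k \<le> \<kappa> * \<mu>" using g_step[of k] step that(1) by auto
    moreover have "real (Suc k - m) = real (k - m) + 1" using step by simp
    ultimately show ?case using step by (simp add: algebra_simps)
  qed auto
  have g_mono: "g m \<le> g m'" if "a \<le> m" "m \<le> m'" "m' \<le> b" for m m'
    using g_diff[OF that] lam by (smt (verit) mult_nonneg_nonneg of_nat_0_le_iff)
  \<comment> \<open>This choice balances the two contributions: g advances by at least \<mu> per
    step, so a window of length \<theta> holds at most \<theta>/\<mu> + 1 = 1/\<theta> + 1 terms,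
    comparable to the 1/\<theta> of \<open>Kusmin_Landau\<close>. The assumption \<mu> <= 1/4 gives
    \<theta> <= 1/2; for larger \<mu> the trivial bound was enough.\<close>
  define \<theta> where "\<theta> = sqrt \<mu>"
  have th: "\<theta> > 0" "\<theta> * \<theta> = \<mu>" using lam by (auto simp: \<theta>_def)
  have "\<theta> \<le> sqrt (1/4)" using True unfolding \<theta>_def by (intro real_sqrt_le_mono) auto
  hence th2: "\<theta> \<le> 1/2" by (simp add: real_sqrt_divide)
  have short: "real (card {m\<in>{a..<b}. P m}) \<le> 1 / \<theta> + 1"
    if P: "\<And>m m'. P m \<Longrightarrow> P m' \<Longrightarrow> g m' - g m \<le> \<theta>" for P
  proof (cases "{m\<in>{a..<b}. P m} = {}")
    case True
    show ?thesis unfolding True using th by simp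
  next
    case False
    define B where "B = {m\<in>{a..<b}. P m}"
    have B: "finite B" "B \<noteq> {}" using False by (auto simp: B_def)
    hence mm: "Min B \<in> B" "Max B \<in> B" "Min B \<le> Max B" by auto
    have "B \<subseteq> {Min B..Max B}" using B by auto
    hence "card B \<le> card {Min B..Max B}" by (intro card_mono) auto
    hence c: "real (card B) \<le> real (Max B - Min B) + 1" using mm by simp
    have "\<mu> * real (Max B - Min B) \<le> g (Max B) - g (Min B)"
      using g_diff[of "Min B" "Max B"] mm by (auto simp: B_def)
    also have "... \<le> \<theta>" using mm P by (auto simp: B_def)
    finally have "\<theta> * (\<theta> * real (Max B - Min B)) \<le> \<theta> * 1" using th(2) by (simp add: mult.assoc[symmetric])
    hence "\<theta> * real (Max B - Min B) \<le> 1" using th(1) by simp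
    hence "real (Max B - Min B) \<le> 1 / \<theta>" using th(1) by (simp add: field_simps)
    thus ?thesis using c unfolding B_def by simp
  qed
  have seg: "norm (\<Sum>m | m \<in> {a..<b} \<and> \<lfloor>g m\<rfloor> = j. ee (f m)) \<le> 4 / \<theta>" for j
  proof -
    define A1 where "A1 = {m\<in>{a..<b}. of_int j \<le> g m \<and> g m < of_int j + \<theta>}"
    define A2 where "A2 = {m\<in>{a..<b}. of_int j + \<theta> \<le> g m \<and> g m \<le> of_int j + 1 - \<theta>}"
    define A3 where "A3 = {m\<in>{a..<b}. of_int j + 1 - \<theta> < g m \<and> g m < of_int j + 1}"
    have U: "{m. m \<in> {a..<b} \<and> \<lfloor>g m\<rfloor> = j} = A1 \<union> A2 \<union> A3"
      unfolding A1_def A2_def A3_def using th th2 by (auto simp: floor_eq_iff)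
    have c1: "real (card A1) \<le> 1 / \<theta> + 1" unfolding A1_def by (rule short) auto
    have c3: "real (card A3) \<le> 1 / \<theta> + 1" unfolding A3_def by (rule short) auto
    have n2: "norm (\<Sum>m\<in>A2. ee (f m)) \<le> 1 / \<theta>"
    proof (cases "A2 = {}")
      case True
      thus ?thesis using th by simp
    next
      case False
      have fin: "finite A2" by (simp add: A2_def)
      hence mm: "Min A2 \<in> A2" "Max A2 \<in> A2" using False by auto
      have sub: "{Min A2..<Suc (Max A2)} \<subseteq> A2"
      proof
          fix m assume m: "m \<in> {Min A2..<Suc (Max A2)}"
          have "g (Min A2) \<le> g m" "g m \<le> g (Max A2)"
            using m mm by (auto intro!: g_mono simp: A2_def)
          thus "m \<in> A2" using m mm by (auto simp: A2_def)
      qed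
      hence A2_eq: "A2 = {Min A2..<Suc (Max A2)}"
        using fin by (intro equalityI) (auto simp: less_Suc_eq_le)
      have "norm (\<Sum>m=Min A2..<Suc (Max A2). ee (f m)) \<le> 1 / \<theta>"
      proof (rule Kusmin_Landau[OF th(1) th2])
        fix n assume n: "Min A2 \<le> n" "n < Suc (Max A2)"
        hence "n \<in> A2" using sub by auto
        thus "of_int j + \<theta> \<le> f (Suc n) - f n \<and> f (Suc n) - f n \<le> of_int j + 1 - \<theta>"
          by (simp add: A2_def g_def)
      next
        fix n assume n: "Min A2 \<le> n" "Suc n < Suc (Max A2)"
        show "f (Suc n) - f n \<le> f (Suc (Suc n)) - f (Suc n)"
          using g_mono[of n "Suc n"] n mm by (simp add: A2_def g_def)
      qed
      thus ?thesis unfolding A2_eq[symmetric] .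
    qed
    have triv: "norm (\<Sum>m\<in>A. ee (f m)) \<le> real (card A)" for A
      using norm_sum[of "\<lambda>m. ee (f m)" A] by simp
    have fin: "finite A1" "finite A2" "finite A3" by (auto simp: A1_def A2_def A3_def)
    have dis: "A1 \<inter> A2 = {}" "(A1 \<union> A2) \<inter> A3 = {}"
      unfolding A1_def A2_def A3_def using th2 by auto
    have "norm (\<Sum>m\<in>A1 \<union> A2 \<union> A3. ee (f m))
        = norm ((\<Sum>m\<in>A1. ee (f m)) + (\<Sum>m\<in>A2. ee (f m)) + (\<Sum>m\<in>A3. ee (f m)))"
      using fin dis by (simp add: sum.union_disjoint)
    also have "... \<le> norm (\<Sum>m\<in>A1. ee (f m)) + norm (\<Sum>m\<in>A2. ee (f m)) + norm (\<Sum>m\<in>A3. ee (f m))"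
      by (intro order_trans[OF norm_triangle_ineq] add_mono norm_triangle_ineq order_refl)
    also have "... \<le> (1/\<theta> + 1) + 1/\<theta> + (1/\<theta> + 1)"
      using triv[of A1] triv[of A3] c1 c3 n2 by (intro add_mono) auto
    also have "... \<le> 4 / \<theta>"
    proof -
      have "2 \<le> 1 / \<theta>" using th th2 by (simp add: le_divide_eq)
      moreover have "4 / \<theta> = 4 * (1 / \<theta>)" by simp
      ultimately show ?thesis by linarith
    qed
    finally show ?thesis unfolding U .
  qed
  define J where "J = {\<lfloor>g a\<rfloor>..\<lfloor>g b\<rfloor>}"
  have J: "real (card J) \<le> \<kappa> * \<mu> * real (b - a) + 2"
  proof -
    have gab: "g a \<le> g b" using g_mono[of a b] True by simp
    hence "\<lfloor>g a\<rfloor> \<le> \<lfloor>g b\<rfloor>" by (rule floor_mono)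
    hence "real (card J) = of_int \<lfloor>g b\<rfloor> - of_int \<lfloor>g a\<rfloor> + 1" by (simp add: J_def)
    also have "... \<le> g b - g a + 2" by linarith
    finally show ?thesis using g_diff[of a b] True by simp
  qed
  have "(\<Sum>m=a..<b. ee (f m)) = (\<Sum>j\<in>J. \<Sum>m | m \<in> {a..<b} \<and> \<lfloor>g m\<rfloor> = j. ee (f m))"
  proof (rule sum.group[symmetric])
    show "(\<lambda>m. \<lfloor>g m\<rfloor>) ` {a..<b} \<subseteq> J"
      unfolding J_def using g_mono by (auto intro!: floor_mono)
  qed (auto simp: J_def)
  hence "norm (\<Sum>m=a..<b. ee (f m)) \<le> (\<Sum>j\<in>J. norm (\<Sum>m | m \<in> {a..<b} \<and> \<lfloor>g m\<rfloor> = j. ee (f m)))"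
    by (simp add: norm_sum)
  also have "... \<le> real (card J) * (4 / \<theta>)" using seg by (rule sum_bounded_above)
  also have "... \<le> (\<kappa> * \<mu> * real (b - a) + 2) * (4 / \<theta>)"
    using J th by (intro mult_right_mono) auto
  also have "... = 4 * \<kappa> * real (b - a) * \<theta> + 8 / \<theta>"
    unfolding th(2)[symmetric] using th(1) by (simp add: field_simps)
  finally show ?thesis unfolding \<theta>_def .
qed

section \<open>The Fourier series of the sawtooth\<close>

text \<open>Up to a constant, b is the periodic second Bernoulli polynomial, with derivative 2 (frac
  t - 1/2) between integers. Both relations are equalities unless the interval crosses an integer.
  Crossing only helps: the periodic b lies below the continuation of each of its parabolic
  branches.\<close>

lemma frac_smoothing:
  fixes t \<eta> :: real
  assumes "0 < \<eta>" "\<eta> < 1"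
  defines "b \<equiv> \<lambda>t::real. (frac t)^2 - frac t"
  shows "b (t + \<eta>) - b t \<le> 2 * \<eta> * (frac t - 1/2) + \<eta>^2"
    and "b t - b (t - \<eta>) \<ge> 2 * \<eta> * (frac t - 1/2) - \<eta>^2"
proof -
  have e: "frac \<eta> = \<eta>" using assms by (simp add: frac_eq)
  have 1: "frac (t + \<eta>) = (if frac t + \<eta> < 1 then frac t + \<eta> else frac t + \<eta> - 1)"
    by (simp add: frac_add e)
  have 2: "frac (t - \<eta>) = (if frac t \<ge> \<eta> then frac t - \<eta> else frac t - \<eta> + 1)"
  proof -
    have "frac t = (if frac (t - \<eta>) + \<eta> < 1 then frac (t - \<eta>) + \<eta> else frac (t - \<eta>) + \<eta> - 1)"
      using frac_add[of "t - \<eta>" \<eta>] by (simp add: e)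
    thus ?thesis using frac_lt_1[of "t - \<eta>"] frac_ge_0[of "t - \<eta>"] by (auto split: if_splits)
  qed
  show "b (t + \<eta>) - b t \<le> 2 * \<eta> * (frac t - 1/2) + \<eta>^2"
    unfolding b_def 1 by (auto simp: power2_eq_square algebra_simps)
  show "b t - b (t - \<eta>) \<ge> 2 * \<eta> * (frac t - 1/2) - \<eta>^2"
    unfolding b_def 2 by (auto simp: power2_eq_square algebra_simps)
qed

lemma norm_geometric_ee:
  assumes "sin (pi * t) \<noteq> 0"
  shows "norm (\<Sum>j<L. ee (real j * t)) \<le> 1 / \<bar>sin (pi * t)\<bar>"
proof -
  have "(\<Sum>j<L. ee (real j * t)) = (\<Sum>j<L. ee t ^ j)"
    by (intro sum.cong) (auto simp: ee_def Complex.DeMoivre mult_ac)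
  hence "(1 - ee t) * (\<Sum>j<L. ee (real j * t)) = 1 - ee t ^ L"
    by (simp add: one_diff_power_eq)
  hence "norm (1 - ee t) * norm (\<Sum>j<L. ee (real j * t)) = norm (1 - ee t ^ L)"
    by (metis norm_mult)
  also have "... \<le> 2" using norm_triangle_ineq4[of 1 "ee t ^ L"] by (simp add: norm_power)
  also have "norm (1 - ee t) = 2 * \<bar>sin (pi * t)\<bar>" by (rule norm_one_minus_ee)
  finally show ?thesis using assms by (simp add: field_simps)
qed

text \<open>In the induction the term ee (L t) raises the square by 1 + 2 Re (A cnj (ee (L t))),
  which is the Dirichlet kernel of order L. The square form gives the sign of the kernel, and
  through the geometric sum its size away from the integers.\<close>

lemma Fejer_kernel_square:
  "(\<Sum>j<L. 1 + 2 * (\<Sum>h=1..j. cos (2 * pi * real h * t))) = (norm (\<Sum>j<L. ee (real j * t)))^2"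
proof (induction L)
  case (Suc L)
  define A where "A = (\<Sum>j<L. ee (real j * t))"
  have "(norm (A + ee (real L * t)))^2 = (norm A)^2 + 2 * Re (A * cnj (ee (real L * t))) + 1"
  proof -
    have "complex_of_real ((norm (A + ee (real L * t)))^2)
      = (A + ee (real L * t)) * cnj (A + ee (real L * t))" by (rule complex_norm_square)
    hence "(norm (A + ee (real L * t)))^2 = Re ((A + ee (real L * t)) * cnj (A + ee (real L * t)))"
      by (metis Re_complex_of_real)
    also have "... = Re (A * cnj A) + Re (ee (real L * t) * cnj (ee (real L * t)))
        + (Re (A * cnj (ee (real L * t))) + Re (ee (real L * t) * cnj A))"
      by (simp add: algebra_simps)
    also have "Re (ee (real L * t) * cnj A) = Re (A * cnj (ee (real L * t)))"
      by (simp add: algebra_simps)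
    also have "Re (A * cnj A) = (norm A)^2" by (simp add: complex_mult_cnj cmod_power2)
    also have "Re (ee (real L * t) * cnj (ee (real L * t))) = 1"
      by (simp add: cnj_ee flip: ee_add)
    finally show ?thesis by simp
  qed
  moreover have "Re (A * cnj (ee (real L * t))) = (\<Sum>h=1..L. cos (2 * pi * real h * t))"
  proof -
    have "Re (A * cnj (ee (real L * t))) = (\<Sum>j<L. cos (2 * pi * (real j * t - real L * t)))"
      by (simp add: A_def sum_distrib_right cnj_ee Re_ee flip: ee_add)
    also have "... = (\<Sum>h=1..L. cos (2 * pi * real h * t))"
    proof (rule sum.reindex_bij_witness[of _ "\<lambda>h. L - h" "\<lambda>j. L - j"])
      fix j assume "j \<in> {..<L}"
      hence "2 * pi * real (L - j) * t = - (2 * pi * (real j * t - real L * t))"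
        by (simp add: of_nat_diff algebra_simps)
      thus "cos (2 * pi * real (L - j) * t) = cos (2 * pi * (real j * t - real L * t))"
        by (metis cos_minus)
    qed auto
    finally show ?thesis .
  qed
  ultimately show ?case using Suc by (simp add: A_def)
qed simp

text \<open>The cosine series of the parabola converges absolutely, so its sum can be found from its
  Fejer means.\<close>

lemma Cesaro_mean_tendsto:
  fixes X :: "nat \<Rightarrow> real"
  assumes "X \<longlonglongrightarrow> l"
  shows "(\<lambda>L. (\<Sum>j<L. X j) / real L) \<longlonglongrightarrow> l"
proof (rule LIMSEQ_I)
  fix r :: real assume r: "r > 0"
  then obtain N where N: "\<And>n. n \<ge> N \<Longrightarrow> \<bar>X n - l\<bar> < r / 2"
    using LIMSEQ_D[OF assms, of "r/2"] by auto
  define K where "K = (\<Sum>j<N. \<bar>X j - l\<bar>)"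
  obtain M where M: "real M > 2 * K / r" using reals_Archimedean2 by blast
  show "\<exists>no. \<forall>L\<ge>no. norm ((\<Sum>j<L. X j) / real L - l) < r"
  proof (intro exI allI impI)
    fix L assume L: "L \<ge> max (max N M) 1"
    have L0: "real L > 0" using L by simp
    have "\<bar>(\<Sum>j<L. X j) - real L * l\<bar> = \<bar>\<Sum>j<L. (X j - l)\<bar>" by (simp add: sum_subtractf)
    also have "... \<le> (\<Sum>j<L. \<bar>X j - l\<bar>)" by (rule sum_abs)
    also have "... = K + (\<Sum>j=N..<L. \<bar>X j - l\<bar>)"
    proof -
      have "{..<L} = {..<N} \<union> {N..<L}" using L by auto
      thus ?thesis unfolding K_def by (simp add: sum.union_disjoint ivl_disj_int)
    qed
    also have "(\<Sum>j=N..<L. \<bar>X j - l\<bar>) \<le> real (card {N..<L}) * (r / 2)"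
      using N by (intro sum_bounded_above) (auto intro: less_imp_le)
    also have "real (card {N..<L}) * (r / 2) \<le> real L * (r/2)"
      using r by (intro mult_right_mono) auto
    also have "K < real L * (r/2)"
    proof -
      have "2 * K / r < real L" using M L by linarith
      thus ?thesis using r by (simp add: field_simps)
    qed
    finally have a: "\<bar>(\<Sum>j<L. X j) - real L * l\<bar> < real L * r" by (simp add: mult.commute)
    have "(\<Sum>j<L. X j) / real L - l = ((\<Sum>j<L. X j) - real L * l) / real L"
      using L0 by (simp add: field_simps)
    hence "\<bar>(\<Sum>j<L. X j) / real L - l\<bar> = \<bar>(\<Sum>j<L. X j) - real L * l\<bar> / real L" by simp
    also have "... < r" using a L0 by (simp add: field_simps)
    finally show "norm ((\<Sum>j<L. X j) / real L - l) < r" by simp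
  qed
qed

lemma summable_cos_over_square: "summable (\<lambda>h. cos (2 * pi * real (Suc h) * t) / (pi^2 * (real (Suc h))^2))"
proof (rule summable_comparison_test')
  have "(\<lambda>h. 1 / (real (Suc h))^2) = (\<lambda>n. 1 / (real n + 1)^2)" by (simp add: add.commute)
  thus "summable (\<lambda>h. 1 / (real (Suc h))^2)"
    using sums_summable[OF inverse_squares_sums] by simp
  fix h :: nat
  have "pi^2 \<ge> 1^2" using pi_gt3 by (intro power_mono) auto
  hence "(real (Suc h))^2 \<le> pi^2 * (real (Suc h))^2"
    using mult_right_mono[of 1 "pi^2" "(real (Suc h))^2"] by simp
  hence "\<bar>cos (2 * pi * real (Suc h) * t)\<bar> / (pi^2 * (real (Suc h))^2) \<le> 1 / (real (Suc h))^2"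
    by (intro frac_le abs_cos_le_one) auto
  thus "norm (cos (2 * pi * real (Suc h) * t) / (pi^2 * (real (Suc h))^2)) \<le> 1 / (real (Suc h))^2"
    by (simp only: real_norm_def abs_divide abs_mult abs_power2)
qed

text \<open>The Cesaro means \<open>E\<close> of the Fourier series minus the parabola have second derivative \<open>-2\<close> times the
  Fejer kernel: \<open>E\<close> is concave, and almost flat away from the end points.\<close>

lemma Fourier_parabola_Cesaro:
  fixes L :: nat and t \<gamma> :: real
  assumes L: "L > 0" and t: "0 \<le> t" "t \<le> 1" and gam: "0 < \<gamma>" "\<gamma> < 1/2"
  defines "E \<equiv> \<lambda>t::real. (\<Sum>j<L. \<Sum>h=1..j. cos (2 * pi * real h * t) / (pi^2 * (real h)^2)) / real L - (t^2 - t)"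
  shows "\<bar>E t - E (1/2)\<bar> \<le> \<gamma> + 1 / (2 * real L * \<gamma>^2)"
proof -
  define E1 where "E1 = (\<lambda>t::real. (\<Sum>j<L. \<Sum>h=1..j. - 2 * sin (2 * pi * real h * t) / (pi * real h)) / real L - (2 * t - 1))"
  define E2 where "E2 = (\<lambda>t::real. - 2 / real L * (norm (\<Sum>j<L. ee (real j * t)))^2)"
  have dc: "((\<lambda>t. cos (2 * pi * real h * t) / (pi^2 * (real h)^2)) has_real_derivative
      - 2 * sin (2 * pi * real h * s) / (pi * real h)) (at s)" if "h \<in> {1..j}" for h j :: nat and s
  proof -
    have "((\<lambda>t. cos (2 * pi * real h * t)) has_real_derivative
        - sin (2 * pi * real h * s) * (2 * pi * real h)) (at s)"
      by (auto intro!: derivative_eq_intros)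
    from DERIV_cdivide[OF this, of "pi^2 * (real h)^2"] show ?thesis
      using that by (simp add: power2_eq_square mult_ac)
  qed
  have ds: "((\<lambda>t. - 2 * sin (2 * pi * real h * t) / (pi * real h)) has_real_derivative
      - 4 * cos (2 * pi * real h * s)) (at s)" if "h \<in> {1..j}" for h j :: nat and s
  proof -
    have "((\<lambda>t. - 2 * sin (2 * pi * real h * t)) has_real_derivative
        - 2 * (cos (2 * pi * real h * s) * (2 * pi * real h))) (at s)"
      by (auto intro!: derivative_eq_intros)
    from DERIV_cdivide[OF this, of "pi * real h"] show ?thesis
      using that by simp
  qed
  have dE: "(E has_real_derivative E1 s) (at s)" for s
  proof -
    have "((\<lambda>t. t^2 - t) has_real_derivative 2 * s - 1) (at s)"
      by (auto intro!: derivative_eq_intros)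
    from this show ?thesis unfolding E_def E1_def
      by (rule DERIV_diff[rotated]) (intro DERIV_cdivide DERIV_sum dc)
  qed
  have dE1: "(E1 has_real_derivative E2 s) (at s)" for s
  proof -
    have x: "- 2 * (1 + 2 * (\<Sum>h=1..j. cos (2 * pi * real h * s)))
        = (\<Sum>h=1..j. - 4 * cos (2 * pi * real h * s)) - 2" for j :: nat
      unfolding sum_distrib_left[symmetric] by (simp only: algebra_simps)
    have "E2 s = - 2 * (\<Sum>j<L. 1 + 2 * (\<Sum>h=1..j. cos (2 * pi * real h * s))) / real L"
      unfolding E2_def Fejer_kernel_square by simp
    also have "... = (\<Sum>j<L. (\<Sum>h=1..j. - 4 * cos (2 * pi * real h * s)) - 2) / real L"
      unfolding x[symmetric] sum_distrib_left ..
    also have "... = (\<Sum>j<L. \<Sum>h=1..j. - 4 * cos (2 * pi * real h * s)) / real L - 2"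
      using L by (simp add: sum_subtractf diff_divide_distrib)
    finally have e: "E2 s = (\<Sum>j<L. \<Sum>h=1..j. - 4 * cos (2 * pi * real h * s)) / real L - 2" .
    have "((\<lambda>t::real. 2 * t - 1) has_real_derivative 2) (at s)"
      by (auto intro!: derivative_eq_intros)
    from this show ?thesis unfolding e E1_def
      by (rule DERIV_diff[rotated]) (intro DERIV_cdivide DERIV_sum ds)
  qed
  have E2_le: "E2 s \<le> 0" for s using L by (simp add: E2_def)
  have E1_mono: "E1 u \<le> E1 s" if "s \<le> u" for s u
    by (rule DERIV_nonpos_imp_nonincreasing[OF that]) (use dE1 E2_le in blast)
  have sin_int: "sin (2 * pi * real h) = 0" "sin (2 * pi * real h * (1/2)) = 0" for h
    using sin_npi2[of h] sin_npi2[of "2 * h"] by (auto simp: mult_ac)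
  have E1_0: "E1 0 = 1" by (simp add: E1_def)
  have E1_1: "E1 1 = -1" unfolding E1_def using sin_int(1) by simp
  have E1_h: "E1 (1/2) = 0" unfolding E1_def sin_int(2) by simp
  \<comment> \<open>\<open>E1\<close> decreases from 1 at 0 to -1 at 1, because \<open>E2\<close> is
    nonpositive.\<close>
  have E1_le: "\<bar>E1 s\<bar> \<le> 1" if "s \<in> {0..1}" for s
    using E1_mono[of 0 s] E1_mono[of s 1] E1_0 E1_1 that by auto
  have E2_bd: "\<bar>E2 s\<bar> \<le> 1 / (2 * real L * \<gamma>^2)" if "s \<in> {\<gamma>..1-\<gamma>}" for s
  proof -
    have s: "sin (pi * s) \<ge> 2 * \<gamma>" using that gam by (intro sin_pi_ge) auto
    hence "norm (\<Sum>j<L. ee (real j * s)) \<le> 1 / \<bar>sin (pi * s)\<bar>"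
      using gam by (intro norm_geometric_ee) auto
    also have "... \<le> 1 / (2 * \<gamma>)" using s gam by (simp add: frac_le)
    finally have "(norm (\<Sum>j<L. ee (real j * s)))^2 \<le> (1 / (2 * \<gamma>))^2" by (intro power_mono) auto
    hence "2 / real L * (norm (\<Sum>j<L. ee (real j * s)))^2 \<le> 2 / real L * (1 / (2 * \<gamma>))^2"
      using L by (intro mult_left_mono) auto
    thus ?thesis using L gam by (simp add: E2_def power2_eq_square abs_mult field_simps)
  qed
  define K where "K = 1 / (2 * real L * \<gamma>^2)"
  have K: "K \<ge> 0" by (simp add: K_def)
  have E1_mid: "\<bar>E1 s\<bar> \<le> K" if "s \<in> {\<gamma>..1-\<gamma>}" for s
  proof -
    have "norm (E1 s - E1 (1/2)) \<le> K * norm (s - 1/2)"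
    proof (rule field_differentiable_bound)
      show "convex {\<gamma>..1-\<gamma>}" by simp
      show "(E1 has_field_derivative E2 z) (at z within {\<gamma>..1-\<gamma>})" for z
        using dE1 by (rule DERIV_subset) simp
      show "norm (E2 z) \<le> K" if "z \<in> {\<gamma>..1-\<gamma>}" for z using E2_bd[OF that] by (simp add: K_def)
    qed (use that gam in auto)
    also have "... \<le> K * 1" using that gam K by (intro mult_left_mono) auto
    finally show ?thesis using E1_h by simp
  qed
  have lip: "norm (E u - E v) \<le> B * norm (u - v)"
    if "convex S" "u \<in> S" "v \<in> S" "\<And>z. z \<in> S \<Longrightarrow> \<bar>E1 z\<bar> \<le> B" for S u v B
    by (rule field_differentiable_bound[OF that(1) _ _ that(2,3)])
       (use dE that(4) in \<open>auto intro: DERIV_subset\<close>)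
  have mid: "\<bar>E s - E (1/2)\<bar> \<le> K" if "s \<in> {\<gamma>..1-\<gamma>}" for s
  proof -
    have "norm (E s - E (1/2)) \<le> K * norm (s - 1/2)"
      by (rule lip[of "{\<gamma>..1-\<gamma>}"]) (use that gam E1_mid in auto)
    also have "... \<le> K * 1" using that gam K by (intro mult_left_mono) auto
    finally show ?thesis by simp
  qed
  \<comment> \<open>A point closer than \<gamma> to an end point is first moved inwards; by |E1| <=
    1 this costs at most \<gamma>.\<close>
  define s where "s = (if t < \<gamma> then \<gamma> else if t > 1 - \<gamma> then 1 - \<gamma> else t)"
  have s: "s \<in> {\<gamma>..1-\<gamma>}" "\<bar>t - s\<bar> \<le> \<gamma>" using t gam by (auto simp: s_def)
  have "norm (E t - E s) \<le> 1 * norm (t - s)"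
    by (rule lip[of "{0..1}"]) (use t s gam E1_le in auto)
  thus ?thesis using mid[OF s(1)] s(2) by (simp add: K_def)
qed

text \<open>The difference of two values is used so that the constant term of the Fourier series
  never has to be evaluated.\<close>

lemma Fourier_parabola:
  defines "b \<equiv> \<lambda>t::real. (frac t)^2 - frac t"
  shows "(\<lambda>h. (cos (2 * pi * real (Suc h) * t) - cos (2 * pi * real (Suc h) * s)) / (pi^2 * (real (Suc h))^2))
     sums (b t - b s)"
proof -
  define c where "c t h = cos (2 * pi * real (Suc h) * t) / (pi^2 * (real (Suc h))^2)" for t h
  have c_frac: "c (frac t) = c t" for t
  proof
    fix h
    have "cos (2 * pi * real (Suc h) * t) = cos (2 * pi * real (Suc h) * frac t)"
    proof -
      have "2 * pi * real (Suc h) * frac t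
          = 2 * pi * real (Suc h) * t - 2 * pi * of_int (int (Suc h) * \<lfloor>t\<rfloor>)"
        by (simp add: frac_def algebra_simps)
      thus ?thesis using cos_int_2pin[of "int (Suc h) * \<lfloor>t\<rfloor>"] sin_int_2pin[of "int (Suc h) * \<lfloor>t\<rfloor>"]
        by (simp only: cos_diff)
    qed
    thus "c (frac t) h = c t h" by (simp add: c_def)
  qed
  have G: "c t sums suminf (c t)" for t
    unfolding c_def using summable_cos_over_square by (rule summable_sums)
  have main: "suminf (c t) - (t^2 - t) = suminf (c (1/2)) - ((1/2)^2 - 1/2)" if t: "0 \<le> t" "t \<le> 1" for t
  proof -
    define E where "E L t = (\<Sum>j<L. \<Sum>h=1..j. cos (2 * pi * real h * t) / (pi^2 * (real h)^2)) / real L - (t^2 - t)"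
      for L and t :: real
    have E_lim: "(\<lambda>L. E L t) \<longlonglongrightarrow> suminf (c t) - (t^2 - t)" for t
    proof -
      have "(\<Sum>h<j. c t h) = (\<Sum>h=1..j. cos (2 * pi * real h * t) / (pi^2 * (real h)^2))" for j
        unfolding c_def by (rule sum.reindex_bij_witness[of _ "\<lambda>h. h - 1" Suc]) auto
      hence "(\<lambda>j. \<Sum>h=1..j. cos (2 * pi * real h * t) / (pi^2 * (real h)^2)) \<longlonglongrightarrow> suminf (c t)"
        using G[of t] by (simp add: sums_def)
      from tendsto_diff[OF Cesaro_mean_tendsto[OF this] tendsto_const] show ?thesis
        unfolding E_def .
    qed
    let ?d = "\<bar>(suminf (c t) - (t^2 - t)) - (suminf (c (1/2)) - ((1/2)^2 - 1/2))\<bar>"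
    \<comment> \<open>First L tends to infinity with \<gamma> fixed, and only afterwards \<gamma> to
      0.\<close>
    have "?d \<le> \<gamma>" if gam: "0 < \<gamma>" "\<gamma> < 1/2" for \<gamma>
    proof (rule LIMSEQ_le)
      show "(\<lambda>L. \<bar>E L t - E L (1/2)\<bar>) \<longlonglongrightarrow> ?d" by (intro tendsto_intros E_lim)
      have "(\<lambda>L. \<gamma> + 1 / (2 * \<gamma>^2) * (1 / real L)) \<longlonglongrightarrow> \<gamma> + 1 / (2 * \<gamma>^2) * 0"
        by (intro tendsto_intros lim_1_over_n)
      thus "(\<lambda>L. \<gamma> + 1 / (2 * real L * \<gamma>^2)) \<longlonglongrightarrow> \<gamma>" by (simp add: mult_ac)
      show "\<exists>N. \<forall>n\<ge>N. \<bar>E n t - E n (1/2)\<bar> \<le> \<gamma> + 1 / (2 * real n * \<gamma>^2)"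
        unfolding E_def using Fourier_parabola_Cesaro[OF _ t gam] by (intro exI[of _ 1]) auto
    qed
    note lim = this
    have "?d \<le> 0 + e" if "e > 0" for e
      using lim[of "min e (1/4)"] that by (simp add: min_le_iff_disj)
    hence "?d \<le> 0" by (rule field_le_epsilon)
    thus ?thesis by simp
  qed
  have "suminf (c t) - suminf (c s) = b t - b s"
    using main[of "frac t"] main[of "frac s"]
    by (simp add: b_def c_frac frac_lt_1 less_imp_le)
  moreover have "(\<lambda>h. c t h - c s h) sums (suminf (c t) - suminf (c s))"
    by (intro sums_diff G)
  ultimately show ?thesis by (simp add: c_def diff_divide_distrib)
qed

lemma sum_inverse_squares_tail:
  assumes "1 \<le> L" "L \<le> M"
  shows "(\<Sum>h=L+1..M. 1 / (real h)^2) \<le> 1 / real L - 1 / real M"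
  using assms(2)
proof (induction M rule: dec_induct)
  case (step M)
  have M: "real M \<ge> 1" using step assms by simp
  have "1 / (real (Suc M))^2 \<le> 1 / (real M * real (Suc M))"
    using M by (intro divide_left_mono) (auto simp: power2_eq_square)
  also have "... = 1 / real M - 1 / real (Suc M)" using M by (simp add: field_simps)
  finally show ?case using step by simp
qed simp

lemma Fourier_parabola_truncated:
  fixes L :: nat
  assumes L: "1 \<le> L"
  defines "b \<equiv> \<lambda>t::real. (frac t)^2 - frac t"
  shows "\<bar>b t - b s - (\<Sum>h=1..L. (cos (2 * pi * real h * t) - cos (2 * pi * real h * s)) / (pi^2 * (real h)^2))\<bar>
     \<le> 1 / real L"
proof -
  define u where "u h = (cos (2 * pi * real h * t) - cos (2 * pi * real h * s)) / (pi^2 * (real h)^2)" for h :: nat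
  have "(\<lambda>h. u (Suc h)) sums (b t - b s)"
    using Fourier_parabola[of t s] unfolding u_def b_def .
  moreover have "(\<Sum>h<M. u (Suc h)) = (\<Sum>h=1..M. u h)" for M
    by (rule sum.reindex_bij_witness[of _ "\<lambda>h. h - 1" Suc]) auto
  ultimately have lim: "(\<lambda>M. \<Sum>h=1..M. u h) \<longlonglongrightarrow> b t - b s" by (simp add: sums_def)
  have u_le: "\<bar>u h\<bar> \<le> 1 / (real h)^2" if "h \<ge> 1" for h
  proof -
    have "\<bar>cos (2 * pi * real h * t) - cos (2 * pi * real h * s)\<bar> \<le> 2"
      using abs_cos_le_one[of "2 * pi * real h * t"] abs_cos_le_one[of "2 * pi * real h * s"] by linarith
    moreover have "pi^2 \<ge> 2"
    proof -
      have "2^2 \<le> pi^2" using pi_gt3 by (intro power_mono) auto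
      thus ?thesis by simp
    qed
    ultimately have "\<bar>cos (2 * pi * real h * t) - cos (2 * pi * real h * s)\<bar> / (pi^2 * (real h)^2)
        \<le> 2 / (2 * (real h)^2)" using that by (intro frac_le mult_right_mono) auto
    thus ?thesis by (simp add: u_def abs_mult)
  qed
  have "\<bar>(\<Sum>h=1..M. u h) - (\<Sum>h=1..L. u h)\<bar> \<le> 1 / real L" if "M \<ge> L" for M
  proof -
    have "{1..M} = {1..L} \<union> {L+1..M}" using that by auto
    hence "(\<Sum>h=1..M. u h) = (\<Sum>h=1..L. u h) + (\<Sum>h=L+1..M. u h)"
      by (simp add: sum.union_disjoint)
    hence "\<bar>(\<Sum>h=1..M. u h) - (\<Sum>h=1..L. u h)\<bar> = \<bar>\<Sum>h=L+1..M. u h\<bar>" by simp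
    also have "... \<le> (\<Sum>h=L+1..M. 1 / (real h)^2)"
      by (intro order_trans[OF sum_abs] sum_mono u_le) auto
    also have "... \<le> 1 / real L - 1 / real M" using L that by (rule sum_inverse_squares_tail)
    also have "... \<le> 1 / real L" by simp
    finally show ?thesis .
  qed
  moreover have "(\<lambda>M. \<bar>(\<Sum>h=1..M. u h) - (\<Sum>h=1..L. u h)\<bar>) \<longlonglongrightarrow> \<bar>b t - b s - (\<Sum>h=1..L. u h)\<bar>"
    by (intro tendsto_intros lim)
  ultimately show ?thesis unfolding u_def[symmetric]
    by (intro LIMSEQ_le_const2) auto
qed

text \<open>Replacing the sawtooth by its average over an interval of length \<open>1 / R\<close> makes the Fourier
  coefficients decay like \<open>R / h\<^sup>2\<close>, so that frequencies beyond \<open>R\<^sup>2\<close> are negligible.\<close>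

lemma sum_sawtooth_le:
  fixes w t :: "nat \<Rightarrow> real" and R :: real
  assumes w: "\<And>d. d \<in> A \<Longrightarrow> w d \<ge> 0" and R: "R > 1" and L: "real L \<ge> R^2"
  shows "\<bar>\<Sum>d\<in>A. w d * (frac (t d) - 1/2)\<bar>
    \<le> (\<Sum>d\<in>A. w d) / R + (\<Sum>h=1..L. min (1 / real h) (R / (real h)^2) * norm (\<Sum>d\<in>A. of_real (w d) * ee (real h * t d)))"
    (is "_ \<le> ?W / R + ?S")
proof -
  define b where "b = (\<lambda>t::real. (frac t)^2 - frac t)"
  define T where "T h = (\<Sum>d\<in>A. of_real (w d) * ee (real h * t d))" for h :: nat
  define \<eta> where "\<eta> = 1 / R"
  have eta: "0 < \<eta>" "\<eta> < 1" using R by (auto simp: \<eta>_def)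
  have "R^2 > 1" using R by (simp add: one_less_power)
  hence L1: "1 \<le> L" using L by linarith
  \<comment> \<open>Both signs of the shift are needed: the forward difference bounds the sawtooth
    from below, the backward one from above.\<close>
  have key: "\<bar>\<Sum>d\<in>A. w d * (b (t d + \<sigma>) - b (t d))\<bar> \<le> ?W / real L + 2 * \<eta> * ?S"
    if sig: "\<bar>\<sigma>\<bar> = \<eta>" for \<sigma>
  proof -
    define u where "u h d = (cos (2 * pi * real h * (t d + \<sigma>)) - cos (2 * pi * real h * t d)) / (pi^2 * (real h)^2)" for h d
    have tr: "\<bar>b (t d + \<sigma>) - b (t d) - (\<Sum>h=1..L. u h d)\<bar> \<le> 1 / real L" for d
      unfolding b_def u_def by (rule Fourier_parabola_truncated[OF L1])
    have "(\<Sum>d\<in>A. w d * (b (t d + \<sigma>) - b (t d)))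
        = (\<Sum>d\<in>A. w d * (b (t d + \<sigma>) - b (t d) - (\<Sum>h=1..L. u h d))) + (\<Sum>d\<in>A. w d * (\<Sum>h=1..L. u h d))"
      by (simp add: algebra_simps flip: sum.distrib)
    also have "(\<Sum>d\<in>A. w d * (\<Sum>h=1..L. u h d)) = (\<Sum>h=1..L. \<Sum>d\<in>A. w d * u h d)"
      unfolding sum_distrib_left by (rule sum.swap)
    finally have "\<bar>\<Sum>d\<in>A. w d * (b (t d + \<sigma>) - b (t d))\<bar>
        \<le> \<bar>\<Sum>d\<in>A. w d * (b (t d + \<sigma>) - b (t d) - (\<Sum>h=1..L. u h d))\<bar> + \<bar>\<Sum>h=1..L. \<Sum>d\<in>A. w d * u h d\<bar>"
      by linarith
    also have "\<bar>\<Sum>d\<in>A. w d * (b (t d + \<sigma>) - b (t d) - (\<Sum>h=1..L. u h d))\<bar> \<le> (\<Sum>d\<in>A. w d * (1 / real L))"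
    proof (intro order_trans[OF sum_abs] sum_mono)
      fix d assume "d \<in> A"
      thus "\<bar>w d * (b (t d + \<sigma>) - b (t d) - (\<Sum>h=1..L. u h d))\<bar> \<le> w d * (1 / real L)"
        unfolding abs_mult using w tr[of d] by (intro mult_mono) auto
    qed
    also have "(\<Sum>d\<in>A. w d * (1 / real L)) = ?W / real L" by (simp add: sum_divide_distrib)
    also have "\<bar>\<Sum>h=1..L. \<Sum>d\<in>A. w d * u h d\<bar>
       \<le> (\<Sum>h=1..L. 2 * \<eta> * (min (1 / real h) (R / (real h)^2) * norm (T h)))"
    proof (rule order_trans[OF sum_abs sum_mono])
      fix h assume "h \<in> {1..L}"
      hence h: "real h \<ge> 1" by simp
      have "Re ((ee (real h * \<sigma>) - 1) * T h) = (\<Sum>d\<in>A. w d * (cos (2 * pi * real h * (t d + \<sigma>)) - cos (2 * pi * real h * t d)))"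
      proof -
        have "(ee (real h * \<sigma>) - 1) * T h = (\<Sum>d\<in>A. of_real (w d) * (ee (real h * (t d + \<sigma>)) - ee (real h * t d)))"
          unfolding T_def sum_distrib_left
          by (intro sum.cong refl) (simp add: ee_add algebra_simps)
        thus ?thesis by (simp add: Re_ee mult.assoc)
      qed
      hence "(\<Sum>d\<in>A. w d * u h d) = Re ((ee (real h * \<sigma>) - 1) * T h) / (pi^2 * (real h)^2)"
        by (simp add: u_def sum_divide_distrib)
      hence "\<bar>\<Sum>d\<in>A. w d * u h d\<bar> = \<bar>Re ((ee (real h * \<sigma>) - 1) * T h)\<bar> / (pi^2 * (real h)^2)"
        by (simp add: abs_mult)
      also have "... \<le> norm ((ee (real h * \<sigma>) - 1) * T h) / (pi^2 * (real h)^2)"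
        by (intro divide_right_mono abs_Re_le_cmod) auto
      also have "... = 2 * \<bar>sin (pi * (real h * \<sigma>))\<bar> / (pi^2 * (real h)^2) * norm (T h)"
        by (simp add: norm_mult norm_minus_commute[of "ee _" 1] norm_one_minus_ee)
      \<comment> \<open>The two entries of the minimum come from |sin u| <= |u| and from |sin u| <=
        1.\<close>
      also have "... \<le> 2 * \<eta> * min (1 / real h) (R / (real h)^2) * norm (T h)"
      proof (intro mult_right_mono norm_ge_zero)
  let ?q = "2 * \<bar>sin (pi * (real h * \<sigma>))\<bar> / (pi^2 * (real h)^2)"
        have "pi^2 \<ge> pi" using pi_gt3 by (simp add: power2_eq_square)
        have "\<bar>sin (pi * (real h * \<sigma>))\<bar> \<le> \<bar>pi * (real h * \<sigma>)\<bar>" by (rule abs_sin_x_le_abs_x)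
        also have "... = pi * real h * \<eta>" using sig by (simp add: abs_mult)
        finally have "?q \<le> 2 * (pi * real h * \<eta>) / (pi * (real h)^2)"
          using h eta \<open>pi^2 \<ge> pi\<close> by (intro frac_le mult_left_mono mult_right_mono) auto
        also have "... = 2 * \<eta> * (1 / real h)" using h by (simp add: power2_eq_square)
        finally have 1: "?q \<le> 2 * \<eta> * (1 / real h)" .
        have "?q \<le> 2 * 1 / (1 * (real h)^2)"
          using h pi_gt3 \<open>pi^2 \<ge> pi\<close> by (intro frac_le mult_left_mono mult_right_mono abs_sin_le_one) auto
        also have "... = 2 * \<eta> * (R / (real h)^2)" using R by (simp add: \<eta>_def)
        finally have 2: "?q \<le> 2 * \<eta> * (R / (real h)^2)" .
        show "?q \<le> 2 * \<eta> * min (1 / real h) (R / (real h)^2)"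
          using 1 2 by (simp only: min_def split: if_split) simp
      qed
      finally show "\<bar>\<Sum>d\<in>A. w d * u h d\<bar> \<le> 2 * \<eta> * (min (1 / real h) (R / (real h)^2) * norm (T h))"
        by (simp only: mult.assoc)
    qed
    also have "... = 2 * \<eta> * ?S" by (simp only: sum_distrib_left T_def)
    finally show ?thesis by linarith
  qed
  have W: "?W \<ge> 0" using w by (rule sum_nonneg)
  \<comment> \<open>Truncation of the series and smoothing each cost at most W / R^2; for the
    truncation this is the hypothesis L >= R^2.\<close>
  have sub: "?W / real L + \<eta>^2 * ?W \<le> 2 * \<eta> * (?W / R)"
  proof -
    have "?W / real L \<le> ?W / R^2" using W L L1 R by (intro divide_left_mono) auto
    thus ?thesis by (simp add: \<eta>_def power2_eq_square)
  qed
  have up: "2 * \<eta> * (\<Sum>d\<in>A. w d * (frac (t d) - 1/2)) \<le> - (\<Sum>d\<in>A. w d * (b (t d + - \<eta>) - b (t d))) + \<eta>^2 * ?W"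
  proof -
    have "(\<Sum>d\<in>A. w d * (2 * \<eta> * (frac (t d) - 1/2))) \<le> (\<Sum>d\<in>A. w d * (b (t d) - b (t d - \<eta>) + \<eta>^2))"
    proof (intro sum_mono mult_left_mono)
      fix d
      show "2 * \<eta> * (frac (t d) - 1/2) \<le> b (t d) - b (t d - \<eta>) + \<eta>^2" using frac_smoothing(2)[OF eta, of "t d"] unfolding b_def by linarith
    qed (use w in auto)
    also have "... = - (\<Sum>d\<in>A. w d * (b (t d + - \<eta>) - b (t d))) + \<eta>^2 * ?W"
      unfolding sum_negf[symmetric] sum_distrib_left sum.distrib[symmetric]
      by (intro sum.cong) (auto simp: algebra_simps)
    also have "(\<Sum>d\<in>A. w d * (2 * \<eta> * (frac (t d) - 1/2))) = 2 * \<eta> * (\<Sum>d\<in>A. w d * (frac (t d) - 1/2))"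
      by (simp add: sum_distrib_left mult_ac)
    finally show ?thesis .
  qed
  have lo: "2 * \<eta> * (\<Sum>d\<in>A. w d * (frac (t d) - 1/2)) \<ge> (\<Sum>d\<in>A. w d * (b (t d + \<eta>) - b (t d))) - \<eta>^2 * ?W"
  proof -
    have "(\<Sum>d\<in>A. w d * (b (t d + \<eta>) - b (t d) - \<eta>^2)) \<le> (\<Sum>d\<in>A. w d * (2 * \<eta> * (frac (t d) - 1/2)))"
    proof (intro sum_mono mult_left_mono)
      fix d
      show "b (t d + \<eta>) - b (t d) - \<eta>^2 \<le> 2 * \<eta> * (frac (t d) - 1/2)" using frac_smoothing(1)[OF eta, of "t d"] unfolding b_def by linarith
    qed (use w in auto)
    also have "(\<Sum>d\<in>A. w d * (2 * \<eta> * (frac (t d) - 1/2))) = 2 * \<eta> * (\<Sum>d\<in>A. w d * (frac (t d) - 1/2))"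
      by (simp add: sum_distrib_left mult_ac)
    also have "(\<Sum>d\<in>A. w d * (b (t d + \<eta>) - b (t d) - \<eta>^2)) = (\<Sum>d\<in>A. w d * (b (t d + \<eta>) - b (t d))) - \<eta>^2 * ?W"
      unfolding sum_distrib_left sum_subtractf[symmetric]
      by (intro sum.cong) (auto simp: algebra_simps)
    finally show ?thesis .
  qed
  have "\<bar>2 * \<eta> * (\<Sum>d\<in>A. w d * (frac (t d) - 1/2))\<bar> \<le> 2 * \<eta> * (?W / R) + 2 * \<eta> * ?S"
    using key[of \<eta>] key[of "- \<eta>"] eta sub up lo unfolding abs_le_iff by linarith
  hence "2 * \<eta> * \<bar>\<Sum>d\<in>A. w d * (frac (t d) - 1/2)\<bar> \<le> 2 * \<eta> * (?W / R + ?S)"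
    using eta by (simp only: abs_mult distrib_left)
  thus ?thesis using eta by (simp only: mult_le_cancel_left_pos)
qed

section \<open>Exponential sums over hyperbolas\<close>

lemma hyperbola_second_difference:
  fixes y :: real assumes "y > 0"
  shows "1 / y - 2 * (1 / (y + 1)) + 1 / (y + 2) = 2 / (y * (y + 1) * (y + 2))"
  using assms by (simp add: divide_simps) (simp add: algebra_simps)

text \<open>With y = (n r + \<delta>)/r the phase is (h x / r)(1/y), so the shift \<delta> does no
  harm. Its second difference is 2 h x / (r y (y + 1)(y + 2)), of order h x r^2 / D^3, and the
  number of terms is at most 2 D / r.\<close>

lemma exp_sum_hyperbola_bound:
  fixes x \<delta> :: real and h r D a b :: nat
  assumes x: "x > 0" and del: "0 \<le> \<delta>" "\<delta> \<le> 1" and h: "h \<ge> 1" and r: "r \<ge> 1"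
  assumes range: "\<And>n. a \<le> n \<Longrightarrow> n < b \<Longrightarrow> D < n * r \<and> n * r \<le> 2 * D"
  shows "norm (\<Sum>n=a..<b. ee (real h * (x / (real (n * r) + \<delta>))))
     \<le> 128 * sqrt (real h * x / real D) + 64 * (real D / real r) / sqrt (real h * x / real D)"
proof (cases "a < b")
  case False
  thus ?thesis using x by simp
next
  case True
  have D: "real D > 0"
  proof -
    have "a * r \<le> 2 * D" "D < a * r" using range[of a] True by auto
    thus ?thesis by (cases D) auto
  qed
  define F where "F = sqrt (real h * x / real D)"
  have F2: "F * F = real h * x / real D" using x by (simp add: F_def)
  have F: "F > 0" using x h D by (simp add: F_def)
  \<comment> \<open>With A = n r + \<delta>, the product A (A + r)(A + 2 r) lies between D^3 and 3 *
    5 * 7 * D^3. Rounding 105 up to 128 makes \<mu> a square of a rational multiple of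
    \<open>r F / D\<close>, and 128 is then also the ratio of the two bounds for the second
    difference.\<close>
  define \<mu> where "\<mu> = (real r * F / (8 * real D))^2"
  have sq: "sqrt \<mu> = real r * F / (8 * real D)" unfolding \<mu>_def using F D by simp
  have mu: "\<mu> = real h * x * (real r)^2 / (64 * real D ^ 3)"
  proof -
    have "\<mu> = (real r)^2 * (F * F) / (64 * (real D)^2)"
      by (simp add: \<mu>_def power2_eq_square)
    thus ?thesis unfolding F2 by (simp add: power2_eq_square power3_eq_cube mult_ac)
  qed
  have mu_pos: "\<mu> > 0" using F D r by (simp add: \<mu>_def)
  define f where "f n = real h * (x / (real (n * r) + \<delta>))" for n
  let ?d = "\<lambda>m. f m - 2 * f (Suc m) + f (Suc (Suc m))"
  have len: "real (b - a) \<le> 2 * real D / real r"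
  proof -
    have "(b - 1) * r \<le> 2 * D" "D < a * r" using range[of a] range[of "b - 1"] True by auto
    hence "a \<ge> 1" by (cases a) auto
    hence "(b - a) * r \<le> (b - 1) * r" by (intro mult_right_mono) auto
    hence "(b - a) * r \<le> 2 * D" using \<open>(b - 1) * r \<le> 2 * D\<close> by linarith
    hence "real (b - a) * real r \<le> 2 * real D" by (metis of_nat_le_iff of_nat_mult of_nat_numeral)
    thus ?thesis using r by (simp add: field_simps)
  qed
  have "norm (\<Sum>n=a..<b. ee (f n)) \<le> 4 * 128 * real (b - a) * sqrt \<mu> + 8 / sqrt \<mu>"
  proof (rule second_difference_test[OF mu_pos])
    fix m assume m: "a \<le> m" "m < b"
    define A where "A = real (m * r) + \<delta>"
    define rr where "rr = real r"
    have rr: "rr \<ge> 1" using r by (simp add: rr_def)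
    have mr: "D < m * r" "m * r \<le> 2 * D" using range[OF m] by auto
    hence A1: "real D < A" "A \<le> 2 * real D + 1" "real D \<ge> 1"
      using del D by (auto simp: A_def simp flip: of_nat_mult)
    have m1: "m \<ge> 1" using mr by (cases m) auto
    hence "r \<le> m * r" by simp
    hence "r \<le> 2 * D" using mr by linarith
    hence r2: "rr \<le> 2 * real D" unfolding rr_def by (metis of_nat_le_iff of_nat_mult of_nat_numeral)
    define y where "y = A / rr"
    have y: "y > 0" using A1 rr by (simp add: y_def)
    have fm: "f m = real h * x / rr * (1 / y)" using rr unfolding f_def y_def A_def[symmetric] by simp
    have fm1: "f (Suc m) = real h * x / rr * (1 / (y + 1))"
    proof -
      have "real (Suc m * r) + \<delta> = rr * (y + 1)" using rr
        unfolding y_def A_def by (simp add: rr_def field_simps)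
      thus ?thesis by (simp add: f_def)
    qed
    have fm2: "f (Suc (Suc m)) = real h * x / rr * (1 / (y + 2))"
    proof -
      have "real (Suc (Suc m) * r) + \<delta> = rr * (y + 2)" using rr
        unfolding y_def A_def by (simp add: rr_def field_simps)
      thus ?thesis by (simp add: f_def)
    qed
    have "?d m
        = real h * x / rr * (1 / y - 2 * (1 / (y + 1)) + 1 / (y + 2))"
      unfolding fm fm1 fm2 by (simp only: algebra_simps)
    also have "... = real h * x / rr * (2 / (y * (y + 1) * (y + 2)))"
      unfolding hyperbola_second_difference[OF y] ..
    also have "y * (y + 1) * (y + 2) = A * (A + rr) * (A + 2 * rr) / rr ^ 3"
      using rr by (simp add: y_def field_simps power3_eq_cube)
    also have "real h * x / rr * (2 / (A * (A + rr) * (A + 2 * rr) / rr ^ 3))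
       = 2 * (real h * x * rr^2) / (A * (A + rr) * (A + 2 * rr))"
      using rr by (simp add: power2_eq_square power3_eq_cube)
    finally have e: "?d m = 2 * (real h * x * rr^2) / (A * (A + rr) * (A + 2 * rr))" .
    have num: "0 \<le> real h * x * rr^2" using x by simp
    have Ap: "A * (A + rr) * (A + 2 * rr) > 0" using A1 rr by (intro mult_pos_pos) auto
    have A3: "A \<le> 3 * real D" "A + rr \<le> 5 * real D" "A + 2 * rr \<le> 7 * real D"
      using A1 r2 by linarith+
    have "A * (A + rr) * (A + 2 * rr) \<le> (3 * real D) * (5 * real D) * (7 * real D)"
      by (intro mult_mono A3) (use A1 rr in auto)
    also have "... \<le> 128 * real D ^ 3" using A1 by (simp add: power3_eq_cube)
    finally have hi: "A * (A + rr) * (A + 2 * rr) \<le> 128 * real D ^ 3" .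
    have lo: "real D ^ 3 \<le> A * (A + rr) * (A + 2 * rr)"
      unfolding power3_eq_cube using A1 rr by (intro mult_mono) auto
    have "\<mu> = 2 * (real h * x * rr^2) / (128 * real D ^ 3)" unfolding mu rr_def by simp
    also have "... \<le> ?d m"
      unfolding e by (rule frac_le[OF _ _ Ap hi]) (use num in auto)
    finally have 1: "\<mu> \<le> ?d m" .
    have "?d m \<le> 2 * (real h * x * rr^2) / (real D ^ 3)"
      unfolding e by (rule frac_le[OF _ _ _ lo]) (use num D in auto)
    also have "... = 128 * \<mu>" unfolding mu rr_def by simp
    finally show "\<mu> \<le> ?d m \<and> ?d m \<le> 128 * \<mu>"
      using 1 by simp
  qed auto
  also have "... \<le> 4 * 128 * (2 * real D / real r) * sqrt \<mu> + 8 / sqrt \<mu>"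
    using len mu_pos by (intro add_mono mult_right_mono mult_left_mono) auto
  also have "... = 128 * F + 64 * (real D / real r) / F"
    unfolding sq using D F r by (simp add: field_simps)
  finally show ?thesis unfolding f_def F_def .
qed

text \<open>The logarithmic derivative of P is at most 3/y, which suggests |(1/P)'| <= 3/(y P y) <=
  3/m^4. The proof is the algebraic version: P b - P a <= 3 (b - a) P b / b.\<close>

lemma inverse_cubic_diff:
  fixes a b m :: real
  assumes m: "m > 0" and ab: "m \<le> a" "m \<le> b"
  defines "P \<equiv> \<lambda>y::real. y * (y + 1) * (y + 2)"
  shows "\<bar>1 / P a - 1 / P b\<bar> \<le> 3 * \<bar>a - b\<bar> / m ^ 4"
proof -
  have *: "\<bar>1 / P a - 1 / P b\<bar> \<le> 3 * \<bar>a - b\<bar> / m ^ 4" if le: "m \<le> a" "a \<le> b" for a b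
  proof -
    have pa: "P a > 0" and pb: "P b > 0" using m le unfolding P_def by (auto intro!: mult_pos_pos)
    have "0 \<le> (b - a) * b + (b - a) * (b + a) + 3 * (b - a) + 3 * b + 4"
      using le m by (intro add_nonneg_nonneg mult_nonneg_nonneg) auto
    also have "... = 3 * ((b + 1) * (b + 2)) - (b * b + a * b + a * a + 3 * (a + b) + 2)"
      by (simp add: algebra_simps)
    finally have "b * b + a * b + a * a + 3 * (a + b) + 2 \<le> 3 * ((b + 1) * (b + 2))" by simp
    hence "(b - a) * (b * b + a * b + a * a + 3 * (a + b) + 2) \<le> (b - a) * (3 * ((b + 1) * (b + 2)))"
      using le by (intro mult_left_mono) auto
    moreover have "P b - P a = (b - a) * (b * b + a * b + a * a + 3 * (a + b) + 2)"
      unfolding P_def by algebra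
    ultimately have d: "P b - P a \<le> (b - a) * (3 * ((b + 1) * (b + 2)))" by simp
    have ge: "P b - P a \<ge> 0" using le m unfolding P_def by (auto intro!: mult_mono)
    have "1 / P a - 1 / P b = (P b - P a) / (P a * P b)" using pa pb by (simp add: field_simps)
    hence "\<bar>1 / P a - 1 / P b\<bar> = (P b - P a) / (P a * P b)" using ge pa pb by simp
    also have "... \<le> ((b - a) * (3 * ((b + 1) * (b + 2)))) / (P a * P b)"
      using d pa pb by (intro divide_right_mono) auto
    also have "... = 3 * (b - a) / (P a * b)"
    proof -
      define Q where "Q = (b + 1) * (b + 2)"
      have Q: "Q \<noteq> 0" "P b = b * Q" using le m by (auto simp: Q_def P_def)
      have "(b - a) * (3 * Q) / (P a * P b) = ((3 * (b - a)) * Q) / ((P a * b) * Q)"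
        unfolding Q(2) by (simp only: mult_ac)
      also have "... = 3 * (b - a) / (P a * b)" using Q(1) by (rule mult_divide_mult_cancel_right)
      finally show ?thesis unfolding Q_def .
    qed
    also have "... \<le> 3 * (b - a) / m ^ 4"
    proof (intro divide_left_mono)
      have "m ^ 4 = m * m * m * m" by (simp add: power4_eq_xxxx)
      also have "... \<le> P a * b" unfolding P_def using le m by (intro mult_mono) auto
      finally show "m ^ 4 \<le> P a * b" .
    qed (use le m pa in auto)
    finally show ?thesis using le by simp
  qed
  show ?thesis
  proof (cases "a \<le> b")
    case True thus ?thesis using *[of a b] ab by simp
  next
    case False
    have "\<bar>1 / P a - 1 / P b\<bar> = \<bar>1 / P b - 1 / P a\<bar>" "\<bar>a - b\<bar> = \<bar>b - a\<bar>" by (auto simp: abs_minus_commute)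
    thus ?thesis using False *[of b a] ab by simp
  qed
qed

text \<open>For \<open>\<delta> > 0\<close> the phase is not a function of \<open>h/n\<close> and \<open>h'/n'\<close> alone; the discrepancy is
  negligible because two distinct fractions \<open>h/n\<close>, \<open>h'/n'\<close> differ by at least \<open>1/(n n')\<close>.\<close>

lemma exp_sum_hyperbola_pair_bound:
  fixes x \<delta> :: real and h h' n n' H N D a b j :: nat
  assumes x: "x > 0" and del: "0 \<le> \<delta>" "\<delta> \<le> 1" and N: "N \<ge> 1"
    and h': "h' < 2 * H"
    and n: "N \<le> n" "n < 2 * N" and n': "N \<le> n'" "n' < 2 * N"
    and j: "j \<ge> 1" "h * n' = h' * n + j"
    and DHN: "16000 * H * N \<le> D"
  assumes range: "\<And>m. a \<le> m \<Longrightarrow> m < b \<Longrightarrow> D < m * n \<and> m * n \<le> 2 * D"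
  defines "F \<equiv> sqrt (x * real j * real N / real D ^ 3)"
  shows "norm (\<Sum>m=a..<b. ee (real h * (x / (real (m * n) + \<delta>)) - real h' * (x / (real (m * n') + \<delta>))))
     \<le> 1536 * (real D / real N) * F + 64 / F"
proof (cases "a < b")
  case False
  thus ?thesis using x by (simp add: F_def)
next
  case True
  have H: "H \<ge> 1" using h' by simp
  have D: "real D \<ge> 16000" 
  proof -
    have "1 * 1 \<le> H * N" using H N by (intro mult_mono) auto
    hence "16000 \<le> 16000 * H * N" unfolding mult.assoc by linarith
    hence "16000 \<le> D" using DHN by linarith
    thus ?thesis by simp
  qed
  define NN where "NN = real N"
  have NN: "NN \<ge> 1" using N by (simp add: NN_def)
  have F2: "F * F = x * real j * NN / real D ^ 3" using x unfolding F_def NN_def by (subst real_sqrt_mult_self) simp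
  have F: "F > 0" using x j N D by (simp add: F_def)
  \<comment> \<open>Since m lies between D/(2N) and 2D/N, the lower bound 2 x U / 16 for the second
    difference, with \<open>U\<close> as defined below, is at least x j N / (64 D^3), and the upper
    bound 3 x U is at most 24 x j N / D^3. The ratio is 24 * 64 = 1536.\<close>
  define \<mu> where "\<mu> = (F / 8)^2"
  have sq: "sqrt \<mu> = F / 8" unfolding \<mu>_def using F by simp
  have mu_pos: "\<mu> > 0" using F by (simp add: \<mu>_def)
  have mu: "\<mu> = x * real j * NN / (64 * real D ^ 3)"
  proof -
    have "\<mu> = F * F / 64" by (simp add: \<mu>_def power2_eq_square)
    thus ?thesis unfolding F2 by simp
  qed
  define f where "f m = real h * (x / (real (m * n) + \<delta>)) - real h' * (x / (real (m * n') + \<delta>))" for m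
  let ?d = "\<lambda>m'. f m' - 2 * f (Suc m') + f (Suc (Suc m'))"
  have m_up: "real m \<le> 2 * real D / NN" if "a \<le> m" "m < b" for m
  proof -
    have "m * N \<le> m * n" using n by simp
    hence "m * N \<le> 2 * D" using range[OF that] by linarith
    hence "real m * NN \<le> 2 * real D" unfolding NN_def by (metis of_nat_le_iff of_nat_mult of_nat_numeral)
    thus ?thesis using NN by (simp add: field_simps)
  qed
  have m_lo: "real D / (2 * NN) \<le> real m" if "a \<le> m" "m < b" for m
  proof -
    have "m * n \<le> m * (2 * N)" using n by simp
    hence "D \<le> m * (2 * N)" using range[OF that] by linarith
    hence "real D \<le> real m * (2 * NN)" unfolding NN_def by (metis of_nat_le_iff of_nat_mult of_nat_numeral)
    thus ?thesis using NN by (simp add: field_simps)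
  qed
  have DH: "8000 * real H \<le> real D / (2 * NN)"
  proof -
    have "16000 * real H * NN \<le> real D" unfolding NN_def using DHN by (metis of_nat_le_iff of_nat_mult of_nat_numeral)
    thus ?thesis using NN by (simp add: field_simps)
  qed
  have len: "real (b - a) \<le> 2 * real D / NN"
  proof -
    have "D < a * n" using range[of a] True by auto
    hence "a \<ge> 1" by (cases a) auto
    hence "real (b - a) \<le> real (b - 1)" by simp
    also have "... \<le> 2 * real D / NN" using m_up[of "b - 1"] True by auto
    finally show ?thesis .
  qed
  have "norm (\<Sum>m=a..<b. ee (f m)) \<le> 4 * 1536 * real (b - a) * sqrt \<mu> + 8 / sqrt \<mu>"
  proof (rule second_difference_test[OF mu_pos])
    fix m' assume m': "a \<le> m'" "m' < b"
    define m where "m = real m'"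
    define q where "q = real n"
    define q' where "q' = real n'"
    have q: "NN \<le> q" "q \<le> 2 * NN" and q': "NN \<le> q'" "q' \<le> 2 * NN"
      using n n' by (auto simp: q_def q'_def NN_def)
    have q0: "q > 0" "q' > 0" using q q' NN by auto
    have m8: "m \<ge> 8000 * real H" using m_lo[OF m'] DH by (simp add: m_def)
    hence m1: "m \<ge> 8000" using H by simp
    define s where "s = \<delta> / q"
    define s' where "s' = \<delta> / q'"
    have s: "0 \<le> s" "s \<le> 1 / NN" and s': "0 \<le> s'" "s' \<le> 1 / NN"
      using del q q' q0 NN by (auto simp: s_def s'_def intro!: frac_le)
    have NN1: "1 / NN \<le> 1" using NN by simp
    define P where "P = (\<lambda>y::real. y * (y + 1) * (y + 2))"
    define w where "w = 1 / P (m + s)"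
    define w' where "w' = 1 / P (m + s')"
    have P_lo: "m ^ 3 \<le> P (m + s)" unfolding P_def power3_eq_cube using m1 s by (intro mult_mono) auto
    have P_hi: "P (m + s) \<le> 2 * m ^ 3"
    proof -
      have "P (m + s) \<le> (m + 1) * (m + 2) * (m + 3)"
        unfolding P_def using m1 s NN1 by (intro mult_mono) auto
      also have "... = m ^ 3 + 6 * (m * m) + 11 * m + 6" by (simp add: power3_eq_cube algebra_simps)
      also have "... \<le> m ^ 3 + m ^ 3"
      proof -
        have "11 * m \<le> m * m" "8000 * (m * m) \<le> m * (m * m)" using m1 by (auto intro!: mult_right_mono)
        moreover have "6 \<le> m" using m1 by simp
        ultimately show ?thesis using m1 unfolding power3_eq_cube by linarith
      qed
      finally show ?thesis by simp
    qed
    have m3: "m ^ 3 > 0" using m1 by simp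
    have P_pos: "P (m + s) > 0" using P_lo m3 by linarith
    have w: "1 / (2 * m ^ 3) \<le> w" "w \<le> 1 / m ^ 3"
      unfolding w_def using frac_le[OF _ _ P_pos P_hi, of 1 1] frac_le[OF _ _ m3 P_lo, of 1 1] by auto
    have ww: "\<bar>w - w'\<bar> \<le> 3 / (NN * m) / m ^ 3"
    proof -
      have "\<bar>w - w'\<bar> \<le> 3 * \<bar>(m + s) - (m + s')\<bar> / m ^ 4"
        unfolding w_def w'_def P_def using m1 s s' by (intro inverse_cubic_diff) auto
      also have "... \<le> 3 * (1 / NN) / m ^ 4"
        using s s' m1 by (intro divide_right_mono mult_left_mono) auto
      also have "... = 3 / (NN * m) / m ^ 3" by (simp add: power4_eq_xxxx power3_eq_cube)
      finally show ?thesis .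
    qed
    define y where "y = m + s"
    define y' where "y' = m + s'"
    have y: "y > 0" "y' > 0" using m1 s s' by (auto simp: y_def y'_def)
    have den: "real (m' * n) + \<delta> = q * y" "real (Suc m' * n) + \<delta> = q * (y + 1)" "real (Suc (Suc m') * n) + \<delta> = q * (y + 2)"
      "real (m' * n') + \<delta> = q' * y'" "real (Suc m' * n') + \<delta> = q' * (y' + 1)" "real (Suc (Suc m') * n') + \<delta> = q' * (y' + 2)"
      using q0 unfolding y_def y'_def s_def s'_def m_def by (auto simp: q_def q'_def algebra_simps)
    have "?d m'
       = real h * x / q * (1 / y - 2 * (1 / (y + 1)) + 1 / (y + 2))
         - real h' * x / q' * (1 / y' - 2 * (1 / (y' + 1)) + 1 / (y' + 2))"
      unfolding f_def den by (simp add: algebra_simps)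
    also have "... = real h * x / q * (2 * w) - real h' * x / q' * (2 * w')"
      unfolding hyperbola_second_difference[OF y(1)] hyperbola_second_difference[OF y(2)] w_def w'_def P_def
      by (simp add: y_def y'_def)
    also have "... = 2 * x * ((real h / q - real h' / q') * w + real h' / q' * (w - w'))"
    proof -
      define c where "c = real h / q"
      define c' where "c' = real h' / q'"
      have "real h * x / q = x * c" "real h' * x / q' = x * c'" by (auto simp: c_def c'_def)
      thus ?thesis unfolding c_def[symmetric] c'_def[symmetric] by (simp only:) (simp add: algebra_simps)
    qed
    also have "real h / q - real h' / q' = real j / (q * q')"
    proof -
      have "real h * q' = real h' * q + real j"
        unfolding q_def q'_def using j(2) by (metis of_nat_add of_nat_mult)
      thus ?thesis using q0 by (simp add: field_simps)
    qed
    finally have e: "?d m'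
       = 2 * x * (real j / (q * q') * w + real h' / q' * (w - w'))" .
    have jj: "real j \<ge> 1" using j by simp
    have qq: "NN * NN \<le> q * q'" "q * q' \<le> (2 * NN) * (2 * NN)" 
      using mult_mono[OF q(1) q'(1)] mult_mono[OF q(2) q'(2)] NN q0 by auto
    have qq0: "0 < q * q'" using q0 by simp
    \<comment> \<open>\<open>U\<close> is the natural size of the main term j w / (q q'): it lies
      between U/8 (a factor 4 from q q' and 2 from P) and U. The perturbation is at most U/16, so it
      cannot spoil the sign.\<close>
    define U where "U = real j / (NN^2 * m ^ 3)"
    have w0: "0 \<le> w" using w(1) m3 by (smt (verit) divide_nonneg_nonneg)
    have main_hi: "real j / (q * q') * w \<le> U"
    proof -
      have "real j / (q * q') \<le> real j / (NN * NN)"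
        by (rule divide_left_mono[OF qq(1)]) (use qq0 NN in auto)
      hence "real j / (q * q') * w \<le> real j / (NN * NN) * (1 / m ^ 3)"
        by (rule mult_mono[OF _ w(2)]) (use w0 in auto)
      thus ?thesis by (simp add: U_def power2_eq_square)
    qed
    have main_lo: "U / 8 \<le> real j / (q * q') * w"
    proof -
      have "real j / ((2 * NN) * (2 * NN)) \<le> real j / (q * q')"
        by (rule divide_left_mono[OF qq(2)]) (use qq0 NN in auto)
      hence "real j / ((2 * NN) * (2 * NN)) * (1 / (2 * m ^ 3)) \<le> real j / (q * q') * w"
        by (rule mult_mono[OF _ w(1)]) (use m3 qq0 in auto)
      thus ?thesis by (simp add: U_def power2_eq_square mult_ac)
    qed
    \<comment> \<open>This is where 16000 H N <= D enters: it gives m >= 8000 H, so the relative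
      size 6 H / m of the perturbation is at most 1/16 <= j/16.\<close>
    have pert: "\<bar>real h' / q' * (w - w')\<bar> \<le> U / 16"
    proof -
      have "\<bar>real h' / q' * (w - w')\<bar> \<le> (2 * real H) / NN * (3 / (NN * m) / m ^ 3)"
        unfolding abs_mult using ww h' q' q0 NN
        by (intro mult_mono) (auto intro!: frac_le)
      also have "... = (6 * real H / m) / (NN^2 * m ^ 3)" by (simp add: power2_eq_square)
      also have "... \<le> (real j / 16) / (NN^2 * m ^ 3)"
      proof (intro divide_right_mono)
        have "6 * real H / m \<le> 1 / 16" using m8 m1 by (simp add: divide_le_eq)
        thus "6 * real H / m \<le> real j / 16" using jj by linarith
      qed (use NN m3 in auto)
      finally show ?thesis by (simp add: U_def)
    qed
    have lower: "2 * x * (U / 16) \<le> ?d m'"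
    proof -
      have "U / 16 \<le> M + V" if "\<bar>V\<bar> \<le> U / 16" "U / 8 \<le> M" for M V :: real using that by linarith
      from this[OF pert main_lo] show ?thesis unfolding e using x by (intro mult_left_mono) auto
    qed
    have U0: "U \<ge> 0" using jj NN m3 by (simp add: U_def)
    have upper: "?d m' \<le> 2 * x * (3 / 2 * U)"
    proof -
      have "M + V \<le> 3 / 2 * U" if "\<bar>V\<bar> \<le> U / 16" "M \<le> U" for M V :: real using that U0 by linarith
      from this[OF pert main_hi] show ?thesis unfolding e using x by (intro mult_left_mono) auto
    qed
    have mu1: "m ^ 3 \<le> (2 * real D / NN) ^ 3" using m_up[OF m'] m1 unfolding m_def by (intro power_mono) auto
    have mu2: "(real D / (2 * NN)) ^ 3 \<le> m ^ 3" using m_lo[OF m'] D NN unfolding m_def by (intro power_mono) auto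
    have "\<mu> = 2 * x * (real j / (NN^2 * (2 * real D / NN) ^ 3) / 16)"
      unfolding mu using NN D by (simp add: power2_eq_square power3_eq_cube field_simps)
    also have "... \<le> 2 * x * (U / 16)"
      unfolding U_def using mu1 m3 NN x D
      by (intro mult_left_mono divide_right_mono divide_left_mono) auto
    finally have 1: "\<mu> \<le> 2 * x * (U / 16)" .
    have "2 * x * (3 / 2 * U) \<le> 2 * x * (3 / 2 * (real j / (NN^2 * (real D / (2 * NN)) ^ 3)))"
      unfolding U_def using mu2 m3 NN x D
      by (intro mult_left_mono divide_left_mono) auto
    also have "... = 1536 * \<mu>" unfolding mu using NN D by (simp add: power2_eq_square power3_eq_cube field_simps)
    finally show "\<mu> \<le> ?d m' \<and> ?d m' \<le> 1536 * \<mu>"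
      using 1 lower upper by linarith
  qed auto
  also have "... \<le> 4 * 1536 * (2 * real D / NN) * sqrt \<mu> + 8 / sqrt \<mu>"
    using len mu_pos by (intro add_mono mult_right_mono mult_left_mono) auto
  also have "... = 1536 * (real D / NN) * F + 64 / F"
    unfolding sq by simp
  finally show ?thesis unfolding f_def NN_def .
qed

section \<open>Bilinear sums\<close>

text \<open>The p are first collected according to their bin, and Cauchy's inequality is applied
  over the K * card Ms pairs (bin, m). Having K bins instead of one costs the factor K, but only
  pairs p, p' from the same bin remain.\<close>

lemma bilinear_Cauchy_Schwarz:
  fixes \<beta> :: "'m \<Rightarrow> complex" and z :: "'p \<Rightarrow> 'm \<Rightarrow> complex" and bin :: "'p \<Rightarrow> nat"
  assumes fin: "finite Ms" "finite P" and bin: "\<And>p. p \<in> P \<Longrightarrow> bin p < K"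
    and \<beta>: "\<And>m. m \<in> Ms \<Longrightarrow> norm (\<beta> m) \<le> B" and B: "B \<ge> 0"
  shows "(norm (\<Sum>p\<in>P. \<Sum>m\<in>Ms. \<beta> m * z p m))^2
    \<le> B^2 * real (K * card Ms) * (\<Sum>(p, p')\<in>{(p, p')\<in>P \<times> P. bin p = bin p'}. norm (\<Sum>m\<in>Ms. z p m * cnj (z p' m)))"
proof -
  let ?c = "\<lambda>p p'. norm (\<Sum>m\<in>Ms. z p m * cnj (z p' m))"
  define G where "G k m = (\<Sum>p | p \<in> P \<and> bin p = k. z p m)" for k m
  have "(\<Sum>p\<in>P. \<Sum>m\<in>Ms. \<beta> m * z p m) = (\<Sum>k<K. \<Sum>p | p \<in> P \<and> bin p = k. \<Sum>m\<in>Ms. \<beta> m * z p m)"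
    using bin by (intro sum.group[symmetric] fin) auto
  also have "... = (\<Sum>k<K. \<Sum>m\<in>Ms. \<beta> m * G k m)"
    unfolding G_def sum_distrib_left by (intro sum.cong sum.swap refl)
  also have "... = (\<Sum>(k, m)\<in>{..<K} \<times> Ms. \<beta> m * G k m)" by (rule sum.cartesian_product)
  finally have S: "(\<Sum>p\<in>P. \<Sum>m\<in>Ms. \<beta> m * z p m) = (\<Sum>(k, m)\<in>{..<K} \<times> Ms. \<beta> m * G k m)" .
  have "norm (\<Sum>(k, m)\<in>{..<K} \<times> Ms. \<beta> m * G k m) \<le> (\<Sum>(k, m)\<in>{..<K} \<times> Ms. B * norm (G k m))"
    by (rule sum_norm_le) (auto simp: norm_mult intro!: mult_right_mono \<beta>)
  hence "(norm (\<Sum>(k, m)\<in>{..<K} \<times> Ms. \<beta> m * G k m))^2 \<le> (\<Sum>(k, m)\<in>{..<K} \<times> Ms. B * norm (G k m))^2"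
    by (intro power_mono) auto
  also have "... \<le> (\<Sum>(k, m)\<in>{..<K} \<times> Ms. B^2) * (\<Sum>(k, m)\<in>{..<K} \<times> Ms. (norm (G k m))^2)"
    using Cauchy_Schwarz_ineq_sum[of "\<lambda>_. B" "\<lambda>(k, m). norm (G k m)" "{..<K} \<times> Ms"]
    by (simp add: case_prod_unfold)
  also have "(\<Sum>(k, m)\<in>{..<K} \<times> Ms. B^2) = B^2 * real (K * card Ms)"
    by (simp add: case_prod_unfold card_cartesian_product)
  also have "(\<Sum>(k, m)\<in>{..<K} \<times> Ms. (norm (G k m))^2) = (\<Sum>k<K. \<Sum>m\<in>Ms. (norm (G k m))^2)"
    by (rule sum.cartesian_product[symmetric])
  also have "... \<le> (\<Sum>k<K. \<Sum>p | p \<in> P \<and> bin p = k. \<Sum>p' | p' \<in> P \<and> bin p' = k. ?c p p')"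
  proof (rule sum_mono)
    fix k
    have "complex_of_real (\<Sum>m\<in>Ms. (norm (G k m))^2) = (\<Sum>m\<in>Ms. G k m * cnj (G k m))"
      unfolding of_real_sum complex_norm_square ..
    also have "... = (\<Sum>m\<in>Ms. \<Sum>p | p \<in> P \<and> bin p = k. \<Sum>p' | p' \<in> P \<and> bin p' = k. z p m * cnj (z p' m))"
      by (simp add: G_def sum_product)
    also have "... = (\<Sum>p | p \<in> P \<and> bin p = k. \<Sum>m\<in>Ms. \<Sum>p' | p' \<in> P \<and> bin p' = k. z p m * cnj (z p' m))"
      by (rule sum.swap)
    also have "... = (\<Sum>p | p \<in> P \<and> bin p = k. \<Sum>p' | p' \<in> P \<and> bin p' = k. \<Sum>m\<in>Ms. z p m * cnj (z p' m))"
      by (intro sum.cong refl sum.swap)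
    finally have e: "complex_of_real (\<Sum>m\<in>Ms. (norm (G k m))^2)
       = (\<Sum>p | p \<in> P \<and> bin p = k. \<Sum>p' | p' \<in> P \<and> bin p' = k. \<Sum>m\<in>Ms. z p m * cnj (z p' m))" .
    have "(\<Sum>m\<in>Ms. (norm (G k m))^2) = norm (complex_of_real (\<Sum>m\<in>Ms. (norm (G k m))^2))"
      unfolding norm_of_real by (simp add: sum_nonneg)
    also have "... \<le> (\<Sum>p | p \<in> P \<and> bin p = k. \<Sum>p' | p' \<in> P \<and> bin p' = k. ?c p p')"
      unfolding e by (intro sum_norm_le norm_sum)
    finally show "(\<Sum>m\<in>Ms. (norm (G k m))^2)
      \<le> (\<Sum>p | p \<in> P \<and> bin p = k. \<Sum>p' | p' \<in> P \<and> bin p' = k. ?c p p')" .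
  qed
  also have "... = (\<Sum>k<K. \<Sum>p | p \<in> P \<and> bin p = k. \<Sum>p' | p' \<in> P \<and> bin p' = bin p. ?c p p')"
    by (intro sum.cong) auto
  also have "... = (\<Sum>p\<in>P. \<Sum>p' | p' \<in> P \<and> bin p' = bin p. ?c p p')"
    using bin by (intro sum.group fin) auto
  also have "... = (\<Sum>(p, p')\<in>(SIGMA p:P. {p'. p' \<in> P \<and> bin p' = bin p}). ?c p p')"
    using fin by (intro sum.Sigma) auto
  also have "(SIGMA p:P. {p'. p' \<in> P \<and> bin p' = bin p}) = {(p, p')\<in>P \<times> P. bin p = bin p'}" by auto
  finally show ?thesis unfolding S by (simp add: mult_left_mono)
qed

text \<open>The pair (h', n) is free. Then h divides the positive number h' n + j = h n' <= 4 H N,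
  which leaves at most \<Delta> choices, and n' is determined.\<close>

lemma card_pairs_det_eq:
  fixes H N j :: nat and \<Delta> :: real
  assumes N: "N \<ge> 1" and H: "H \<ge> 1"
    and \<Delta>: "\<And>v. 0 < v \<Longrightarrow> v \<le> 4 * H * N \<Longrightarrow> real (card {d. d dvd v}) \<le> \<Delta>"
  defines "P \<equiv> {H..<2*H} \<times> {N..<2*N}"
  shows "real (card {((h, n), (h', n')). (h, n) \<in> P \<and> (h', n') \<in> P \<and> h * n' = h' * n + j}) \<le> real H * real N * \<Delta>"
proof -
  let ?Q = "{((h, n), (h', n')). (h, n) \<in> P \<and> (h', n') \<in> P \<and> h * n' = h' * n + j}"
  let ?V = "{v. 0 < v \<and> v \<le> 4 * H * N}"
  \<comment> \<open>Where h' n + j is out of range the fibre is replaced by the empty set, so that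
    the bound \<Delta> holds for every (h', n).\<close>
  let ?F = "\<lambda>q :: nat \<times> nat. if fst q * snd q + j \<in> ?V then {d. d dvd fst q * snd q + j} else {}"
  let ?HN = "{H..<2*H} \<times> {N..<2*N}"
  define f where "f = (\<lambda>((h :: nat, n :: nat), (h' :: nat, n' :: nat)). ((h', n), h))"
  have inj: "inj_on f ?Q"
  proof (rule inj_onI)
    fix q1 q2 assume q: "q1 \<in> ?Q" "q2 \<in> ?Q" "f q1 = f q2"
    obtain h n h' n1 where q1: "q1 = ((h, n), (h', n1))" by (metis surj_pair)
    obtain n2 where q2: "q2 = ((h, n), (h', n2))"
      using q(3) unfolding q1 f_def by (cases q2) auto
    have "h * n1 = h * n2" using q(1,2) unfolding q1 q2 by simp
    moreover have "h > 0" using q(1) H unfolding q1 P_def by simp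
    ultimately show "q1 = q2" unfolding q1 q2 by simp
  qed
  have sub: "f ` ?Q \<subseteq> (SIGMA q:(?HN). ?F q)"
  proof
    fix y assume "y \<in> f ` ?Q"
    then obtain h n h' n' where y: "y = ((h', n), h)" "(h, n) \<in> P" "(h', n') \<in> P" "h * n' = h' * n + j"
      unfolding f_def by force
    have "h * n' \<le> (2 * H) * (2 * N)" using y by (intro mult_mono) (auto simp: P_def)
    moreover have "h * n' > 0" using y H N by (auto simp: P_def)
    ultimately have "h' * n + j \<in> ?V" using y(4) by simp
    moreover have "h dvd h' * n + j" using y(4) by (metis dvd_triv_left)
    ultimately show "y \<in> (SIGMA q:(?HN). ?F q)"
      using y by (auto simp: P_def)
  qed
  have fin: "finite (?F q)" for q :: "nat \<times> nat"
    by auto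
  have "card ?Q = card (f ` ?Q)" using inj by (simp add: card_image)
  also have "... \<le> card (SIGMA q:(?HN). ?F q)"
    using fin by (intro card_mono sub finite_SigmaI) auto
  also have "... = (\<Sum>q\<in>?HN. card (?F q))"
    using fin by (intro card_SigmaI) auto
  finally have cQ: "card ?Q \<le> (\<Sum>q\<in>?HN. card (?F q))" .
  have "real (card ?Q) \<le> (\<Sum>q\<in>?HN. real (card (?F q)))"
    using of_nat_mono[OF cQ, where ?'a = real] unfolding of_nat_sum .
  also have "... \<le> (\<Sum>q\<in>?HN. \<Delta>)"
  proof (rule sum_mono)
    fix q
    have "real (card {d. d dvd (1::nat)}) \<le> \<Delta>" using \<Delta>[of 1] H N by simp
    hence "\<Delta> \<ge> 0" by (smt (verit) of_nat_0_le_iff)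
    thus "real (card (?F q)) \<le> \<Delta>"
      using \<Delta> by auto
  qed
  also have "... = real H * real N * \<Delta>" by (simp add: card_cartesian_product)
  finally show ?thesis .
qed

text \<open>Each off-diagonal sum over m is bounded by (D/N) F + 1/F up to constants, with F^2 = x j
  N / D^3. Hypothesis \<open>c1\<close> controls the first term for the largest j, about 4 R^2, and
  \<open>c2\<close> the second term for j = 1; both become O(D / (N R^2)).\<close>

lemma type_II_bound:
  fixes x \<delta> R A B \<Delta> :: real and H N D D2 :: nat and \<gamma> :: "nat \<Rightarrow> nat \<Rightarrow> complex" and \<beta> :: "nat \<Rightarrow> complex"
  assumes x: "x > 0" and del: "0 \<le> \<delta>" "\<delta> \<le> 1" and H: "H \<ge> 1" and N: "N \<ge> 1" and D2: "D2 \<le> 2 * D"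
    and R: "R \<ge> 1" "R^2 \<le> 2 * real N" and DHN: "16000 * H * N \<le> D"
    and c1: "x * R ^ 6 * real N \<le> 2 * real D ^ 3" and c2: "real D * real N * R ^ 4 \<le> 2 * x"
    and \<Delta>: "\<And>v. 0 < v \<Longrightarrow> v \<le> 4 * H * N \<Longrightarrow> real (card {d. d dvd v}) \<le> \<Delta>"
    and \<gamma>: "\<And>h n. norm (\<gamma> h n) \<le> A" and \<beta>: "\<And>m. norm (\<beta> m) \<le> B"
  shows "norm (\<Sum>h=H..<2*H. \<Sum>n=N..<2*N. \<Sum>m=1..2*D.
      if D < m * n \<and> m * n \<le> D2 then \<gamma> h n * \<beta> m * ee (real h * (x / (real (m * n) + \<delta>))) else 0)
    \<le> 600 * A * B * \<Delta> * real H * real D / R"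
proof -
  let ?t = "\<lambda>h n m. if D < m * n \<and> m * n \<le> D2 then \<gamma> h n * \<beta> m * ee (real h * (x / (real (m * n) + \<delta>))) else 0"
  have A: "A \<ge> 0" using \<gamma>[of 0 0] norm_ge_zero order_trans by blast
  have B: "B \<ge> 0" using \<beta>[of 0] norm_ge_zero order_trans by blast
  have \<Delta>1: "\<Delta> \<ge> 1" using \<Delta>[of 1] H N by simp
  have HN1: "1 * 1 \<le> H * N" using H N by (intro mult_mono) auto
  have Dpos: "real D > 0"
  proof -
    have "16000 \<le> 16000 * H * N" using HN1 unfolding mult.assoc by linarith
    thus ?thesis using DHN by linarith
  qed
  have Np: "real N > 0" using N by auto
  define P where "P = {H..<2*H} \<times> {N..<2*N}"
  define Ms where "Ms = {1..2 * D div N}"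
  define z where "z = (\<lambda>(h, n) m. if D < m * n \<and> m * n \<le> D2 then \<gamma> h n * ee (real h * (x / (real (m * n) + \<delta>))) else 0)"
  \<comment> \<open>Equal bins mean |h/n - h'/n'| < R^2/N^2, and multiplying by n n' <= 4 N^2 gives
    |h n' - h' n| < 4 R^2.\<close>
  define bin where "bin = (\<lambda>(h, n). nat \<lfloor>real h / real n * ((real N)^2 / R^2)\<rfloor>)"
  define K where "K = nat \<lfloor>2 * real H * real N / R^2\<rfloor> + 1"
  have cardMs: "real (card Ms) \<le> 2 * real D / real N"
    unfolding Ms_def using of_nat_div_le_of_nat[of "2 * D" N, where ?'a = real] by simp
  have R2: "R^2 \<ge> 1" using R by simp
  have in_Ms: "m \<in> Ms" if "D < m * n" "m * n \<le> D2" "n \<ge> N" for m n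
  proof -
    have "m * N \<le> m * n" using that by simp
    hence "m * N \<le> 2 * D" using that D2 by linarith
    hence "m \<le> 2 * D div N" using N by (simp add: less_eq_div_iff_mult_less_eq)
    moreover have "m \<ge> 1" using that by (cases m) auto
    ultimately show ?thesis by (simp add: Ms_def)
  qed
  have S: "(\<Sum>h=H..<2*H. \<Sum>n=N..<2*N. \<Sum>m=1..2*D.
      ?t h n m)
    = (\<Sum>p\<in>P. \<Sum>m\<in>Ms. \<beta> m * z p m)"
  proof -
    have in_eq: "(\<Sum>m=1..2*D. ?t h n m)
      = (\<Sum>m\<in>Ms. \<beta> m * z (h, n) m)" if "n \<in> {N..<2*N}" for h n
    proof -
      have "Ms \<subseteq> {1..2*D}" unfolding Ms_def using div_le_dividend[of "2*D" N] by auto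
      hence "(\<Sum>m=1..2*D. \<beta> m * z (h, n) m) = (\<Sum>m\<in>Ms. \<beta> m * z (h, n) m)"
        using that in_Ms by (intro sum.mono_neutral_right) (auto simp: z_def)
      thus ?thesis by (simp add: z_def if_distrib mult_ac cong: if_cong)
    qed
    have "(\<Sum>h=H..<2*H. \<Sum>n=N..<2*N. \<Sum>m=1..2*D.
        ?t h n m)
      = (\<Sum>h=H..<2*H. \<Sum>n=N..<2*N. \<Sum>m\<in>Ms. \<beta> m * z (h, n) m)"
      by (rule sum.cong[OF refl], rule sum.cong[OF refl]) (rule in_eq)
    also have "... = (\<Sum>p\<in>P. \<Sum>m\<in>Ms. \<beta> m * z p m)"
      unfolding P_def sum.cartesian_product[of "\<lambda>h n. \<Sum>m\<in>Ms. \<beta> m * z (h, n) m"] by (simp only: case_prod_unfold prod.collapse)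
    finally show ?thesis .
  qed
  have bin_lt: "bin p < K" if "p \<in> P" for p
  proof -
    obtain h n where p: "p = (h, n)" "h < 2 * H" "N \<le> n" using \<open>p \<in> P\<close> unfolding P_def by (cases p) auto
    have "real h / real n \<le> 2 * real H / real N" using p Np by (intro frac_le) auto
    hence "real h / real n * ((real N)^2 / R^2) \<le> 2 * real H / real N * ((real N)^2 / R^2)"
      by (intro mult_right_mono) auto
    also have "... = 2 * real H * real N / R^2" using Np by (simp add: power2_eq_square)
    finally have "bin p \<le> nat \<lfloor>2 * real H * real N / R^2\<rfloor>"
      unfolding bin_def p(1) by (auto intro!: nat_mono floor_mono)
    thus ?thesis by (simp add: K_def)
  qed
  \<comment> \<open>The rounding term 1 in \<open>K\<close> is absorbed because R^2 <= 2 N; this is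
    why n must not be smaller than about R^2.\<close>
  have K: "real K \<le> 4 * real H * real N / R^2"
  proof -
    have "1 * (2 * real N) \<le> real H * (2 * real N)" using H by (intro mult_right_mono) auto
    hence "R^2 \<le> 2 * real H * real N" using R(2) by linarith
    hence "1 \<le> 2 * real H * real N / R^2" using R2 by (subst le_divide_eq_1_pos) linarith+
    moreover have "real K \<le> 2 * real H * real N / R^2 + 1" unfolding K_def by simp
    moreover have "4 * real H * real N / R^2 = 2 * (2 * real H * real N / R^2)" by simp
    ultimately show ?thesis by linarith
  qed
  define E where "E = 4800 * (real D / real N) / R^2"
  define J where "J = nat \<lfloor>4 * R^2\<rfloor>"
  have J: "real J \<le> 4 * R^2" unfolding J_def by simp
  define Q where "Q j = {((h, n), (h', n')). (h, n) \<in> P \<and> (h', n') \<in> P \<and> h * n' = h' * n + j}" for j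
  \<comment> \<open>The determinant j is a natural number, so its two signs form two families;
    \<open>Q'\<close> is the mirror image of \<open>Q\<close>, and its exponential sums are the
    complex conjugates.\<close>
  define Q' where "Q' j = {((h, n), (h', n')). (h, n) \<in> P \<and> (h', n') \<in> P \<and> h' * n = h * n' + j}" for j
  have finP: "finite P" by (simp add: P_def)
  have finQ: "finite (Q j)" "finite (Q' j)" for j
    by (rule finite_subset[of _ "P \<times> P"]; use finP in \<open>auto simp: Q_def Q'_def\<close>)+
  have cardQ: "real (card (Q j)) \<le> real H * real N * \<Delta>" for j
    unfolding Q_def P_def by (rule card_pairs_det_eq[OF N H \<Delta>])
  have cardQ': "real (card (Q' j)) \<le> real H * real N * \<Delta>" for j
  proof -
    have "Q' j = prod.swap ` Q j" by (auto simp: Q_def Q'_def image_iff)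
    hence "card (Q' j) = card (Q j)" by (simp add: card_image)
    thus ?thesis using cardQ by simp
  qed
  define T where "T = {(p, p')\<in>P \<times> P. bin p = bin p'}"
  have finT: "finite T" unfolding T_def by (rule finite_subset[of _ "P \<times> P"]) (use finP in auto)
  have T_sub: "T - Q 0 \<subseteq> (\<Union>j\<in>{1..J}. Q j \<union> Q' j)"
  proof
    fix q assume q: "q \<in> T - Q 0"
    obtain h n h' n' where q_eq: "q = ((h, n), (h', n'))" by (metis surj_pair)
    have hn: "(h, n) \<in> P" "(h', n') \<in> P" "bin (h, n) = bin (h', n')" "h * n' \<noteq> h' * n"
      using q by (auto simp: q_eq T_def Q_def)
    have n0: "0 < real n" "0 < real n'" "real n \<le> 2 * real N" "real n' \<le> 2 * real N" using hn N by (auto simp: P_def)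
    define c where "c = (real N)^2 / R^2"
    have c: "c > 0" unfolding c_def using Np R by (intro divide_pos_pos zero_less_power) auto
    have "\<bar>real h / real n * c - real h' / real n' * c\<bar> < 1"
    proof -
      have "\<lfloor>real h / real n * c\<rfloor> = \<lfloor>real h' / real n' * c\<rfloor>"
        using hn(3) c by (simp add: bin_def c_def nat_eq_iff2)
      thus ?thesis by linarith
    qed
    moreover have "real h / real n * c - real h' / real n' * c = (real h * real n' - real h' * real n) * (c / (real n * real n'))"
      using n0 by (simp add: field_simps)
    ultimately have "\<bar>real h * real n' - real h' * real n\<bar> * (c / (real n * real n')) < 1"
      using c n0 by (simp add: abs_mult)
    hence "\<bar>real h * real n' - real h' * real n\<bar> < real n * real n' / c"
      using c n0 by (simp add: field_simps)
    also have "... \<le> (2 * real N) * (2 * real N) / c"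
      using n0 c by (intro divide_right_mono mult_mono) auto
    also have "... = 4 * R^2" using Np by (simp add: c_def power2_eq_square)
    finally have lt: "\<bar>real (h * n') - real (h' * n)\<bar> < 4 * R^2" by simp
    show "q \<in> (\<Union>j\<in>{1..J}. Q j \<union> Q' j)"
    proof (cases "h * n' > h' * n")
      case True
      define j where "j = h * n' - h' * n"
      have "real j < 4 * R^2" using lt True by (simp add: j_def of_nat_diff)
      hence "j \<in> {1..J}" using True by (simp add: J_def j_def le_nat_floor)
      moreover have "q \<in> Q j" using hn True by (simp add: q_eq Q_def j_def)
      ultimately show ?thesis by blast
    next
      case False
      define j where "j = h' * n - h * n'"
      have lt': "h' * n > h * n'" using False hn(4) by simp
      have "real j < 4 * R^2" using lt lt' by (simp add: j_def of_nat_diff)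
      hence "j \<in> {1..J}" using lt' by (simp add: J_def j_def le_nat_floor)
      moreover have "q \<in> Q' j" using hn lt' by (simp add: q_eq Q'_def j_def)
      ultimately show ?thesis by blast
    qed
  qed
  have cardT: "real (card (T - Q 0)) \<le> 8 * R^2 * (real H * real N * \<Delta>)"
  proof -
    have "card (T - Q 0) \<le> card (\<Union>j\<in>{1..J}. Q j \<union> Q' j)"
      using finQ by (intro card_mono T_sub) auto
    also have "... \<le> (\<Sum>j=1..J. card (Q j \<union> Q' j))" by (rule card_UN_le) simp
    also have "... \<le> (\<Sum>j=1..J. card (Q j) + card (Q' j))" by (intro sum_mono card_Un_le)
    finally have cT: "card (T - Q 0) \<le> (\<Sum>j=1..J. card (Q j) + card (Q' j))" .
    have "real (card (T - Q 0)) \<le> (\<Sum>j=1..J. real (card (Q j)) + real (card (Q' j)))"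
      using of_nat_mono[OF cT, where ?'a = real] unfolding of_nat_sum of_nat_add .
    also have "... \<le> (\<Sum>j=1..J. 2 * (real H * real N * \<Delta>))"
    proof (rule sum_mono)
      fix j
      show "real (card (Q j)) + real (card (Q' j)) \<le> 2 * (real H * real N * \<Delta>)"
        using cardQ[of j] cardQ'[of j] by linarith
    qed
    also have "... = 2 * real J * (real H * real N * \<Delta>)" by simp
    also have "... \<le> 2 * (4 * R^2) * (real H * real N * \<Delta>)"
      using J \<Delta>1 by (intro mult_right_mono mult_left_mono) auto
    finally show ?thesis by simp
  qed
  define Ph where "Ph h n h' n' m = real h * (x / (real (m * n) + \<delta>)) - real h' * (x / (real (m * n') + \<delta>))"
    for h n h' n' m
  \<comment> \<open>First m with both m n and m n' above D; \<open>up\<close> is the first m for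
    which one of them exceeds \<open>D2\<close>, as the sums run over half-open intervals.\<close>
  define lo where "lo n n' = max (D div n + 1) (D div n' + 1)" for n n'
  define up where "up n n' = min (D2 div n + 1) (D2 div n' + 1)" for n n'
  let ?S = "\<lambda>h n h' n'. norm (\<Sum>m=lo n n'..<up n n'. ee (Ph h n h' n' m))"
  have mem_iff: "D < m * n \<and> m * n \<le> D2 \<and> D < m * n' \<and> m * n' \<le> D2 \<longleftrightarrow> m \<in> {lo n n'..<up n n'}"
    if "n > 0" "n' > 0" for m n n'
    using that by (auto simp: lo_def up_def div_less_iff_less_mult less_eq_div_iff_mult_less_eq Suc_le_eq less_Suc_eq_le)
  have seg_sub: "{lo n n'..<up n n'} \<subseteq> Ms" if "n \<ge> N" "n' \<ge> N" for n n'
  proof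
    fix m assume m: "m \<in> {lo n n'..<up n n'}"
    have "n > 0" "n' > 0" using that N by auto
    from mem_iff[OF this, of m] m show "m \<in> Ms" using in_Ms that(1) by blast
  qed
  have zz: "norm (\<Sum>m\<in>Ms. z (h, n) m * cnj (z (h', n') m)) \<le> A^2 * ?S h n h' n'"
    if "(h, n) \<in> P" "(h', n') \<in> P" for h n h' n'
  proof -
    have n: "n > 0" "n' > 0" "n \<ge> N" "n' \<ge> N" using that N by (auto simp: P_def)
    have "{lo n n'..<up n n'} \<subseteq> Ms" using seg_sub n by blast
    have "(\<Sum>m\<in>Ms. z (h, n) m * cnj (z (h', n') m)) = (\<Sum>m=lo n n'..<up n n'. z (h, n) m * cnj (z (h', n') m))"
    proof (rule sum.mono_neutral_right)
      show "\<forall>i\<in>Ms - {lo n n'..<up n n'}. z (h, n) i * cnj (z (h', n') i) = 0"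
      proof
        fix m assume "m \<in> Ms - {lo n n'..<up n n'}"
        hence "\<not> (D < m * n \<and> m * n \<le> D2 \<and> D < m * n' \<and> m * n' \<le> D2)" using mem_iff[OF n(1,2), of m] by blast
        thus "z (h, n) m * cnj (z (h', n') m) = 0" unfolding z_def by (simp split: if_split) blast
      qed
    qed (use \<open>{lo n n'..<up n n'} \<subseteq> Ms\<close> in \<open>auto simp: Ms_def\<close>)
    also have "... = (\<Sum>m=lo n n'..<up n n'. (\<gamma> h n * cnj (\<gamma> h' n')) * ee (Ph h n h' n' m))"
    proof (rule sum.cong[OF refl])
      fix m assume "m \<in> {lo n n'..<up n n'}"
      hence "D < m * n \<and> m * n \<le> D2 \<and> D < m * n' \<and> m * n' \<le> D2" using mem_iff[OF n(1,2)] by blast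
      thus "z (h, n) m * cnj (z (h', n') m) = (\<gamma> h n * cnj (\<gamma> h' n')) * ee (Ph h n h' n' m)"
        by (simp add: z_def Ph_def cnj_ee ee_add[of _ "- _", simplified])
    qed
    finally have "norm (\<Sum>m\<in>Ms. z (h, n) m * cnj (z (h', n') m))
       = norm (\<gamma> h n) * norm (\<gamma> h' n') * ?S h n h' n'"
      by (simp add: norm_mult flip: sum_distrib_left)
    also have "... \<le> A * A * ?S h n h' n'"
      using \<gamma> A by (intro mult_right_mono mult_mono) auto
    finally show ?thesis by (simp add: power2_eq_square)
  qed
  have E_bound: "?S h n h' n' \<le> E"
    if hn: "(h, n) \<in> P" "(h', n') \<in> P" "h * n' = h' * n + j" and j: "j \<in> {1..J}" for h n h' n' j
  proof -
    define F where "F = sqrt (x * real j * real N / real D ^ 3)"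
    have n: "n > 0" "n' > 0" "n \<ge> N" "n' \<ge> N" "n < 2 * N" "n' < 2 * N" "h' < 2 * H" using hn N by (auto simp: P_def)
    have range: "D < m * n \<and> m * n \<le> 2 * D" if "lo n n' \<le> m" "m < up n n'" for m
      using mem_iff[OF n(1,2), of m] that D2 by auto
    have j1: "j \<ge> 1" "real j \<le> 4 * R^2" using j J by auto
    have *: "?S h n h' n' \<le> 1536 * (real D / real N) * F + 64 / F"
      unfolding Ph_def F_def using exp_sum_hyperbola_pair_bound[OF x del N n(7) n(3,5,4,6) j1(1) hn(3) DHN range] .
    have F_le: "F \<le> 3 / R^2"
    proof -
      have "x * real j * real N / real D ^ 3 \<le> x * (4 * R^2) * real N / real D ^ 3"
        using x j1 Np Dpos by (intro divide_right_mono mult_right_mono mult_left_mono) auto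
      also have "... = 4 * (x * R ^ 6 * real N) / (real D ^ 3 * R ^ 4)"
        using R by (simp add: power2_eq_square power4_eq_xxxx eval_nat_numeral)
      also have "... \<le> 4 * (2 * real D ^ 3) / (real D ^ 3 * R ^ 4)"
        using c1 Dpos R by (intro divide_right_mono mult_left_mono) auto
      also have "... \<le> (3 / R^2)^2"
        using Dpos R by (simp add: power_divide divide_right_mono flip: power_mult)
      finally show ?thesis unfolding F_def by (intro real_le_lsqrt) auto
    qed
    have "1 / F \<le> (3 / 2) * (real D / real N) / R^2"
    proof -
      have "((2 / 3) * (real N / real D) * R^2)^2 = (4 / 9) * (real N)^2 * R ^ 4 / (real D)^2"
        by (simp add: power_mult_distrib power_divide flip: power_mult)
      also have "... = (4 / 9) * (real D * real N * R ^ 4) * real N / real D ^ 3"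
        using Dpos by (simp add: power2_eq_square power3_eq_cube)
      also have "... \<le> (4 / 9) * (2 * x) * real N / real D ^ 3"
        using c2 Np Dpos by (intro divide_right_mono mult_right_mono mult_left_mono) auto
      also have "... \<le> x * real j * real N / real D ^ 3"
      proof -
        have "(4 / 9) * (2 * x) \<le> x * real j" using j1 x mult_left_mono[of 1 "real j" x] by simp
        thus ?thesis using Np Dpos by (intro divide_right_mono mult_right_mono) auto
      qed
      finally have "(2 / 3) * (real N / real D) * R^2 \<le> F" unfolding F_def by (rule real_le_rsqrt)
      moreover have "(2 / 3) * (real N / real D) * R^2 > 0" using Np Dpos R by auto
      ultimately have "1 / F \<le> 1 / ((2 / 3) * (real N / real D) * R^2)" by (intro frac_le) auto
      also have "... = (3 / 2) * (real D / real N) / R^2" using Np Dpos R by (simp add: field_simps)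
      finally show ?thesis .
    qed
    hence "64 / F \<le> 64 * ((3 / 2) * (real D / real N) / R^2)" by linarith
    moreover have "1536 * (real D / real N) * F \<le> 1536 * (real D / real N) * (3 / R^2)"
      using F_le by (intro mult_left_mono) auto
    ultimately have "?S h n h' n'
        \<le> 1536 * (real D / real N) * (3 / R^2) + 64 * ((3 / 2) * (real D / real N) / R^2)" using * by linarith
    \<comment> \<open>1536 * 3 + 64 * 3/2 = 4704, rounded up to 4800 in \<open>E\<close>.\<close>
    also have "... = 4704 * (real D / real N / R^2)" by simp
    also have "... \<le> 4800 * (real D / real N / R^2)" by (intro mult_right_mono) auto
    finally show ?thesis unfolding E_def by simp
  qed
  define f where "f = (\<lambda>(p, p'). norm (\<Sum>m\<in>Ms. z p m * cnj (z p' m)))"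
  have f0: "f q \<le> A^2 * (2 * real D / real N)" if "q \<in> T" for q
  proof -
    obtain h n h' n' where q_eq: "q = ((h, n), (h', n'))" by (metis surj_pair)
    have hn: "(h, n) \<in> P" "(h', n') \<in> P" using that by (auto simp: q_eq T_def)
    have "?S h n h' n' \<le> real (card {lo n n'..<up n n'})"
      using norm_sum[of "\<lambda>m. ee (Ph h n h' n' m)" "{lo n n'..<up n n'}"] by simp
    also have "... \<le> real (card Ms)"
      using hn by (intro of_nat_mono card_mono seg_sub) (auto simp: Ms_def P_def)
    also have "... \<le> 2 * real D / real N" by (rule cardMs)
    finally have "A^2 * ?S h n h' n' \<le> A^2 * (2 * real D / real N)"
      by (intro mult_left_mono) auto
    thus ?thesis using zz[OF hn] unfolding f_def q_eq by simp
  qed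
  have f1: "f q \<le> A^2 * E" if q: "q \<in> T - Q 0" for q
  proof -
    obtain h n h' n' where q_eq: "q = ((h, n), (h', n'))" by (metis surj_pair)
    obtain j where j: "j \<in> {1..J}" "q \<in> Q j \<or> q \<in> Q' j"
      using subsetD[OF T_sub q] unfolding UN_iff Un_iff by (elim bexE)
    have hn: "(h, n) \<in> P" "(h', n') \<in> P" using that by (auto simp: q_eq T_def)
    have "?S h n h' n' \<le> E"
    proof (cases "q \<in> Q j")
      case True
      thus ?thesis using E_bound[OF hn _ j(1)] by (simp add: q_eq Q_def)
    next
      case False
      have "?S h n h' n' = norm (cnj (\<Sum>m=lo n n'..<up n n'. ee (Ph h n h' n' m)))"
        by (rule complex_mod_cnj[symmetric])
      also have "cnj (\<Sum>m=lo n n'..<up n n'. ee (Ph h n h' n' m)) = (\<Sum>m=lo n' n..<up n' n. ee (Ph h' n' h n m))"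
        by (simp add: cnj_ee Ph_def lo_def up_def max.commute min.commute)
      finally show ?thesis using E_bound[OF hn(2,1) _ j(1)] False j(2) by (simp add: q_eq Q'_def)
    qed
    hence "A^2 * ?S h n h' n' \<le> A^2 * E" by (intro mult_left_mono) auto
    thus ?thesis using zz[OF hn] unfolding f_def q_eq by simp
  qed
  have E0: "E \<ge> 0" unfolding E_def by simp
  have "(\<Sum>q\<in>T. f q) = (\<Sum>q\<in>T \<inter> Q 0. f q) + (\<Sum>q\<in>T - Q 0. f q)"
    using sum.Int_Diff[OF finT] .
  also have "... \<le> real (card (T \<inter> Q 0)) * (A^2 * (2 * real D / real N)) + real (card (T - Q 0)) * (A^2 * E)"
    using f0 f1 by (intro add_mono sum_bounded_above) auto
  also have "... \<le> (real H * real N * \<Delta>) * (A^2 * (2 * real D / real N)) + (8 * R^2 * (real H * real N * \<Delta>)) * (A^2 * E)"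
  proof (intro add_mono mult_right_mono cardT)
    have "card (T \<inter> Q 0) \<le> card (Q 0)" using finQ by (intro card_mono) auto
    thus "real (card (T \<inter> Q 0)) \<le> real H * real N * \<Delta>" using cardQ[of 0] by linarith
  qed (use E0 in auto)
  also have "... = 38402 * (A^2 * \<Delta> * real H * real D)"
    unfolding E_def using Np R by (simp add: field_simps)
  finally have sumT: "(\<Sum>q\<in>T. f q) \<le> 38402 * (A^2 * \<Delta> * real H * real D)" .
  have f_nonneg: "0 \<le> (\<Sum>q\<in>T. f q)" by (intro sum_nonneg) (auto simp: f_def)
  have "(norm (\<Sum>p\<in>P. \<Sum>m\<in>Ms. \<beta> m * z p m))^2 \<le> B^2 * real (K * card Ms) * (\<Sum>q\<in>T. f q)"
    unfolding T_def f_def by (intro bilinear_Cauchy_Schwarz finP bin_lt \<beta> B) (auto simp: Ms_def)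
  also have "... \<le> B^2 * ((4 * real H * real N / R^2) * (2 * real D / real N)) * (38402 * (A^2 * \<Delta> * real H * real D))"
  proof (intro mult_mono mult_left_mono sumT)
    show "real (K * card Ms) \<le> (4 * real H * real N / R^2) * (2 * real D / real N)"
      unfolding of_nat_mult by (intro mult_mono K cardMs) auto
  qed (use f_nonneg in auto)
  \<comment> \<open>The factor is 8 * 38402, where 38402 = 2 + 8 * 4800 comes from the diagonal and
    the other pairs. It is below 600^2, and \<Delta> <= \<Delta>^2 then makes the bound a perfect
    square.\<close>
  also have "... = 307216 * \<Delta> * (A * B * real H * real D / R)^2"
    using Np R by (simp add: power2_eq_square)
  also have "... \<le> 360000 * \<Delta>^2 * (A * B * real H * real D / R)^2"
  proof (intro mult_right_mono mult_mono)
    show "\<Delta> \<le> \<Delta>^2" using \<Delta>1 by (simp add: power2_eq_square)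
  qed (use \<Delta>1 in auto)
  also have "... = (600 * A * B * \<Delta> * real H * real D / R)^2"
    by (simp add: power2_eq_square)
  finally have "norm (\<Sum>p\<in>P. \<Sum>m\<in>Ms. \<beta> m * z p m) \<le> 600 * A * B * \<Delta> * real H * real D / R"
    by (rule power2_le_imp_le) (use A B \<Delta>1 R in auto)
  thus ?thesis unfolding S .
qed

section \<open>Sums over a dyadic block\<close>

lemma tau_Suc_divisors:
  assumes "w > 0"
  shows "tau (Suc k) w = (\<Sum>v | v dvd w. tau k v)"
  unfolding tau_Suc[OF assms]
proof (rule sum.reindex_bij_witness[of _ "\<lambda>v. w div v" "\<lambda>v. w div v"])
  fix a assume "a \<in> {v. v dvd w}"
  then obtain b where b: "w = a * b" by auto
  hence "a > 0" "b > 0" using assms by auto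
  thus "w div (w div a) = a" "w div a \<in> {v. v dvd w}" "tau k (w div a) = tau k (w div a)" using b by auto
next
  fix a assume "a \<in> {v. v dvd w}"
  then obtain b where b: "w = a * b" by auto
  hence "a > 0" "b > 0" using assms by auto
  thus "w div (w div a) = a" "w div a \<in> {v. v dvd w}" using b by auto
qed

lemma sum_over_factorizations:
  fixes \<alpha> G :: "nat \<Rightarrow> complex"
  assumes G: "\<And>p. p > X \<Longrightarrow> G p = 0"
  shows "(\<Sum>u=1..X. \<Sum>n=1..X. \<alpha> u * G (u * n)) = (\<Sum>p=1..X. (\<Sum>u | u dvd p. \<alpha> u) * G p)"
proof -
  let ?S = "{(u, n). u \<in> {1..X} \<and> n \<in> {1..X} \<and> u * n \<le> X}"
  have "(\<Sum>u=1..X. \<Sum>n=1..X. \<alpha> u * G (u * n)) = (\<Sum>(u, n)\<in>{1..X} \<times> {1..X}. \<alpha> u * G (u * n))"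
    by (rule sum.cartesian_product)
  also have "... = (\<Sum>(u, n)\<in>?S. \<alpha> u * G (u * n))"
  proof -
    have "p \<le> X" if "G p \<noteq> 0" for p using G that by (meson not_le)
    thus ?thesis by (intro sum.mono_neutral_right) auto
  qed
  also have "... = (\<Sum>(p, u)\<in>(SIGMA p:{1..X}. {u. u dvd p}). \<alpha> u * G p)"
  proof (rule sum.reindex_bij_witness[of _ "\<lambda>(p, u). (u, p div u)" "\<lambda>(u, n). (u * n, u)"])
    fix q assume "q \<in> (SIGMA p:{1..X}. {u. u dvd p})"
    then obtain u n where q: "q = (u * n, u)" "1 \<le> u * n" "u * n \<le> X" by (auto elim!: dvdE)
    hence un: "u > 0" "n > 0" by (auto intro: gr0I)
    have "u \<le> X" "n \<le> X" using le_trans[OF _ q(3), of u] le_trans[OF _ q(3), of n] un by auto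
    thus "(case (case q of (p, u) \<Rightarrow> (u, p div u)) of (u, n) \<Rightarrow> (u * n, u)) = q"
      "(case q of (p, u) \<Rightarrow> (u, p div u)) \<in> ?S" using q un by auto
  next
    fix q assume "q \<in> ?S"
    then obtain u n where q: "q = (u, n)" "1 \<le> u" "1 \<le> n" "u * n \<le> X" by auto
    thus "(case (case q of (u, n) \<Rightarrow> (u * n, u)) of (p, u) \<Rightarrow> (u, p div u)) = q"
      "(case q of (u, n) \<Rightarrow> (u * n, u)) \<in> (SIGMA p:{1..X}. {u. u dvd p})"
      "(case (case q of (u, n) \<Rightarrow> (u * n, u)) of (p, u) \<Rightarrow> \<alpha> u * G p) = (case q of (u, n) \<Rightarrow> \<alpha> u * G (u * n))"
      by auto
  qed
  also have "... = (\<Sum>p=1..X. \<Sum>u | u dvd p. \<alpha> u * G p)"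
    by (rule sum.Sigma[symmetric]) auto
  finally show ?thesis by (simp add: sum_distrib_right)
qed

lemma sum_dyadic_blocks:
  fixes g :: "nat \<Rightarrow> 'a :: comm_monoid_add"
  shows "(\<Sum>n=1..<2^I. g n) = (\<Sum>i<I. \<Sum>n=2^i..<2*2^i. g n)"
proof (induction I)
  case (Suc I)
  have "{1..<2^Suc I} = {1..<2^I} \<union> {2^I..<2*2^I :: nat}" by auto
  hence "(\<Sum>n=1..<2^Suc I. g n) = (\<Sum>n=1..<2^I. g n) + (\<Sum>n=2^I..<2*2^I. g n)"
    by (simp only:) (intro sum.union_disjoint, auto)
  thus ?case using Suc by simp
qed simp

text \<open>The bound \<open>y \<ge> 40\<close> only serves to guarantee \<open>16000 H N \<le> D\<close> whenever \<open>N\<^sup>2 \<le> 2 D\<close>.\<close>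

locale hyperbola_block =
  fixes x y R \<delta> \<Delta> :: real and D D2 H I Y :: nat and c :: "nat \<Rightarrow> complex"
  assumes x: "x = y ^ 19" and y: "y \<ge> 40" and R: "1 \<le> R" "R \<le> y" and D: "real D = R * y ^ 9"
    and D2: "D2 \<le> 2 * D" and del: "0 \<le> \<delta>" "\<delta> \<le> 1"
    and H: "H \<ge> 1" "real H \<le> 2 * R^2" and c: "\<And>h. norm (c h) \<le> 1"
    and \<Delta>: "\<And>v. 0 < v \<Longrightarrow> v \<le> 2 * D \<Longrightarrow> real (card {d. d dvd v}) \<le> \<Delta>"
    and harm: "(\<Sum>r=1..2*D. 1 / real r) \<le> \<Delta>"
    and I: "2 * D < 2 ^ I" "real I \<le> \<Delta>"
    and Y: "Y = nat \<lfloor>R^2\<rfloor>"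
begin

text \<open>The coefficients \<open>c h\<close> will be the conjugate signs of the sums over d, so
  that a bound for this combined sum bounds the sum of their absolute values over a dyadic range of
  h.\<close>

definition f :: "nat \<Rightarrow> complex" where
  "f d = (\<Sum>h=H..<2*H. c h * ee (real h * (x / (real d + \<delta>))))"

text \<open>The admissible size for one dyadic range of frequencies: multiplied by the Fourier
  weight min (1/H) (R/H^2) it is at most 2 D / R = 2 y^9. The second term is what the decay R/h^2
  beyond h = R allows.\<close>

definition W :: real where "W = real D / R * (real H + (real H)^2 / R)"

text \<open>Cutting off by a window lets the factors of d run over full ranges up to 2 D, where sums
  can be freely interchanged.\<close>

definition wnd :: "nat \<Rightarrow> complex" where
  "wnd d = (if D < d \<and> d \<le> D2 then f d else 0)"

lemma y_pos: "y > 0" and x_pos: "x > 0" and D_pos: "real D > 0" "D \<ge> 1"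
proof -
  show y0: "y > 0" using y by simp
  thus "x > 0" using x by simp
  show "real D > 0" using D R y0 by simp
  thus "D \<ge> 1" by simp
qed

lemma Delta_ge_1: "\<Delta> \<ge> 1"
  using \<Delta>[of 1] D_pos by simp

text \<open>Here 4096000000 = 40^6, from D = R y^3 y^6 with y^3 >= R^3 and y^6 >= 40^6.\<close>

lemma D_ge: "R ^ 4 * 4096000000 \<le> real D"
proof -
  have "40 ^ 6 \<le> y ^ 6" using y by (intro power_mono) auto
  moreover have "R ^ 3 \<le> y ^ 3" using R by (intro power_mono) auto
  ultimately have "R ^ 3 * 40 ^ 6 \<le> y ^ 3 * y ^ 6" using y_pos R by (intro mult_mono) auto
  hence "R * (R ^ 3 * 40 ^ 6) \<le> R * (y ^ 3 * y ^ 6)" using R by (intro mult_left_mono) auto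
  also have "R * (y ^ 3 * y ^ 6) = real D" by (simp add: D flip: power_add)
  also have "R * (R ^ 3 * 40 ^ 6) = R ^ 4 * 4096000000" by (simp add: eval_nat_numeral)
  finally show ?thesis .
qed

lemma pow_R_mono: "R ^ i \<le> y ^ i"
  using R by (intro power_mono) auto

text \<open>\<open>param1\<close> and \<open>param2\<close> are the squares of the conditions
  \<open>c1\<close> and \<open>c2\<close> of \<open>type_II_bound\<close> for N^2 about 2 D, and
  \<open>param3\<close> and \<open>param4\<close> serve the two terms of
  \<open>exp_sum_hyperbola_bound\<close>. The first three are powers of R <= y, with equality at R =
  y; the last has room to spare.\<close>

lemma param1: "x^2 * R ^ 12 \<le> real D ^ 5"
proof -
  have "x^2 * R ^ 12 = (y ^ 38 * R ^ 5) * R ^ 7" by (simp add: x mult_ac flip: power_mult power_add)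
  also have "... \<le> (y ^ 38 * R ^ 5) * y ^ 7" using R y_pos by (intro mult_left_mono pow_R_mono) auto
  also have "... = real D ^ 5" by (simp add: D power_mult_distrib mult_ac flip: power_mult power_add)
  finally show ?thesis .
qed

lemma param2: "real D ^ 3 * R ^ 8 \<le> x^2"
proof -
  have "real D ^ 3 * R ^ 8 = y ^ 27 * R ^ 11" by (simp add: D power_mult_distrib mult_ac flip: power_mult power_add)
  also have "... \<le> y ^ 27 * y ^ 11" using y_pos by (intro mult_left_mono pow_R_mono) auto
  also have "... = x^2" by (simp add: x flip: power_mult power_add)
  finally show ?thesis .
qed

lemma param3: "x * R ^ 11 \<le> real D ^ 3"
proof -
  have "x * R ^ 11 = (y ^ 19 * R ^ 3) * R ^ 8" by (simp add: x mult_ac flip: power_add)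
  also have "... \<le> (y ^ 19 * R ^ 3) * y ^ 8" using R y_pos by (intro mult_left_mono pow_R_mono) auto
  also have "... = real D ^ 3" by (simp add: D power_mult_distrib mult_ac flip: power_mult power_add)
  finally show ?thesis .
qed

lemma param4: "R^2 * real D \<le> x"
proof -
  have "R^2 * real D = y ^ 9 * R ^ 3" by (simp add: D power2_eq_square power3_eq_cube mult_ac)
  also have "... \<le> y ^ 9 * y ^ 3" using y_pos by (intro mult_left_mono pow_R_mono) auto
  also have "... = y ^ 12" by (simp flip: power_add)
  also have "... \<le> x" unfolding x using y by (intro power_increasing) auto
  finally show ?thesis .
qed

lemma Y_le: "real Y \<le> R^2" unfolding Y by simp

lemma less_Y: "Y < p \<Longrightarrow> R^2 < real p" unfolding Y by linarith

lemma Y_le_D: "Y \<le> D"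
proof -
  have "R^2 \<ge> 1" using R by simp
  hence "1 \<le> R^2 * 4096000000" by linarith
  hence "R^2 * 1 \<le> R^2 * (R^2 * 4096000000)" by (rule mult_left_mono) simp
  hence "R^2 \<le> R ^ 4 * 4096000000" by (simp add: power2_eq_square power4_eq_xxxx)
  hence "real Y \<le> real D" using Y_le D_ge by linarith
  thus ?thesis by simp
qed

lemma tau_le: "0 < w \<Longrightarrow> w \<le> 2 * D \<Longrightarrow> norm (of_nat (tau k w) :: complex) \<le> \<Delta> ^ k"
  using tau_le_power[of "2*D" \<Delta> w k, OF \<Delta>] Delta_ge_1 by simp

section \<open>Bilinear (type II) sums inside the block\<close>

lemma type_II_block:
  assumes N: "N = 2 ^ i" and \<alpha>: "\<And>n. norm (\<alpha> n) \<le> A" and \<beta>: "\<And>m. norm (\<beta> m) \<le> B"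
    and supp: "n0 \<in> {N..<2*N}" "Y < n0" "n0 * n0 \<le> 2 * D"
  shows "norm (\<Sum>n=N..<2*N. \<Sum>m=1..2*D. \<alpha> n * \<beta> m * wnd (n * m)) \<le> 600 * A * B * \<Delta> * real H * real D / R"
proof -
  let ?t = "\<lambda>n m h. if D < m * n \<and> m * n \<le> D2 then (c h * \<alpha> n) * \<beta> m * ee (real h * (x / (real (m * n) + \<delta>))) else 0"
  have A0: "A \<ge> 0" using \<alpha>[of 0] norm_ge_zero order_trans by blast
  have N1: "N \<ge> 1" by (simp add: N)
  \<comment> \<open>A single element \<open>n0\<close> of the dyadic range that satisfies the
    support conditions locates N: R^2 < n0 < 2 N and N^2 <= n0^2 <= 2 D.\<close>
  have NN: "N * N \<le> 2 * D"
  proof -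
    have "N * N \<le> n0 * n0" using supp by (intro mult_mono) auto
    thus ?thesis using supp by simp
  qed
  have NNr: "(real N)^2 \<le> 2 * real D"
    unfolding power2_eq_square using NN by (metis of_nat_le_iff of_nat_mult of_nat_numeral)
  have R2: "R^2 \<le> 2 * real N" using less_Y[OF supp(2)] supp(1) by auto
  have c1: "x * R ^ 6 * real N \<le> 2 * real D ^ 3"
  proof (rule power2_le_imp_le)
    have "(x * R ^ 6 * real N)^2 = (x^2 * R ^ 12) * (real N)^2" by (simp add: power_mult_distrib flip: power_mult)
    also have "... \<le> real D ^ 5 * (2 * real D)" by (intro mult_mono param1 NNr) auto
    also have "... = 2 * real D ^ 6" by (simp add: eval_nat_numeral)
    also have "... \<le> 4 * real D ^ 6" by simp
    also have "... = (2 * real D ^ 3)^2" by (simp add: power_mult_distrib flip: power_mult)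
    finally show "(x * R ^ 6 * real N)^2 \<le> (2 * real D ^ 3)^2" .
  qed simp
  have c2: "real D * real N * R ^ 4 \<le> 2 * x"
  proof (rule power2_le_imp_le)
    have "(real D * real N * R ^ 4)^2 = (real D)^2 * R ^ 8 * (real N)^2" by (simp add: power_mult_distrib mult_ac flip: power_mult)
    also have "... \<le> (real D)^2 * R ^ 8 * (2 * real D)" using R by (intro mult_left_mono NNr) auto
    also have "... = 2 * (real D ^ 3 * R ^ 8)" by (simp add: power2_eq_square power3_eq_cube)
    also have "... \<le> 4 * x^2" using param2 x_pos by (intro mult_mono) auto
    also have "... = (2 * x)^2" by (simp add: power_mult_distrib)
    finally show "(real D * real N * R ^ 4)^2 \<le> (2 * x)^2" .
  qed (use x_pos in simp)
  have DHN: "16000 * H * N \<le> D"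
  proof -
    have "16000 * real H * real N \<le> real D"
    proof (rule power2_le_imp_le)
      have "(16000 * real H * real N)^2 = 256000000 * (real H)^2 * (real N)^2" by (simp add: power_mult_distrib)
      also have "... \<le> 256000000 * (2 * R^2)^2 * (2 * real D)"
        by (intro mult_mono mult_left_mono power_mono H NNr) auto
      also have "... = (R ^ 4 * 2048000000) * real D" by (simp add: power_mult_distrib flip: power_mult)
      also have "... \<le> real D * real D" using D_ge R by (intro mult_right_mono) auto
      finally show "(16000 * real H * real N)^2 \<le> (real D)^2" by (simp add: power2_eq_square)
    qed simp
    thus ?thesis by (metis of_nat_le_iff of_nat_mult of_nat_numeral)
  qed
  have "(\<Sum>n=N..<2*N. \<Sum>m=1..2*D. \<alpha> n * \<beta> m * wnd (n * m))
     = (\<Sum>n=N..<2*N. \<Sum>m=1..2*D. \<Sum>h=H..<2*H.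
         ?t n m h)"
  proof (intro sum.cong refl)
    fix n m
    show "\<alpha> n * \<beta> m * wnd (n * m) = (\<Sum>h=H..<2*H.
         ?t n m h)"
    proof (cases "D < m * n \<and> m * n \<le> D2")
      case True
      hence "wnd (n * m) = f (m * n)" by (simp add: wnd_def mult.commute)
      thus ?thesis using True by (simp add: f_def sum_distrib_left mult_ac)
    next
      case False
      hence "wnd (n * m) = 0" by (auto simp: wnd_def mult.commute[of n m])
      thus ?thesis using False by (simp only: if_False) simp
    qed
  qed
  also have "... = (\<Sum>n=N..<2*N. \<Sum>h=H..<2*H. \<Sum>m=1..2*D.
         ?t n m h)"
    by (rule sum.cong[OF refl], rule sum.swap)
  also have "... = (\<Sum>h=H..<2*H. \<Sum>n=N..<2*N. \<Sum>m=1..2*D.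
         ?t n m h)"
    by (rule sum.swap)
  also have "norm ... \<le> 600 * A * B * \<Delta> * real H * real D / R"
  proof (rule type_II_bound[OF x_pos del H(1) N1 D2 R(1) R2 DHN c1 c2])
    fix v assume "0 < v" "v \<le> 4 * H * N"
    thus "real (card {d. d dvd v}) \<le> \<Delta>" using DHN by (intro \<Delta>) auto
  next
    fix h n
    show "norm (c h * \<alpha> n) \<le> A" unfolding norm_mult using mult_mono[OF c[of h] \<alpha>[of n]] A0 by simp
  qed (rule \<beta>)
  finally show ?thesis .
qed

lemma type_II_half:
  assumes \<alpha>: "\<And>n. norm (\<alpha> n) \<le> A" and \<beta>: "\<And>m. norm (\<beta> m) \<le> B"
    and supp: "\<And>n. \<alpha> n \<noteq> 0 \<Longrightarrow> Y < n \<and> n * n \<le> 2 * D"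
  shows "norm (\<Sum>n=1..2*D. \<Sum>m=1..2*D. \<alpha> n * \<beta> m * wnd (n * m)) \<le> 600 * A * B * \<Delta>^2 * real H * real D / R"
proof -
  have A0: "A \<ge> 0" using \<alpha>[of 0] norm_ge_zero order_trans by blast
  have B0: "B \<ge> 0" using \<beta>[of 0] norm_ge_zero order_trans by blast
  let ?b = "600 * A * B * \<Delta> * real H * real D / R"
  have b0: "?b \<ge> 0" using A0 B0 Delta_ge_1 R by (intro divide_nonneg_nonneg mult_nonneg_nonneg) auto
  let ?g = "\<lambda>n. \<Sum>m=1..2*D. \<alpha> n * \<beta> m * wnd (n * m)"
  have out: "?g n = 0" if "n > 2 * D" for n
  proof -
    have "\<alpha> n = 0"
    proof (rule ccontr)
      assume "\<alpha> n \<noteq> 0"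
      hence "n * n \<le> 2 * D" using supp by blast
      moreover have "n * 1 \<le> n * n" using that by (intro mult_left_mono) auto
      ultimately show False using that by linarith
    qed
    thus ?thesis by simp
  qed
  have "(\<Sum>n=1..2*D. ?g n) = (\<Sum>n=1..<2^I. ?g n)"
    using I(1) out by (intro sum.mono_neutral_left) auto
  also have "... = (\<Sum>i<I. \<Sum>n=2^i..<2*2^i. ?g n)" by (rule sum_dyadic_blocks)
  also have "norm ... \<le> (\<Sum>i<I. ?b)"
  proof (rule sum_norm_le)
    fix i
    show "norm (\<Sum>n=2^i..<2*2^i. ?g n) \<le> ?b"
    proof (cases "\<exists>n0\<in>{2^i..<2*2^i}. \<alpha> n0 \<noteq> 0")
      case True
      then obtain n0 where n0: "n0 \<in> {2^i..<2*2^i}" "\<alpha> n0 \<noteq> 0" by blast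
      from type_II_block[of _ i \<alpha> A \<beta> B n0, OF refl \<alpha> \<beta> n0(1)] supp[OF n0(2)] show ?thesis by blast
    next
      case False
      hence "(\<Sum>n=2^i..<2*2^i. ?g n) = 0" by (intro sum.neutral) auto
      thus ?thesis using b0 by simp
    qed
  qed
  also have "... = real I * ?b" by (simp only: sum_constant card_lessThan)
  also have "... \<le> \<Delta> * ?b" using I(2) b0 by (rule mult_right_mono)
  also have "... = 600 * A * B * \<Delta>^2 * real H * real D / R" by (simp add: power2_eq_square)
  finally show ?thesis .
qed

text \<open>From p Y <= D < p q it follows that q > Y as well. If p^2 <= 2 D, then p is the short
  variable of \<open>type_II_half\<close>; otherwise q <= p because p q <= 2 D, so q^2 <= 2 D and
  the two variables exchange their roles.\<close>

lemma type_II_range: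
  assumes \<alpha>: "\<And>n. norm (\<alpha> n) \<le> A" and \<beta>: "\<And>m. norm (\<beta> m) \<le> B"
    and supp: "\<And>p. \<alpha> p \<noteq> 0 \<Longrightarrow> Y < p \<and> p * Y \<le> D"
  shows "norm (\<Sum>p=1..2*D. \<Sum>q=1..2*D. \<alpha> p * \<beta> q * wnd (p * q)) \<le> 1200 * A * B * \<Delta>^2 * real H * real D / R"
proof -
  have A0: "A \<ge> 0" using \<alpha>[of 0] norm_ge_zero order_trans by blast
  have B0: "B \<ge> 0" using \<beta>[of 0] norm_ge_zero order_trans by blast
  define a1 where "a1 p = (if p * p \<le> 2 * D then \<alpha> p else 0)" for p
  define a2 where "a2 p = (if p * p \<le> 2 * D then 0 else \<alpha> p)" for p
  define b2 where "b2 q = (if Y < q \<and> q * q \<le> 2 * D then \<beta> q else 0)" for q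
  have e: "a2 p * \<beta> q * wnd (p * q) = b2 q * a2 p * wnd (q * p)" for p q
  proof (cases "a2 p \<noteq> 0 \<and> wnd (p * q) \<noteq> 0")
    case True
    have p: "\<not> p * p \<le> 2 * D" "\<alpha> p \<noteq> 0" using True by (auto simp: a2_def split: if_splits)
    have pq: "D < p * q" "p * q \<le> 2 * D" using True D2 by (auto simp: wnd_def split: if_splits)
    have "p * Y < p * q" using supp[OF p(2)] pq by linarith
    hence "Y < q" by simp
    moreover have "q * q \<le> 2 * D"
    proof -
      have "q \<le> p" using p pq by (metis linorder_not_le mult_le_mono2 nat_less_le order.strict_trans2 order_le_less_trans)
      hence "q * q \<le> p * q" by (rule mult_right_mono) simp
      thus ?thesis using pq by linarith
    qed
    ultimately show ?thesis by (simp add: b2_def mult_ac)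
  next
    case False
    thus ?thesis by (auto simp: mult_ac)
  qed
  have "\<alpha> p * \<beta> q * wnd (p * q) = a1 p * \<beta> q * wnd (p * q) + b2 q * a2 p * wnd (q * p)" for p q
    unfolding e[symmetric] by (simp add: a1_def a2_def)
  hence "(\<Sum>p=1..2*D. \<Sum>q=1..2*D. \<alpha> p * \<beta> q * wnd (p * q))
    = (\<Sum>p=1..2*D. \<Sum>q=1..2*D. a1 p * \<beta> q * wnd (p * q)) + (\<Sum>p=1..2*D. \<Sum>q=1..2*D. b2 q * a2 p * wnd (q * p))"
    by (simp only: sum.distrib)
  also have "(\<Sum>p=1..2*D. \<Sum>q=1..2*D. b2 q * a2 p * wnd (q * p)) = (\<Sum>q=1..2*D. \<Sum>p=1..2*D. b2 q * a2 p * wnd (q * p))"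
    by (rule sum.swap)
  also have "norm ((\<Sum>p=1..2*D. \<Sum>q=1..2*D. a1 p * \<beta> q * wnd (p * q)) + (\<Sum>q=1..2*D. \<Sum>p=1..2*D. b2 q * a2 p * wnd (q * p)))
     \<le> 600 * A * B * \<Delta>^2 * real H * real D / R + 600 * B * A * \<Delta>^2 * real H * real D / R"
  proof (intro order_trans[OF norm_triangle_ineq] add_mono type_II_half)
    show "norm (a1 n) \<le> A" "norm (a2 n) \<le> A" for n using \<alpha>[of n] A0 by (auto simp: a1_def a2_def)
    show "norm (b2 n) \<le> B" for n using \<beta>[of n] B0 by (auto simp: b2_def)
    show "norm (\<beta> n) \<le> B" for n by (rule \<beta>)
    show "Y < n \<and> n * n \<le> 2 * D" if "a1 n \<noteq> 0" for n using that supp[of n] by (auto simp: a1_def split: if_splits)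
    show "Y < n \<and> n * n \<le> 2 * D" if "b2 n \<noteq> 0" for n using that by (auto simp: b2_def split: if_splits)
  qed
  also have "... = 1200 * A * B * \<Delta>^2 * real H * real D / R" by (simp add: mult_ac)
  finally show ?thesis .
qed

section \<open>Sums with one long smooth variable (type I)\<close>

lemma Y_ge_1: "Y \<ge> 1"
proof -
  have "R^2 \<ge> 1" using R by simp
  thus ?thesis unfolding Y by linarith
qed

lemma wnd_out: "u \<ge> 1 \<Longrightarrow> p > 2 * D \<Longrightarrow> wnd (u * p) = 0"
proof -
  assume "u \<ge> 1" "p > 2 * D"
  moreover from \<open>u \<ge> 1\<close> have "1 * p \<le> u * p" by (rule mult_right_mono) simp
  ultimately have "D2 < u * p" using D2 by linarith
  thus ?thesis by (simp add: wnd_def)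
qed

text \<open>The conditions D < u n Y and u n v <= 2 D force v <= 2 Y. For such v the admissible n
  form an interval, on which d = n r with r = u v fixed, and \<open>exp_sum_hyperbola_bound\<close>
  applies to each h.\<close>

lemma type_I_inner:
  assumes u: "u \<ge> 1" and v: "v \<ge> 1"
  shows "norm (\<Sum>n=1..2*D. if D < u * n * Y then wnd (u * n * v) else 0)
    \<le> (if v \<le> 2 * Y then real H * (128 * sqrt (2 * real H * x / real D) + 64 * (real D / sqrt (x / real D)) * (1 / real u) * (1 / real v)) else 0)"
proof (cases "v \<le> 2 * Y")
  case False
  have "(if D < u * n * Y then wnd (u * n * v) else 0) = 0" for n
  proof (cases "D < u * n * Y")
    case True
    have "u * n * (2 * Y) \<le> u * n * v" using False by (intro mult_left_mono) auto
    hence "2 * D < u * n * v" using True by linarith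
    thus ?thesis using D2 by (simp add: wnd_def)
  qed simp
  thus ?thesis using False by simp
next
  case True
  define r where "r = u * v"
  have r: "r \<ge> 1" using mult_mono[OF u v] by (simp add: r_def)
  have uY: "u * Y > 0" using u Y_ge_1 by simp
  define a where "a = max (D div (u * Y) + 1) (D div r + 1)"
  define b where "b = D2 div r + 1"
  have mem: "D < u * n * Y \<and> D < u * n * v \<and> u * n * v \<le> D2 \<longleftrightarrow> a \<le> n \<and> n < b" for n
  proof -
    have 1: "u * n * Y = n * (u * Y)" and 2: "u * n * v = n * r" by (auto simp: r_def)
    have 3: "D < n * (u * Y) \<longleftrightarrow> D div (u * Y) < n" using uY by (simp add: div_less_iff_less_mult)
    have 4: "D < n * r \<longleftrightarrow> D div r < n" using r by (simp add: div_less_iff_less_mult)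
    have 5: "n * r \<le> D2 \<longleftrightarrow> n \<le> D2 div r" using r by (simp add: less_eq_div_iff_mult_less_eq)
    show ?thesis unfolding 1 2 3 4 5 a_def b_def by auto
  qed
  have range: "D < n * r \<and> n * r \<le> 2 * D" if "a \<le> n" "n < b" for n
    using mem[of n] that D2 by (simp add: r_def mult_ac)
  have a_pos: "a \<ge> 1" by (simp add: a_def)
  have b_le: "b \<le> 2 * D + 1" 
  proof -
    have "D2 div r \<le> D2" by (rule div_le_dividend)
    thus ?thesis using D2 unfolding b_def by linarith
  qed
  have "(\<Sum>n=1..2*D. if D < u * n * Y then wnd (u * n * v) else 0) = (\<Sum>n=a..<b. f (n * r))"
  proof (rule sum.mono_neutral_cong_right)
    show "{a..<b} \<subseteq> {1..2*D}" using a_pos b_le by auto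
    show "\<forall>i\<in>{1..2*D} - {a..<b}. (if D < u * i * Y then wnd (u * i * v) else 0) = 0"
    proof
      fix i assume "i \<in> {1..2*D} - {a..<b}"
      hence "\<not> (D < u * i * Y \<and> D < u * i * v \<and> u * i * v \<le> D2)" using mem[of i] by auto
      thus "(if D < u * i * Y then wnd (u * i * v) else 0) = 0" by (auto simp: wnd_def)
    qed
    fix n assume "n \<in> {a..<b}"
    hence m: "D < u * n * Y" "D < u * n * v" "u * n * v \<le> D2" using mem[of n] by auto
    have e: "u * n * v = n * r" by (simp add: r_def)
    show "(if D < u * n * Y then wnd (u * n * v) else 0) = f (n * r)"
      using m unfolding wnd_def e by simp
  qed auto
  also have "... = (\<Sum>h=H..<2*H. \<Sum>n=a..<b. c h * ee (real h * (x / (real (n * r) + \<delta>))))"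
    unfolding f_def by (rule sum.swap)
  also have "norm ... \<le> (\<Sum>h=H..<2*H. 128 * sqrt (2 * real H * x / real D) + 64 * (real D / sqrt (x / real D)) * (1 / real u) * (1 / real v))"
  proof (rule sum_norm_le)
    fix h assume h: "h \<in> {H..<2*H}"
    have xD: "x / real D > 0" using x_pos D_pos by simp
    have "norm (\<Sum>n=a..<b. c h * ee (real h * (x / (real (n * r) + \<delta>))))
       = norm (c h) * norm (\<Sum>n=a..<b. ee (real h * (x / (real (n * r) + \<delta>))))"
      by (simp add: norm_mult flip: sum_distrib_left)
    also have "... \<le> 1 * (128 * sqrt (real h * x / real D) + 64 * (real D / real r) / sqrt (real h * x / real D))"
      using h H r by (intro mult_mono c exp_sum_hyperbola_bound x_pos del range) auto
    also have "... \<le> 128 * sqrt (2 * real H * x / real D) + 64 * (real D / real r) / sqrt (x / real D)"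
    proof -
      have "real h * x / real D \<le> 2 * real H * x / real D"
        using h x_pos by (intro divide_right_mono mult_right_mono) auto
      moreover have "x / real D \<le> real h * x / real D"
        using h H x_pos by (intro divide_right_mono) auto
      ultimately have s: "sqrt (real h * x / real D) \<le> sqrt (2 * real H * x / real D)" "sqrt (x / real D) \<le> sqrt (real h * x / real D)"
        by (simp_all only: real_sqrt_le_iff)
      have "0 < sqrt (x / real D)" using xD by simp
      with s have q: "64 * (real D / real r) / sqrt (real h * x / real D) \<le> 64 * (real D / real r) / sqrt (x / real D)"
        by (intro frac_le) auto
      show ?thesis unfolding mult_1_left by (rule add_mono[OF mult_left_mono[OF s(1)] q]) simp
    qed
    also have "64 * (real D / real r) / sqrt (x / real D) = 64 * (real D / sqrt (x / real D)) * (1 / real u) * (1 / real v)"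
      by (simp add: r_def)
    finally show "norm (\<Sum>n=a..<b. c h * ee (real h * (x / (real (n * r) + \<delta>))))
       \<le> 128 * sqrt (2 * real H * x / real D) + 64 * (real D / sqrt (x / real D)) * (1 / real u) * (1 / real v)" .
  qed
  finally show ?thesis using True by simp
qed

text \<open>R^4 stands for the number of pairs (u, v). The square of the claim follows from
  \<open>param3\<close> and 2 s <= (1 + s)^2 with s = H/R.\<close>

lemma type_I_size: "R ^ 4 * sqrt (2 * real H * x / real D) \<le> real D / R * (1 + real H / R)"
proof (rule power2_le_imp_le)
  have nn: "2 * real H * x / real D \<ge> 0" using x_pos by simp
  have "(R ^ 4 * sqrt (2 * real H * x / real D))^2 = (R ^ 4)^2 * (2 * real H * x / real D)"
    unfolding power_mult_distrib real_sqrt_pow2[OF nn] ..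
  also have "... = 2 * (real H / R) * (x * R ^ 11) / (real D * R^2)"
    using R D_pos by (simp add: divide_simps flip: power_mult power_add) (simp add: eval_nat_numeral)
  also have "... \<le> 2 * (real H / R) * (real D ^ 3) / (real D * R^2)"
    using R by (intro divide_right_mono mult_left_mono param3) auto
  also have "... = (real D / R)^2 * (2 * (real H / R))"
    using D_pos by (simp add: power2_eq_square power3_eq_cube mult_ac)
  also have "... \<le> (real D / R)^2 * (1 + real H / R)^2"
  proof (rule mult_left_mono)
    have "0 \<le> 1 + (real H / R)^2" by simp
    thus "2 * (real H / R) \<le> (1 + real H / R)^2" unfolding power2_sum by simp
  qed simp
  finally show "(R ^ 4 * sqrt (2 * real H * x / real D))^2 \<le> (real D / R * (1 + real H / R))^2"
    by (simp only: power_mult_distrib)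
qed (use R in auto)

text \<open>The first term of \<open>type_I_inner\<close> is summed over 2 Y^2 <= 2 R^4 pairs (u,
  v). The second carries 1/(u v), so its sum costs only two harmonic sums, that is \<Delta>^2. The
  constant is 320 = 2 * 128 + 64.\<close>

lemma type_I_bound:
  assumes a: "\<And>u. norm (a u) \<le> A"
  shows "norm (\<Sum>u=1..Y. \<Sum>v=1..2*D. \<Sum>n=1..2*D. a u * (of_nat (tau k v) * (if D < u * n * Y then wnd (u * n * v) else 0)))
    \<le> 320 * A * \<Delta> ^ (k + 2) * W"
proof -
  let ?t = "\<lambda>u v n. a u * (of_nat (tau k v) * (if D < u * n * Y then wnd (u * n * v) else 0))"
  let ?s = "(\<Sum>u=1..Y. 1 / real u) * (\<Sum>v=1..2*Y. 1 / real v)"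
  have A0: "A \<ge> 0" using a[of 0] norm_ge_zero order_trans by blast
  have dk: "\<Delta> ^ k \<ge> 0" using Delta_ge_1 by simp
  define Z where "Z = 128 * sqrt (2 * real H * x / real D)"
  define z where "z = 64 * (real D / sqrt (x / real D))"
  let ?m = "\<lambda>u v. A * \<Delta> ^ k * (if v \<le> 2 * Y then real H * (Z + z * (1 / real u) * (1 / real v)) else 0)"
  have Z0: "Z \<ge> 0" "z \<ge> 0" using x_pos by (auto simp: Z_def z_def)
  have z_le: "z \<le> 64 * (real D / R)"
  proof -
    have "R^2 \<le> x / real D" using param4 D_pos by (simp add: field_simps)
    hence "R \<le> sqrt (x / real D)" by (rule real_le_rsqrt)
    moreover have "0 < sqrt (x / real D)" using x_pos D_pos by simp
    ultimately show ?thesis unfolding z_def using R by (intro mult_left_mono divide_left_mono mult_pos_pos) auto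
  qed
  have "norm (\<Sum>u=1..Y. \<Sum>v=1..2*D. \<Sum>n=1..2*D. ?t u v n)
    \<le> (\<Sum>u=1..Y. \<Sum>v=1..2*D. ?m u v)"
  proof (intro sum_norm_le)
    fix u v assume uv: "u \<in> {1..Y}" "v \<in> {1..2*D}"
    have "norm (\<Sum>n=1..2*D. ?t u v n)
       = norm (a u) * norm (of_nat (tau k v) :: complex) * norm (\<Sum>n=1..2*D. if D < u * n * Y then wnd (u * n * v) else 0)"
      by (simp only: norm_mult mult.assoc flip: sum_distrib_left)
    also have "... \<le> ?m u v"
      unfolding Z_def z_def using uv dk A0 by (intro mult_mono a tau_le type_I_inner) auto
    finally show "norm (\<Sum>n=1..2*D. ?t u v n)
       \<le> ?m u v" .
  qed
  also have "... = A * \<Delta> ^ k * real H * (\<Sum>u=1..Y. \<Sum>v=1..2*Y. Z + z * (1 / real u) * (1 / real v))"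
  proof -
    have "(\<Sum>v=1..2*D. ?m u v)
       = (\<Sum>v=1..2*Y. A * \<Delta> ^ k * real H * (Z + z * (1 / real u) * (1 / real v)))" for u
      using Y_le_D by (intro sum.mono_neutral_cong_right) auto
    thus ?thesis by (simp only: sum_distrib_left)
  qed
  also have "(\<Sum>u=1..Y. \<Sum>v=1..2*Y. Z + z * (1 / real u) * (1 / real v))
      = 2 * (real Y)^2 * Z + z * (?s)"
  proof -
    have "z * (?s)
        = z * (\<Sum>u=1..Y. \<Sum>v=1..2*Y. (1 / real u) * (1 / real v))"
      by (simp only: sum_product)
    also have "... = (\<Sum>u=1..Y. \<Sum>v=1..2*Y. z * (1 / real u) * (1 / real v))"
      by (simp only: sum_distrib_left mult.assoc)
    finally show ?thesis by (simp add: sum.distrib power2_eq_square)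
  qed
  also have "A * \<Delta> ^ k * real H * (2 * (real Y)^2 * Z + z * (?s))
     \<le> A * \<Delta> ^ k * real H * (256 * (real D / R * (1 + real H / R)) + 64 * (real D / R) * \<Delta>^2)"
  proof (intro mult_left_mono add_mono)
    have "2 * (real Y)^2 * Z \<le> 2 * (R^2)^2 * Z" using Y_le Z0 by (intro mult_right_mono mult_left_mono power_mono) auto
    also have "... = 256 * (R ^ 4 * sqrt (2 * real H * x / real D))" by (simp add: Z_def flip: power_mult)
    also have "... \<le> 256 * (real D / R * (1 + real H / R))" by (intro mult_left_mono type_I_size) auto
    finally show "2 * (real Y)^2 * Z \<le> 256 * (real D / R * (1 + real H / R))" .
    have h: "(\<Sum>u=1..m. 1 / real u) \<le> \<Delta>" if "m \<le> 2 * D" for m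
    proof -
      have "(\<Sum>u=1..m. 1 / real u) \<le> (\<Sum>u=1..2*D. 1 / real u)" using that by (intro sum_mono2) auto
      thus ?thesis using harm by linarith
    qed
    have HP: "?s \<le> \<Delta> * \<Delta>"
      using Y_le_D Delta_ge_1 by (intro mult_mono h) (auto intro: sum_nonneg)
    show "z * (?s) \<le> 64 * (real D / R) * \<Delta>^2"
      unfolding power2_eq_square by (rule mult_mono[OF z_le HP]) (use R in \<open>auto intro!: mult_nonneg_nonneg sum_nonneg\<close>)
  qed (use A0 dk in auto)
  also have "... \<le> A * \<Delta> ^ k * real H * (320 * \<Delta>^2 * (real D / R * (1 + real H / R)))"
  proof (rule mult_left_mono)
    let ?T = "real D / R * (1 + real H / R)"
    have T: "real D / R \<le> ?T" "?T \<ge> 0" using R by (auto simp: distrib_left)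
    have d2: "\<Delta>^2 \<ge> 1" using Delta_ge_1 by simp
    have "256 * ?T \<le> \<Delta>^2 * (256 * ?T)" using mult_right_mono[OF d2, of "256 * ?T"] T by simp
    moreover have "64 * (real D / R) * \<Delta>^2 \<le> 64 * ?T * \<Delta>^2" using T by (intro mult_right_mono mult_left_mono) auto
    moreover have "256 * T + 64 * q * s \<le> 320 * s * T"
      if "256 * T \<le> s * (256 * T)" "64 * q * s \<le> 64 * T * s" for T q s :: real
      using that by (simp add: algebra_simps)
    ultimately show "256 * ?T + 64 * (real D / R) * \<Delta>^2 \<le> 320 * \<Delta>^2 * ?T" by blast
  qed (use A0 dk in auto)
  also have "... = 320 * A * \<Delta> ^ (k + 2) * W"
    unfolding W_def by (simp add: power2_eq_square distrib_left distrib_right mult_ac add_divide_distrib)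
  finally show ?thesis .
qed

section \<open>Induction over the number of factors\<close>

lemma W_ge: "real H * real D / R \<le> W" "W \<ge> 0"
  using R by (auto simp: W_def distrib_left mult_ac)

text \<open>The arbitrary weights \<open>a u\<close> with u <= Y stand for the product of the
  factors already split off; this generality makes the induction work. After the next factor n is
  split off, p = u n falls into one of three ranges: p <= Y leads to the induction hypothesis with
  new weights \<open>b p\<close>, Y < p <= D/Y to \<open>type_II_range\<close>, and p > D/Y to
  \<open>type_I_bound\<close> with the long variable n. As \<open>b p\<close> is a sum over the
  divisors of p, the weight bound grows by \<Delta> at each step.\<close>

lemma tau_weighted_sum_bound:
  assumes a: "\<And>u. norm (a u) \<le> A"
  shows "norm (\<Sum>u=1..Y. \<Sum>w=1..2*D. a u * (of_nat (tau k w) * wnd (u * w))) \<le> 1700 * real k * A * \<Delta> ^ (2 * k + 2) * W"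
  using a
proof (induction k arbitrary: a A)
  case 0
  \<comment> \<open>With no factor left w = 1, so d = u <= Y <= D lies outside the block.\<close>
  have "a u * (of_nat (tau 0 w) * wnd (u * w)) = 0" if "u \<in> {1..Y}" for u w
    using that Y_le_D by (auto simp: tau_0 wnd_def)
  hence "(\<Sum>u=1..Y. \<Sum>w=1..2*D. a u * (of_nat (tau 0 w) * wnd (u * w))) = 0"
    by (intro sum.neutral ballI)
  thus ?case by simp
next
  case (Suc k)
  note a = Suc.prems
  have A0: "A \<ge> 0" using a[of 0] norm_ge_zero order_trans by blast
  have d0: "\<Delta> ^ m \<ge> 0" for m using Delta_ge_1 by simp
  define a' where "a' u = (if 1 \<le> u \<and> u \<le> Y then a u else 0)" for u
  have a': "norm (a' u) \<le> A" for u using a[of u] A0 by (auto simp: a'_def)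
  define g where "g p = (\<Sum>v=1..2*D. of_nat (tau k v) * wnd (p * v))" for p
  define b where "b p = (if 1 \<le> p \<and> p \<le> 2 * D then \<Sum>u | u dvd p. a' u else 0)" for p
  let ?b = "\<lambda>p. if Y < p \<and> p * Y \<le> D then b p else 0"
  let ?w = "\<lambda>u n v. of_nat (tau k v) * (if D < u * n * Y then wnd (u * n * v) else 0)"
  have b: "norm (b p) \<le> A * \<Delta>" for p
  proof (cases "1 \<le> p \<and> p \<le> 2 * D")
    case True
    have "b p = (\<Sum>u | u dvd p. a' u)" using True by (simp add: b_def)
    hence "norm (b p) \<le> (\<Sum>u | u dvd p. A)" by (simp only:) (rule sum_norm_le, rule a')
    also have "... = real (card {d. d dvd p}) * A" by simp
    also have "... \<le> \<Delta> * A" using \<Delta>[of p] True A0 by (intro mult_right_mono) auto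
    finally show ?thesis by (simp add: mult.commute)
  next
    case False
    thus ?thesis using A0 Delta_ge_1 by (auto simp: b_def)
  qed
  have "(\<Sum>u=1..Y. \<Sum>w=1..2*D. a u * (of_nat (tau (Suc k) w) * wnd (u * w)))
    = (\<Sum>u=1..Y. \<Sum>n=1..2*D. a u * g (u * n))"
  proof (rule sum.cong[OF refl])
    fix u assume u: "u \<in> {1..Y}"
    have "(\<Sum>v=1..2*D. \<Sum>n=1..2*D. of_nat (tau k v) * wnd (u * (v * n)))
       = (\<Sum>p=1..2*D. (\<Sum>v | v dvd p. of_nat (tau k v)) * wnd (u * p))"
      using u by (intro sum_over_factorizations[of "2*D" "\<lambda>p. wnd (u * p)"] wnd_out) auto
    also have "... = (\<Sum>w=1..2*D. of_nat (tau (Suc k) w) * wnd (u * w))"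
      by (intro sum.cong refl) (simp add: tau_Suc_divisors)
    finally have "(\<Sum>w=1..2*D. of_nat (tau (Suc k) w) * wnd (u * w))
       = (\<Sum>v=1..2*D. \<Sum>n=1..2*D. of_nat (tau k v) * wnd (u * (v * n)))" ..
    also have "... = (\<Sum>n=1..2*D. \<Sum>v=1..2*D. of_nat (tau k v) * wnd (u * (v * n)))" by (rule sum.swap)
    also have "... = (\<Sum>n=1..2*D. g (u * n))" unfolding g_def by (simp add: mult_ac)
    finally show "(\<Sum>w=1..2*D. a u * (of_nat (tau (Suc k) w) * wnd (u * w))) = (\<Sum>n=1..2*D. a u * g (u * n))"
      by (simp only: flip: sum_distrib_left)
  qed
  also have "... = (\<Sum>u=1..Y. \<Sum>n=1..2*D. a u * (if u * n * Y \<le> D then g (u * n) else 0))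
      + (\<Sum>u=1..Y. \<Sum>n=1..2*D. a u * (if D < u * n * Y then g (u * n) else 0))"
    unfolding sum.distrib[symmetric] by (intro sum.cong refl) auto
  also have "(\<Sum>u=1..Y. \<Sum>n=1..2*D. a u * (if D < u * n * Y then g (u * n) else 0))
      = (\<Sum>u=1..Y. \<Sum>v=1..2*D. \<Sum>n=1..2*D. a u * (?w u n v))"
  proof (rule sum.cong[OF refl])
    fix u
    have "(\<Sum>n=1..2*D. a u * (if D < u * n * Y then g (u * n) else 0))
       = (\<Sum>n=1..2*D. \<Sum>v=1..2*D. a u * (?w u n v))"
      by (intro sum.cong refl) (auto simp: g_def sum_distrib_left)
    also have "... = (\<Sum>v=1..2*D. \<Sum>n=1..2*D. a u * (?w u n v))"
      by (rule sum.swap)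
    finally show "(\<Sum>n=1..2*D. a u * (if D < u * n * Y then g (u * n) else 0))
       = (\<Sum>v=1..2*D. \<Sum>n=1..2*D. a u * (?w u n v))" .
  qed
  also have "(\<Sum>u=1..Y. \<Sum>n=1..2*D. a u * (if u * n * Y \<le> D then g (u * n) else 0))
      = (\<Sum>u=1..2*D. \<Sum>n=1..2*D. a' u * (if u * n * Y \<le> D then g (u * n) else 0))"
    using Y_le_D by (intro sum.mono_neutral_cong_left) (auto simp: a'_def)
  also have "... = (\<Sum>p=1..2*D. (\<Sum>u | u dvd p. a' u) * (if p * Y \<le> D then g p else 0))"
  proof (rule sum_over_factorizations[of "2*D" "\<lambda>p. if p * Y \<le> D then g p else 0"])
    fix p assume p: "2 * D < p"
    have "p \<le> p * Y" using Y_ge_1 by simp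
    hence "\<not> p * Y \<le> D" using p by linarith
    thus "(if p * Y \<le> D then g p else 0) = 0" by simp
  qed
  also have "... = (\<Sum>p=1..2*D. b p * (if p * Y \<le> D then g p else 0))"
    by (intro sum.cong refl) (auto simp: b_def)
  also have "... = (\<Sum>p=1..2*D. if p \<le> Y then b p * g p else 0)
      + (\<Sum>p=1..2*D. (?b p) * g p)"
  proof -
    \<comment> \<open>For p <= Y the condition p Y <= D holds automatically, since Y^2 <= R^4 <=
      D.\<close>
    have "b p * (if p * Y \<le> D then g p else 0) = (if p \<le> Y then b p * g p else 0) + (?b p) * g p" for p
    proof (cases "p \<le> Y")
      case True
      have "p * Y \<le> Y * Y" using True by (rule mult_right_mono) simp
      also have "Y * Y \<le> D"
      proof -
        have "real Y * real Y \<le> R^2 * R^2" by (intro mult_mono Y_le) auto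
        also have "... = R ^ 4" by (simp add: power2_eq_square power4_eq_xxxx)
        also have "... \<le> real D" using D_ge R by (smt (verit) zero_le_power)
        finally show ?thesis by (metis of_nat_le_iff of_nat_mult)
      qed
      finally show ?thesis using True by simp
    qed simp
    thus ?thesis by (simp only: flip: sum.distrib)
  qed
  also have "(\<Sum>p=1..2*D. if p \<le> Y then b p * g p else 0) = (\<Sum>p=1..Y. \<Sum>w=1..2*D. b p * (of_nat (tau k w) * wnd (p * w)))"
    using Y_le_D by (intro sum.mono_neutral_cong_right) (auto simp: g_def sum_distrib_left)
  also have "(\<Sum>p=1..2*D. (?b p) * g p)
      = (\<Sum>p=1..2*D. \<Sum>q=1..2*D. (?b p)
          * (if 1 \<le> q \<and> q \<le> 2 * D then of_nat (tau k q) else 0) * wnd (p * q))"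
    by (intro sum.cong refl) (simp add: g_def sum_distrib_left mult_ac)
  finally have "norm (\<Sum>u=1..Y. \<Sum>w=1..2*D. a u * (of_nat (tau (Suc k) w) * wnd (u * w)))
    \<le> 1700 * real k * (A * \<Delta>) * \<Delta> ^ (2 * k + 2) * W + 1200 * (A * \<Delta>) * \<Delta> ^ k * \<Delta>^2 * real H * real D / R
      + 320 * A * \<Delta> ^ (k + 2) * W"
  proof (simp only:, intro order_trans[OF norm_triangle_ineq] add_mono Suc.IH type_II_range type_I_bound)
    show "norm (b u) \<le> A * \<Delta>" for u by (rule b)
    show "norm (?b p) \<le> A * \<Delta>" for p
      using b[of p] A0 Delta_ge_1 by auto
    show "norm (if 1 \<le> q \<and> q \<le> 2 * D then of_nat (tau k q) else 0 :: complex) \<le> \<Delta> ^ k" for q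
      using tau_le[of q k] d0 by auto
    show "Y < p \<and> p * Y \<le> D" if "(?b p) \<noteq> 0" for p
      using that by (auto split: if_splits)
    show "norm (a u) \<le> A" for u by (rule a)
  qed
  also have "... \<le> 1700 * real k * A * \<Delta> ^ (2 * k + 4) * W + 1200 * A * \<Delta> ^ (2 * k + 4) * W + 320 * A * \<Delta> ^ (2 * k + 4) * W"
  proof (intro add_mono)
    have pm: "\<Delta> ^ i \<le> \<Delta> ^ j" if "i \<le> j" for i j using Delta_ge_1 that by (rule power_increasing[rotated])
    have "\<Delta> * \<Delta> ^ (2 * k + 2) = \<Delta> ^ (2 * k + 3)" by (simp add: power_add eval_nat_numeral)
    hence "1700 * real k * (A * \<Delta>) * \<Delta> ^ (2 * k + 2) * W = 1700 * real k * A * \<Delta> ^ (2 * k + 3) * W" by (simp add: mult_ac)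
    also have "... \<le> 1700 * real k * A * \<Delta> ^ (2 * k + 4) * W"
      using A0 W_ge by (intro mult_right_mono mult_left_mono pm) auto
    finally show "1700 * real k * (A * \<Delta>) * \<Delta> ^ (2 * k + 2) * W \<le> 1700 * real k * A * \<Delta> ^ (2 * k + 4) * W" .
    have "\<Delta> * \<Delta> ^ k * \<Delta>^2 = \<Delta> ^ (k + 3)" by (simp add: power_add eval_nat_numeral)
    hence "1200 * (A * \<Delta>) * \<Delta> ^ k * \<Delta>^2 * real H * real D / R = 1200 * A * \<Delta> ^ (k + 3) * (real H * real D / R)"
      by (simp add: mult_ac)
    also have "... \<le> 1200 * A * \<Delta> ^ (2 * k + 4) * W"
      using A0 W_ge R d0 by (intro mult_mono mult_left_mono pm) auto
    finally show "1200 * (A * \<Delta>) * \<Delta> ^ k * \<Delta>^2 * real H * real D / R \<le> 1200 * A * \<Delta> ^ (2 * k + 4) * W" .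
    show "320 * A * \<Delta> ^ (k + 2) * W \<le> 320 * A * \<Delta> ^ (2 * k + 4) * W"
      using A0 W_ge by (intro mult_right_mono mult_left_mono pm) auto
  qed
  \<comment> \<open>One step of the induction adds 1200 + 320 = 1520, below 1700.\<close>
  also have "... \<le> 1700 * real (Suc k) * A * \<Delta> ^ (2 * Suc k + 2) * W"
  proof -
    define V where "V = A * \<Delta> ^ (2 * k + 4) * W"
    have "0 \<le> V" using A0 d0 W_ge by (simp add: V_def)
    hence "(1700 * real k + 1520) * V \<le> (1700 * real (Suc k)) * V" by (intro mult_right_mono) auto
    moreover have "2 * Suc k + 2 = 2 * k + 4" by simp
    ultimately show ?thesis by (simp only: V_def distrib_right mult.assoc)
  qed
  finally show ?case .
qed

lemma tau_exp_sum_bound: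
  "norm (\<Sum>d\<in>{D<..D2}. of_nat (tau k d) * f d) \<le> 1700 * real k * \<Delta> ^ (2 * k + 2) * W"
proof -
  \<comment> \<open>Nothing has been split off yet: the weight is concentrated at u = 1.\<close>
  have "norm (\<Sum>u=1..Y. \<Sum>w=1..2*D. (if u = 1 then 1 else 0) * (of_nat (tau k w) * wnd (u * w))) \<le> 1700 * real k * 1 * \<Delta> ^ (2 * k + 2) * W"
    by (rule tau_weighted_sum_bound) auto
  also have "(\<Sum>u=1..Y. \<Sum>w=1..2*D. (if u = 1 then 1 else 0) * (of_nat (tau k w) * wnd (u * w)))
      = (\<Sum>u\<in>{1}. \<Sum>w=1..2*D. of_nat (tau k w) * wnd (u * w))"
    using Y_ge_1 by (intro sum.mono_neutral_cong_right) auto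
  also have "... = (\<Sum>d\<in>{D<..D2}. of_nat (tau k d) * f d)"
    using D2 by (simp, intro sum.mono_neutral_cong_right) (auto simp: wnd_def)
  finally show ?thesis by simp
qed

end

section \<open>The sawtooth sum\<close>

lemma sum_inverse_dyadic_le:
  assumes "m < 2 ^ I"
  shows "(\<Sum>r=1..m. 1 / real r) \<le> real I"
proof -
  have "(\<Sum>r=1..m. 1 / real r) \<le> (\<Sum>r=1..<2^I. 1 / real r)"
    using assms by (intro sum_mono2) auto
  also have "... = (\<Sum>i<I. \<Sum>r=2^i..<2*2^i. 1 / real r)" by (rule sum_dyadic_blocks)
  also have "... \<le> (\<Sum>i<I. 1)"
  proof (rule sum_mono)
    fix i
    have "(\<Sum>r=2^i..<2*2^i. 1 / real r) \<le> (\<Sum>r\<in>{2^i..<2*2^i::nat}. 1 / 2^i)"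
    proof (rule sum_mono)
      fix r :: nat assume "r \<in> {2^i..<2*2^i}"
      hence "2 ^ i \<le> r" by simp
      hence "(2 :: real) ^ i \<le> real r" by (metis of_nat_le_iff of_nat_numeral of_nat_power)
      thus "1 / real r \<le> 1 / 2 ^ i" by (intro divide_left_mono) (auto intro!: mult_pos_pos order.strict_trans2[of 0 "2^i" "real r"])
    qed
    also have "... = 1" by simp
    finally show "(\<Sum>r=2^i..<2*2^i. 1 / real r) \<le> 1" .
  qed
  finally show ?thesis by simp
qed

text \<open>Trivially the sum is at most D \<Delta>^k, so a factor R = D / y^9 must be saved. The
  frequencies are cut into dyadic ranges of at most \<open>I\<close> many, each contributing O(y^9)
  up to powers of \<Delta>.\<close>

lemma block_sawtooth_bound:
  fixes x y \<delta> \<Delta> :: real and D D2 I k :: nat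
  assumes x: "x = y ^ 19" and y: "y \<ge> 40" and Dy: "y ^ 9 \<le> real D" "real D \<le> y ^ 10"
    and D2: "D2 \<le> 2 * D" and del: "0 \<le> \<delta>" "\<delta> \<le> 1"
    and \<Delta>: "\<And>v. 0 < v \<Longrightarrow> v \<le> 2 * D \<Longrightarrow> real (card {d. d dvd v}) \<le> \<Delta>"
    and I: "2 * D < 2 ^ I" "real I \<le> \<Delta>"
  shows "\<bar>\<Sum>d\<in>{D<..D2}. real (tau k d) * (frac (x / (real d + \<delta>)) - 1/2)\<bar> \<le> 3400 * (real k + 1) * \<Delta> ^ (2 * k + 3) * y ^ 9"
proof -
  let ?P = "\<bar>\<Sum>d\<in>{D<..D2}. real (tau k d) * (frac (x / (real d + \<delta>)) - 1/2)\<bar>"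
  have y9: "y ^ 9 > 0" using y by simp
  define R where "R = real D / y ^ 9"
  have "real D > 0" using less_le_trans[OF y9 Dy(1)] .
  hence DR: "real D = R * y ^ 9" and DR': "real D / R = y ^ 9" using y9 by (auto simp: R_def)
  have R: "1 \<le> R" "R \<le> y"
  proof -
    show "1 \<le> R" unfolding R_def using Dy y9 by simp
    have "real D \<le> y * y ^ 9" using Dy(2) by (simp add: eval_nat_numeral)
    thus "R \<le> y" unfolding R_def using y9 by (simp add: divide_le_eq)
  qed
  have D1: "D \<ge> 1"
  proof -
    from less_le_trans[OF y9 Dy(1)] show ?thesis by simp
  qed
  have \<Delta>1: "\<Delta> \<ge> 1" using \<Delta>[of 1] D1 by simp
  have tau_le: "real (tau k d) \<le> \<Delta> ^ k" if "d \<in> {D<..D2}" for d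
    using that D2 \<Delta>1 by (intro tau_le_power[of "2*D" \<Delta> d k, OF \<Delta>]) auto
  have W: "(\<Sum>d\<in>{D<..D2}. real (tau k d)) \<le> real D * \<Delta> ^ k"
  proof -
    have "(\<Sum>d\<in>{D<..D2}. real (tau k d)) \<le> real (card {D<..D2}) * \<Delta> ^ k"
      using tau_le by (rule sum_bounded_above)
    also have "... \<le> real D * \<Delta> ^ k" using D2 \<Delta>1 by (intro mult_right_mono) auto
    finally show ?thesis .
  qed
  have fr: "\<bar>frac t - 1/2\<bar> \<le> 1" for t :: real using frac_ge_0[of t] frac_lt_1[of t] by linarith
  have pm: "\<Delta> ^ i \<le> \<Delta> ^ j" if "i \<le> j" for i j using \<Delta>1 that by (rule power_increasing[rotated])
  show ?thesis
  proof (cases "R = 1")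
    \<comment> \<open>For R = 1 there is nothing to save and the trivial bound suffices;
      \<open>sum_sawtooth_le\<close> needs R > 1.\<close>
    case True
    have "?P \<le> (\<Sum>d\<in>{D<..D2}. real (tau k d) * 1)"
      by (rule order_trans[OF sum_abs sum_mono]) (simp only: abs_mult abs_of_nat, intro mult_left_mono fr, simp)
    also have "... \<le> y ^ 9 * \<Delta> ^ k" using W DR True by simp
    also have "... \<le> y ^ 9 * (3400 * (real k + 1) * \<Delta> ^ (2 * k + 3))"
    proof (intro mult_left_mono)
      have "1 * \<Delta> ^ k \<le> (3400 * (real k + 1)) * \<Delta> ^ (2 * k + 3)" using \<Delta>1 by (intro mult_mono pm) auto
      thus "\<Delta> ^ k \<le> 3400 * (real k + 1) * \<Delta> ^ (2 * k + 3)" by simp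
    qed (use y9 in auto)
    finally show ?thesis by (simp only: mult_ac)
  next
    case False
    hence R1: "R > 1" using R by simp
    define L where "L = nat \<lceil>R^2\<rceil>"
    have R2: "R^2 \<ge> 1" using R by simp
    have L: "real L \<ge> R^2" "real L \<le> 2 * R^2" unfolding L_def using R2 by linarith+
    have LD: "L \<le> 2 * D"
    proof -
      have "R^2 \<le> y ^ 2" using R by (intro power_mono) auto
      also have "... \<le> y ^ 9" using y by (intro power_increasing) auto
      finally have "R^2 \<le> real D" using Dy by linarith
      hence "real L \<le> real (2 * D)" using L by simp
      thus ?thesis by (simp only: of_nat_le_iff)
    qed
    define T where "T h = (\<Sum>d\<in>{D<..D2}. of_real (real (tau k d)) * ee (real h * (x / (real d + \<delta>))))" for h :: nat
    define g where "g h = (if h \<le> L then min (1 / real h) (R / (real h)^2) * norm (T h) else 0)" for h :: nat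
    have blk: "(\<Sum>h=2^i..<2*2^i. g h) \<le> 3400 * real k * \<Delta> ^ (2 * k + 2) * y ^ 9" for i
    proof (cases "2 ^ i \<le> L")
      case False
      hence "(\<Sum>h=2^i..<2*2^i. g h) = 0" by (intro sum.neutral) (auto simp: g_def)
      thus ?thesis using \<Delta>1 y9 by simp
    next
      case True
      define H :: nat where "H = 2 ^ i"
      have H1: "H \<ge> 1" by (simp add: H_def)
      have HL: "H \<le> L" using True by (simp add: H_def)
      \<comment> \<open>Then c h * T h = |T h|, and \<open>c h\<close> vanishes if
        \<open>T h\<close> does.\<close>
      define c where "c h = cnj (sgn (T h))" for h
      have c1: "norm (c h) \<le> 1" for h by (simp add: c_def norm_sgn)
      have cT: "c h * T h = of_real (norm (T h))" for h
      proof (cases "T h = 0")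
        case False
        have "c h * T h = cnj (T h) * T h / of_real (norm (T h))"
          by (simp add: c_def sgn_eq)
        also have "cnj (T h) * T h = of_real ((norm (T h))^2)" unfolding complex_norm_square by (rule mult.commute)
        finally show ?thesis using False by (simp add: power2_eq_square)
      qed (simp add: c_def)
      interpret hyperbola_block x y R \<delta> \<Delta> D D2 H I "nat \<lfloor>R^2\<rfloor>" c
      proof
        show "real H \<le> 2 * R^2" using HL L by linarith
        show "(\<Sum>r=1..2*D. 1 / real r) \<le> \<Delta>" using sum_inverse_dyadic_le[OF I(1)] I(2) by linarith
      qed (use x y R DR D2 del H1 c1 \<Delta> I in auto)
      define m where "m = min (1 / real H) (R / (real H)^2)"
      have m0: "m \<ge> 0" using R by (simp add: m_def)
      have "(\<Sum>d\<in>{D<..D2}. of_nat (tau k d) * f d) = (\<Sum>h=H..<2*H. c h * T h)"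
      proof -
        have "(\<Sum>d\<in>{D<..D2}. of_nat (tau k d) * f d)
          = (\<Sum>d\<in>{D<..D2}. \<Sum>h=H..<2*H. c h * (of_real (real (tau k d)) * ee (real h * (x / (real d + \<delta>)))))"
          unfolding f_def sum_distrib_left by (intro sum.cong refl) (simp add: mult_ac)
        also have "... = (\<Sum>h=H..<2*H. \<Sum>d\<in>{D<..D2}. c h * (of_real (real (tau k d)) * ee (real h * (x / (real d + \<delta>)))))"
          by (rule sum.swap)
        finally show ?thesis by (simp only: T_def sum_distrib_left)
      qed
      also have "... = of_real (\<Sum>h=H..<2*H. norm (T h))" unfolding cT by simp
      finally have "norm (of_real (\<Sum>h=H..<2*H. norm (T h)) :: complex) \<le> 1700 * real k * \<Delta> ^ (2 * k + 2) * W"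
        using tau_exp_sum_bound[of k] by simp
      hence sT: "(\<Sum>h=H..<2*H. norm (T h)) \<le> 1700 * real k * \<Delta> ^ (2 * k + 2) * W"
        unfolding norm_of_real by linarith
      have "(\<Sum>h=H..<2*H. g h) \<le> (\<Sum>h=H..<2*H. m * norm (T h))"
      proof (rule sum_mono)
        fix h assume h: "h \<in> {H..<2*H}"
        have "1 / real h \<le> 1 / real H" using h H1 by (intro frac_le) auto
        moreover have "R / (real h)^2 \<le> R / (real H)^2" using h H1 R by (intro frac_le power_mono) auto
        ultimately have "min (1 / real h) (R / (real h)^2) \<le> m" unfolding m_def by (rule min.mono)
        thus "g h \<le> m * norm (T h)" using m0 by (simp add: g_def mult_right_mono)
      qed
      also have "... = m * (\<Sum>h=H..<2*H. norm (T h))" by (simp only: sum_distrib_left)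
      also have "... \<le> m * (1700 * real k * \<Delta> ^ (2 * k + 2) * W)" using sT m0 by (rule mult_left_mono)
      also have "... = 1700 * real k * \<Delta> ^ (2 * k + 2) * (m * W)" by (simp only: mult_ac)
      also have "... \<le> 1700 * real k * \<Delta> ^ (2 * k + 2) * (2 * y ^ 9)"
      proof (rule mult_left_mono)
        have "m * real H \<le> 1 / real H * real H" by (intro mult_right_mono) (auto simp: m_def)
        hence 1: "m * real H \<le> 1" using H1 by simp
        have "m * ((real H)^2 / R) \<le> (R / (real H)^2) * ((real H)^2 / R)" using R by (intro mult_right_mono) (auto simp: m_def)
        hence 2: "m * ((real H)^2 / R) \<le> 1" using H1 R by simp
        have "m * W = y ^ 9 * (m * real H + m * ((real H)^2 / R))" unfolding W_def DR' by (simp only: distrib_left mult_ac)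
        also have "... \<le> y ^ 9 * 2" using 1 2 y9 by (intro mult_left_mono) linarith+
        finally show "m * W \<le> 2 * y ^ 9" by simp
      qed (use \<Delta>1 in simp)
      finally show ?thesis by (simp add: H_def)
    qed
    have "(\<Sum>h=1..L. min (1 / real h) (R / (real h)^2) * norm (T h)) = (\<Sum>h=1..<2^I. g h)"
      using LD I(1) by (intro sum.mono_neutral_cong_left) (auto simp: g_def)
    also have "... = (\<Sum>i<I. \<Sum>h=2^i..<2*2^i. g h)" by (rule sum_dyadic_blocks)
    also have "... \<le> (\<Sum>i<I. 3400 * real k * \<Delta> ^ (2 * k + 2) * y ^ 9)" by (intro sum_mono blk)
    also have "... = real I * (3400 * real k * \<Delta> ^ (2 * k + 2) * y ^ 9)" by (simp only: sum_constant card_lessThan)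
    also have "... \<le> \<Delta> * (3400 * real k * \<Delta> ^ (2 * k + 2) * y ^ 9)" using I \<Delta>1 y9 by (intro mult_right_mono) auto
    also have "... = 3400 * real k * \<Delta> ^ (2 * k + 3) * y ^ 9" by (simp add: power_add eval_nat_numeral)
    finally have S: "(\<Sum>h=1..L. min (1 / real h) (R / (real h)^2) * norm (T h)) \<le> 3400 * real k * \<Delta> ^ (2 * k + 3) * y ^ 9" .
    have "?P
       \<le> (\<Sum>d\<in>{D<..D2}. real (tau k d)) / R + (\<Sum>h=1..L. min (1 / real h) (R / (real h)^2) * norm (T h))"
      unfolding T_def by (rule sum_sawtooth_le[OF _ R1 L(1)]) simp
    also have "... \<le> y ^ 9 * \<Delta> ^ (2 * k + 3) + 3400 * real k * \<Delta> ^ (2 * k + 3) * y ^ 9"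
    proof (rule add_mono[OF _ S])
      have "(\<Sum>d\<in>{D<..D2}. real (tau k d)) / R \<le> real D * \<Delta> ^ k / R" using W R by (intro divide_right_mono) auto
      also have "... = (real D / R) * \<Delta> ^ k" by simp
      also have "... = y ^ 9 * \<Delta> ^ k" unfolding DR' ..
      also have "... \<le> y ^ 9 * \<Delta> ^ (2 * k + 3)" using y9 by (intro mult_left_mono pm) auto
      finally show "(\<Sum>d\<in>{D<..D2}. real (tau k d)) / R \<le> y ^ 9 * \<Delta> ^ (2 * k + 3)" .
    qed
    also have "... = (3400 * real k + 1) * (\<Delta> ^ (2 * k + 3) * y ^ 9)" by (simp add: algebra_simps)
    also have "... \<le> (3400 * (real k + 1)) * (\<Delta> ^ (2 * k + 3) * y ^ 9)"
      using \<Delta>1 y9 by (intro mult_right_mono) auto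
    finally show ?thesis by (simp only: mult_ac)
  qed
qed

text \<open>The d up to about y^9 are estimated trivially; the rest up to \<open>Z\<close> is
  covered by at most \<open>I\<close> blocks, each twice as long as the preceding one, which
  accounts for one more power of \<Delta>.\<close>

lemma sawtooth_sum_bound:
  fixes y \<delta> \<Delta> :: real and Z I k :: nat
  assumes x: "x = y ^ 19" and y: "y \<ge> 40" and Z: "Z = nat \<lfloor>y ^ 10\<rfloor>" and del: "0 \<le> \<delta>" "\<delta> \<le> 1"
    and \<Delta>: "\<And>v. 0 < v \<Longrightarrow> v \<le> 2 * Z \<Longrightarrow> real (card {d. d dvd v}) \<le> \<Delta>"
    and I: "2 * Z < 2 ^ I" "real I \<le> \<Delta>"
  shows "\<bar>\<Sum>d=1..Z. real (tau k d) * (frac (x / (real d + \<delta>)) - 1/2)\<bar> \<le> 3402 * (real k + 1) * \<Delta> ^ (2 * k + 4) * y ^ 9"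
proof -
  define \<psi> where "\<psi> d = real (tau k d) * (frac (x / (real d + \<delta>)) - 1/2)" for d
  define B where "B = 3400 * (real k + 1) * \<Delta> ^ (2 * k + 3) * y ^ 9"
  have y9: "y ^ 9 \<ge> 1" using y by (simp add: one_le_power)
  have y9p: "0 \<le> y ^ 9" using y9 by linarith
  have y10: "y ^ 10 \<ge> 40 * y ^ 9"
    using mult_right_mono[OF y, of "y ^ 9"] y9 by (simp add: eval_nat_numeral)
  have Zle: "real Z \<le> y ^ 10" unfolding Z using y by simp
  define D0 where "D0 = nat \<lceil>y ^ 9\<rceil>"
  have D0: "y ^ 9 \<le> real D0" "real D0 \<le> 2 * y ^ 9" unfolding D0_def using y9 by linarith+
  have D0Z: "D0 \<le> Z" unfolding D0_def Z using y10 y9 by (intro nat_mono) linarith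
  have Z1: "Z \<ge> 1" using D0Z D0 y9 by linarith
  have \<Delta>1: "\<Delta> \<ge> 1" using \<Delta>[of 1] Z1 by simp
  have B0: "B \<ge> 0" unfolding B_def using \<Delta>1 y9p by (intro mult_nonneg_nonneg) auto
  \<comment> \<open>Induction on the number i of doublings that carry D beyond \<open>Z\<close>; the
    last block is cut at \<open>Z\<close>, which is why the block bounds allow any D2 <= 2
    D.\<close>
  have blocks: "\<bar>\<Sum>d\<in>{D<..Z}. \<psi> d\<bar> \<le> real i * B" if "D0 \<le> D" "Z < 2 ^ i * D" for D i
    using that
  proof (induction i arbitrary: D)
    case (Suc i)
    show ?case
    proof (cases "D \<le> Z")
      case False
      thus ?thesis using B0 by simp
    next
      case True
      define D2 where "D2 = min (2 * D) Z"
      have split: "{D<..Z} = {D<..D2} \<union> {D2<..Z}" using True by (auto simp: D2_def)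
      have "(\<Sum>d\<in>{D<..Z}. \<psi> d) = (\<Sum>d\<in>{D<..D2}. \<psi> d) + (\<Sum>d\<in>{D2<..Z}. \<psi> d)"
        unfolding split by (intro sum.union_disjoint) auto
      also have "\<bar>...\<bar> \<le> B + real i * B"
      proof (rule order_trans[OF abs_triangle_ineq add_mono])
        show "\<bar>\<Sum>d\<in>{D<..D2}. \<psi> d\<bar> \<le> B" unfolding \<psi>_def B_def
        proof (rule block_sawtooth_bound[OF x y _ _ _ del _ _ I(2)])
          show "y ^ 9 \<le> real D" using D0(1) Suc.prems(1) by linarith
          show "real D \<le> y ^ 10" using True Zle by linarith
          show "D2 \<le> 2 * D" by (simp add: D2_def)
          show "2 * D < 2 ^ I" using I(1) True by linarith
          show "real (card {d. d dvd v}) \<le> \<Delta>" if "0 < v" "v \<le> 2 * D" for v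
            using that True by (intro \<Delta>) auto
        qed
        show "\<bar>\<Sum>d\<in>{D2<..Z}. \<psi> d\<bar> \<le> real i * B"
        proof (cases "2 * D \<le> Z")
          case True
          hence "D2 = 2 * D" by (simp add: D2_def)
          thus ?thesis using Suc.IH[of "2 * D"] Suc.prems by (simp add: mult_ac)
        next
          case False
          hence "{D2<..Z} = {}" by (simp add: D2_def)
          thus ?thesis using B0 by simp
        qed
      qed
      finally show ?thesis by (simp add: algebra_simps)
    qed
  qed simp
  have fr: "\<bar>frac t - 1/2\<bar> \<le> 1" for t :: real using frac_ge_0[of t] frac_lt_1[of t] by linarith
  have small: "\<bar>\<Sum>d=1..D0. \<psi> d\<bar> \<le> 2 * y ^ 9 * \<Delta> ^ k"
  proof -
    have "\<bar>\<Sum>d=1..D0. \<psi> d\<bar> \<le> (\<Sum>d=1..D0. \<Delta> ^ k)"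
    proof (rule order_trans[OF sum_abs sum_mono])
      fix d assume d: "d \<in> {1..D0}"
      have "real (tau k d) \<le> \<Delta> ^ k"
        using d D0Z \<Delta>1 by (intro tau_le_power[of "2*Z" \<Delta> d k, OF \<Delta>]) auto
      hence "real (tau k d) * \<bar>frac (x / (real d + \<delta>)) - 1/2\<bar> \<le> \<Delta> ^ k * 1"
        using \<Delta>1 by (intro mult_mono fr) auto
      thus "\<bar>\<psi> d\<bar> \<le> \<Delta> ^ k" by (simp add: \<psi>_def abs_mult)
    qed
    also have "... = real D0 * \<Delta> ^ k" by simp
    also have "... \<le> 2 * y ^ 9 * \<Delta> ^ k" using D0 \<Delta>1 by (intro mult_right_mono) auto
    finally show ?thesis .
  qed
  have "{1..Z} = {1..D0} \<union> {D0<..Z}" using D0Z by auto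
  hence "(\<Sum>d=1..Z. \<psi> d) = (\<Sum>d=1..D0. \<psi> d) + (\<Sum>d\<in>{D0<..Z}. \<psi> d)"
    by (simp only:) (intro sum.union_disjoint, auto)
  also have "\<bar>...\<bar> \<le> 2 * y ^ 9 * \<Delta> ^ k + real I * B"
  proof (rule order_trans[OF abs_triangle_ineq add_mono[OF small blocks]])
    have "D0 \<ge> 1" using D0 y9 by linarith
    hence "2 ^ I * 1 \<le> 2 ^ I * D0" by (intro mult_left_mono) auto
    thus "Z < 2 ^ I * D0" using I(1) by linarith
  qed simp
  also have "... \<le> 2 * (y ^ 9 * \<Delta> ^ (2 * k + 4)) + 3400 * (real k + 1) * (y ^ 9 * \<Delta> ^ (2 * k + 4))"
  proof (rule add_mono)
    have "\<Delta> ^ k \<le> \<Delta> ^ (2 * k + 4)" using \<Delta>1 by (intro power_increasing) auto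
    from mult_left_mono[OF this y9p] show "2 * y ^ 9 * \<Delta> ^ k \<le> 2 * (y ^ 9 * \<Delta> ^ (2 * k + 4))" by simp
    have "real I * B \<le> \<Delta> * B" using I B0 by (intro mult_right_mono) auto
    also have "... = 3400 * (real k + 1) * (y ^ 9 * \<Delta> ^ (2 * k + 4))" by (simp add: B_def power_add eval_nat_numeral)
    finally show "real I * B \<le> 3400 * (real k + 1) * (y ^ 9 * \<Delta> ^ (2 * k + 4))" .
  qed
  also have "... = (3400 * real k + 3402) * (y ^ 9 * \<Delta> ^ (2 * k + 4))" by (simp add: algebra_simps)
  also have "... \<le> (3402 * (real k + 1)) * (y ^ 9 * \<Delta> ^ (2 * k + 4))"
    using \<Delta>1 y9p by (intro mult_right_mono mult_nonneg_nonneg) auto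
  finally show ?thesis unfolding \<psi>_def by (simp only: mult_ac)
qed

text \<open>The condition y >= 40 of the block estimates becomes x >= 40^19. One \<Delta> of the
  form const * (2 x)^e bounds both the divisor function up to 2 Z and the number of dyadic
  ranges.\<close>

lemma sawtooth_sum_powr_bound:
  fixes \<epsilon> :: real and k :: nat
  assumes eps: "\<epsilon> > 0"
  obtains C where "C \<ge> 0" "\<And>x \<delta>. x \<ge> 40 ^ 19 \<Longrightarrow> 0 \<le> \<delta> \<Longrightarrow> \<delta> \<le> 1 \<Longrightarrow>
    \<bar>\<Sum>d=1..nat \<lfloor>x powr (10/19)\<rfloor>. real (tau k d) * (frac (x / (real d + \<delta>)) - 1/2)\<bar> \<le> C * x powr (9/19 + \<epsilon>)"
proof -
  \<comment> \<open>Chosen so that the final power \<Delta>^(2 k + 4) is a constant times (2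
    x)^\<epsilon>.\<close>
  define e where "e = \<epsilon> / (2 * real k + 4)"
  have e: "e > 0" using eps by (simp add: e_def)
  obtain C1 where C1: "C1 \<ge> 1" "\<And>n. n > 0 \<Longrightarrow> real (card {d. d dvd n}) \<le> C1 * real n powr e"
    using divisor_bound[OF e] by blast
  define C2 where "C2 = max 1 (1 / (e * ln 2))"
  define C3 where "C3 = max C1 C2"
  have C3: "C3 \<ge> 1" "C1 \<le> C3" "C2 \<le> C3" using C1 by (auto simp: C3_def)
  define C where "C = 3402 * (real k + 1) * C3 ^ (2 * k + 4) * 2 powr \<epsilon>"
  show ?thesis
  proof (rule that[of C])
    show "C \<ge> 0" using C3 by (simp add: C_def)
    fix x \<delta> :: real assume x40: "x \<ge> 40 ^ 19" and del: "0 \<le> \<delta>" "\<delta> \<le> 1"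
    have x1: "x \<ge> 1" using x40 by simp
    define y where "y = x powr (1/19)"
    have yp: "y ^ n = x powr (real n / 19)" if "n > 0" for n
      using x1 that by (simp add: y_def powr_power)
    have xy: "x = y ^ 19" using x1 by (simp add: yp)
    have y: "y \<ge> 40"
    proof -
      have "((40::real) ^ 19) powr (1/19) \<le> y" unfolding y_def using x40 by (intro powr_mono2) auto
      moreover have "((40::real) ^ 19) powr (1/19) = 40"
        using powr_realpow[of 40 19] powr_powr[of "40::real" 19 "1/19"] by simp
      ultimately show ?thesis by linarith
    qed
    define Z where "Z = nat \<lfloor>y ^ 10\<rfloor>"
    have Zx: "Z = nat \<lfloor>x powr (10/19)\<rfloor>" by (simp add: Z_def yp)
    have y10: "y ^ 10 \<ge> 1" using y by (simp add: one_le_power)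
    have Zle: "real Z \<le> y ^ 10" unfolding Z_def using y by simp
    have Z1: "Z \<ge> 1" unfolding Z_def using y10 by linarith
    have y10x: "y ^ 10 \<le> x" unfolding xy using y by (intro power_increasing) auto
    define \<Delta> where "\<Delta> = C3 * (2 * x) powr e"
    have px: "(real v) powr e \<le> (2 * x) powr e" if "v \<le> 2 * Z" for v
    proof (rule powr_mono2)
      have "real v \<le> real (2 * Z)" using that by (simp only: of_nat_le_iff)
      thus "real v \<le> 2 * x" using Zle y10x by simp
    qed (use e in auto)
    obtain n where n: "2 ^ n \<le> 2 * Z" "2 * Z < 2 ^ (n + 1)"
      using ex_power_ivl1[of 2 "2 * Z"] Z1 by auto
    have "\<bar>\<Sum>d=1..Z. real (tau k d) * (frac (x / (real d + \<delta>)) - 1/2)\<bar> \<le> 3402 * (real k + 1) * \<Delta> ^ (2 * k + 4) * y ^ 9"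
    proof (rule sawtooth_sum_bound[OF xy y Z_def del _ n(2)])
      fix v :: nat assume v: "0 < v" "v \<le> 2 * Z"
      have "real (card {d. d dvd v}) \<le> C1 * real v powr e" by (rule C1(2)[OF v(1)])
      also have "... \<le> C3 * (2 * x) powr e" using C1 C3 px[OF v(2)] by (intro mult_mono) auto
      finally show "real (card {d. d dvd v}) \<le> \<Delta>" unfolding \<Delta>_def .
    next
      have "real (n + 1) \<le> C2 * 2 powr (real n * e)" using linear_le_powr_two[OF e, of n] by (simp add: C2_def)
      also have "2 powr (real n * e) = real (2 ^ n) powr e" by (simp add: powr_powr flip: powr_realpow)
      also have "C2 * real (2 ^ n) powr e \<le> C3 * (2 * x) powr e"
        using C3 px[OF n(1)] by (intro mult_mono) auto
      finally show "real (n + 1) \<le> \<Delta>" unfolding \<Delta>_def .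
    qed
    also have "\<Delta> ^ (2 * k + 4) = C3 ^ (2 * k + 4) * (2 * x) powr \<epsilon>"
    proof -
      have "((2 * x) powr e) ^ (2 * k + 4) = (2 * x) powr (e * real (2 * k + 4))"
        using x1 by (subst powr_realpow[symmetric]) (auto simp: powr_powr)
      also have "e * real (2 * k + 4) = \<epsilon>" by (simp add: e_def)
      finally show ?thesis unfolding \<Delta>_def by (simp add: power_mult_distrib)
    qed
    also have "3402 * (real k + 1) * (C3 ^ (2 * k + 4) * (2 * x) powr \<epsilon>) * y ^ 9 = C * x powr (9/19 + \<epsilon>)"
      using x1 by (simp add: C_def yp powr_mult powr_add)
    finally show "\<bar>\<Sum>d=1..nat \<lfloor>x powr (10/19)\<rfloor>. real (tau k d) * (frac (x / (real d + \<delta>)) - 1/2)\<bar> \<le> C * x powr (9/19 + \<epsilon>)"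
      unfolding Zx .
  qed
qed

section \<open>Convergence and tail of the main series\<close>

lemma powr_telescope_bound:
  fixes e :: real and d :: nat
  assumes e: "0 < e" "e \<le> 1/2" and d: "d \<ge> 1"
  shows "real d powr e / (real d * (real d + 1)) \<le> 4 * (real d powr (e - 1) - (real d + 1) powr (e - 1))"
proof -
  have "\<exists>z::real. real d < z \<and> z < real d + 1 \<and>
      (real d + 1) powr (e - 1) - real d powr (e - 1) = (real d + 1 - real d) * ((e - 1) * z powr (e - 1 - 1))"
  proof (rule MVT2)
    fix z :: real assume "real d \<le> z"
    thus "((\<lambda>z. z powr (e - 1)) has_real_derivative (e - 1) * z powr (e - 1 - 1)) (at z)"
      using d by (intro has_real_derivative_powr) auto
  qed simp
  then obtain z where z: "real d < z" "z < real d + 1"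
    "(real d + 1) powr (e - 1) - real d powr (e - 1) = (e - 1) * z powr (e - 2)" by auto
  have zb: "(real d + 1) powr (e - 2) \<le> z powr (e - 2)" using z d e by (intro powr_mono2') auto
  have "real d powr e / (real d * (real d + 1)) = real d powr (e - 1) / (real d + 1)"
    using d by (simp add: powr_diff)
  \<comment> \<open>This shift from d to d + 1 costs a factor 2, and 1 - e >= 1/2 in the mean value
    theorem costs another; hence the constant 4.\<close>
  also have "real d powr (e - 1) \<le> 2 * (real d + 1) powr (e - 1)"
  proof -
    have "2 * real d \<ge> real d + 1" using d by simp
    hence "(2 * real d) powr (e - 1) \<le> (real d + 1) powr (e - 1)" using d e by (intro powr_mono2') auto
    moreover have "(2 * real d) powr (e - 1) = 2 powr (e - 1) * real d powr (e - 1)" using d by (simp add: powr_mult)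
    moreover have "2 powr (e - 1) \<ge> (1/2 :: real)"
      using powr_mono[of "-1" "e - 1" "2::real"] e by (simp add: powr_minus_divide)
    hence "1/2 * real d powr (e - 1) \<le> 2 powr (e - 1) * real d powr (e - 1)" by (intro mult_right_mono) auto
    ultimately show ?thesis by linarith
  qed
  hence "real d powr (e - 1) / (real d + 1) \<le> 2 * (real d + 1) powr (e - 1) / (real d + 1)"
    by (intro divide_right_mono) auto
  also have "... = 2 * (real d + 1) powr (e - 2)" using d by (simp add: powr_diff[of _ _ 1] powr_diff[of _ _ 2] powr_numeral power2_eq_square)
  also have "... \<le> 2 * z powr (e - 2)" using zb by simp
  also have "... \<le> 4 * ((1 - e) * z powr (e - 2))"
    unfolding mult.assoc[symmetric] using e by (intro mult_right_mono) auto
  also have "(1 - e) * z powr (e - 2) = real d powr (e - 1) - (real d + 1) powr (e - 1)"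
    using z(3) by (simp add: algebra_simps)
  finally show ?thesis .
qed

text \<open>\<open>F n\<close> is the term with d = n + 1, so the sum over n < Z covers d <= Z. The
  telescoping majorant yields convergence and the tail bound together.\<close>

lemma tau_series_tail:
  fixes e C :: real and k :: nat
  assumes e: "0 < e" "e \<le> 1/2" and C: "\<And>n. n > 0 \<Longrightarrow> real (tau k n) \<le> C * real n powr e" and C0: "C \<ge> 0"
  defines "F \<equiv> \<lambda>n. real (tau k (n + 1)) / (real (n + 1) * real (n + 2))"
  shows "summable F" and "(\<Sum>n. F n) - (\<Sum>n<Z. F n) \<le> 4 * C * real (Z + 1) powr (e - 1)" and "0 \<le> (\<Sum>n. F n) - (\<Sum>n<Z. F n)"
proof -
  define t where "t n = real (n + 1) powr (e - 1)" for n
  have F_le: "F n \<le> 4 * C * (t n - t (Suc n))" for n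
  proof -
    have "F n \<le> C * real (n + 1) powr e / (real (n + 1) * real (n + 2))"
      unfolding F_def using C[of "n + 1"] by (intro divide_right_mono) auto
    also have "... = C * (real (n + 1) powr e / (real (n + 1) * (real (n + 1) + 1)))" by (simp add: add.commute)
    also have "... \<le> C * (4 * (real (n + 1) powr (e - 1) - (real (n + 1) + 1) powr (e - 1)))"
      using C0 by (intro mult_left_mono powr_telescope_bound e) auto
    also have "... = 4 * C * (t n - t (Suc n))" by (simp add: t_def add_ac)
    finally show ?thesis .
  qed
  have F0: "F n \<ge> 0" for n by (simp add: F_def)
  have "filterlim (\<lambda>n. real (Suc n)) at_top sequentially"
    by (rule filterlim_compose[OF filterlim_real_sequentially filterlim_Suc])
  hence t0: "t \<longlonglongrightarrow> 0"
    unfolding t_def using e by (intro tendsto_neg_powr) auto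
  have ts: "(\<lambda>n. 4 * C * (t (n + Z) - t (Suc n + Z))) sums (4 * C * (t (0 + Z) - 0))" for Z
  proof (rule sums_mult)
    have "(\<lambda>n. t (n + Z)) \<longlonglongrightarrow> 0" using t0 by (rule LIMSEQ_ignore_initial_segment)
    from telescope_sums'[OF this] show "(\<lambda>n. t (n + Z) - t (Suc n + Z)) sums (t (0 + Z) - 0)" .
  qed
  show sF: "summable F"
  proof (rule summable_comparison_test')
    show "summable (\<lambda>n. 4 * C * (t n - t (Suc n)))" using ts[of 0] by (simp add: sums_iff)
    show "norm (F n) \<le> 4 * C * (t n - t (Suc n))" for n using F_le F0 by simp
  qed
  have sp: "(\<Sum>n. F n) - (\<Sum>n<Z. F n) = (\<Sum>n. F (n + Z))"
    using suminf_split_initial_segment[OF sF, of Z] by simp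
  have "(\<Sum>n. F (n + Z)) \<le> 4 * C * (t (0 + Z) - 0)"
  proof (rule sums_le[OF _ _ ts])
    show "(\<lambda>n. F (n + Z)) sums (\<Sum>n. F (n + Z))" using sF by (intro summable_sums summable_ignore_initial_segment)
    show "F (n + Z) \<le> 4 * C * (t (n + Z) - t (Suc n + Z))" for n using F_le[of "n + Z"] by simp
  qed
  thus "(\<Sum>n. F n) - (\<Sum>n<Z. F n) \<le> 4 * C * real (Z + 1) powr (e - 1)" unfolding sp by (simp add: t_def)
  show "0 \<le> (\<Sum>n. F n) - (\<Sum>n<Z. F n)" unfolding sp
    using sF F0 by (intro suminf_nonneg summable_ignore_initial_segment)
qed

section \<open>The asymptotic formula\<close>

text \<open>Since m <= [x/n] is equivalent to n <= [x/m], the quotient equals d exactly for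
  [x/(d+1)] < n <= [x/d].\<close>

lemma floor_quotient_fibre_card:
  fixes x :: real and d :: nat
  assumes x: "x \<ge> 1" and d: "d \<ge> 1"
  shows "real (card {n\<in>{1..nat \<lfloor>x\<rfloor>}. nat \<lfloor>x / real n\<rfloor> = d})
    = x / (real d * (real d + 1)) - frac (x / real d) + frac (x / (real d + 1))"
proof -
  have le_iff: "m \<le> nat \<lfloor>x / real n\<rfloor> \<longleftrightarrow> n \<le> nat \<lfloor>x / real m\<rfloor>" if "n \<ge> 1" "m \<ge> 1" for m n :: nat
  proof -
    have "m \<le> nat \<lfloor>x / real n\<rfloor> \<longleftrightarrow> real m \<le> x / real n"
      using x that by (simp add: le_nat_iff le_floor_iff)
    also have "... \<longleftrightarrow> real n \<le> x / real m" using that by (simp add: field_simps)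
    also have "... \<longleftrightarrow> n \<le> nat \<lfloor>x / real m\<rfloor>" using x that by (simp add: le_nat_iff le_floor_iff)
    finally show ?thesis .
  qed
  let ?a = "nat \<lfloor>x / real (d + 1)\<rfloor>" and ?b = "nat \<lfloor>x / real d\<rfloor>"
  have "{n\<in>{1..nat \<lfloor>x\<rfloor>}. nat \<lfloor>x / real n\<rfloor> = d} = {?a<..?b}"
  proof (intro equalityI subsetI)
    fix n assume "n \<in> {n\<in>{1..nat \<lfloor>x\<rfloor>}. nat \<lfloor>x / real n\<rfloor> = d}"
    hence n: "n \<ge> 1" "nat \<lfloor>x / real n\<rfloor> = d" by auto
    have "n \<le> ?b" using le_iff[of n d] n d by simp
    moreover have "\<not> n \<le> ?a" using le_iff[of n "d + 1"] n by simp
    ultimately show "n \<in> {?a<..?b}" by simp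
  next
    fix n assume n: "n \<in> {?a<..?b}"
    hence n1: "n \<ge> 1" by simp
    have 1: "d \<le> nat \<lfloor>x / real n\<rfloor>" using le_iff[of n d] n n1 d by simp
    have 2: "\<not> d + 1 \<le> nat \<lfloor>x / real n\<rfloor>" using le_iff[of n "d + 1"] n n1 by simp
    have "x / real d \<le> x" using x d by (simp add: divide_le_eq)
    hence "?b \<le> nat \<lfloor>x\<rfloor>" by (intro nat_mono floor_mono)
    thus "n \<in> {n\<in>{1..nat \<lfloor>x\<rfloor>}. nat \<lfloor>x / real n\<rfloor> = d}" using n n1 1 2 by simp
  qed
  moreover have "?a \<le> ?b"
    using x d by (intro nat_mono floor_mono divide_left_mono) auto
  ultimately have "real (card {n\<in>{1..nat \<lfloor>x\<rfloor>}. nat \<lfloor>x / real n\<rfloor> = d}) = real ?b - real ?a"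
    by (simp add: of_nat_diff)
  also have "real ?b = x / real d - frac (x / real d)" using x d by (simp add: frac_def)
  also have "real ?a = x / (real d + 1) - frac (x / (real d + 1))" using x d by (simp add: frac_def add.commute)
  also have "x / real d - frac (x / real d) - (x / (real d + 1) - frac (x / (real d + 1)))
     = x / (real d * (real d + 1)) - frac (x / real d) + frac (x / (real d + 1))"
    using d by (simp add: divide_simps) (simp add: algebra_simps)
  finally show ?thesis .
qed

lemma floor_quotient_sum_bound:
  fixes k :: nat and \<epsilon> :: real
  assumes eps: "\<epsilon> > 0"
  obtains C where "C \<ge> 0" "\<And>x. x \<ge> 40 ^ 19 \<Longrightarrow>
    \<bar>(\<Sum>n=1..nat \<lfloor>x\<rfloor>. real (tau k (nat \<lfloor>x / real n\<rfloor>)))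
      - x * (\<Sum>n. real (tau k (n + 1)) / (real (n + 1) * real (n + 2)))\<bar> \<le> C * x powr (9/19 + \<epsilon>)"
proof -
  \<comment> \<open>The telescoping bound for the series requires an exponent of at most
    1/2.\<close>
  define e where "e = min \<epsilon> (1/2)"
  have e: "0 < e" "e \<le> 1/2" "e \<le> \<epsilon>" using eps by (auto simp: e_def)
  obtain C1 where C1: "C1 \<ge> 1" "\<And>n. n > 0 \<Longrightarrow> real (tau k n) \<le> C1 * real n powr e"
    using tau_bound[OF e(1)] by blast
  obtain C2 where C2: "C2 \<ge> 0" "\<And>x \<delta>. x \<ge> 40 ^ 19 \<Longrightarrow> 0 \<le> \<delta> \<Longrightarrow> \<delta> \<le> 1 \<Longrightarrow>
    \<bar>\<Sum>d=1..nat \<lfloor>x powr (10/19)\<rfloor>. real (tau k d) * (frac (x / (real d + \<delta>)) - 1/2)\<bar> \<le> C2 * x powr (9/19 + \<epsilon>)"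
    using sawtooth_sum_powr_bound[OF eps] by blast
  define F where "F n = real (tau k (n + 1)) / (real (n + 1) * real (n + 2))" for n
  show ?thesis
  proof (rule that[of "C1 + 4 * C1 + 2 * C2"])
    show "0 \<le> C1 + 4 * C1 + 2 * C2" using C1 C2 by simp
    fix x :: real assume x40: "x \<ge> 40 ^ 19"
    hence x1: "x \<ge> 1" by simp
    define Z where "Z = nat \<lfloor>x powr (10/19)\<rfloor>"
    define q where "q n = nat \<lfloor>x / real n\<rfloor>" for n
    define E where "E = x powr (9/19 + \<epsilon>)"
    have xe: "x powr (9/19 + e) \<le> E" unfolding E_def using x1 e by (intro powr_mono) auto
    have Zlt: "x powr (10/19) < real (Z + 1)" unfolding Z_def by linarith
    let ?A = "{n\<in>{1..nat \<lfloor>x\<rfloor>}. q n > Z}" and ?B = "{n\<in>{1..nat \<lfloor>x\<rfloor>}. q n \<le> Z}"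
    have "{1..nat \<lfloor>x\<rfloor>} = ?A \<union> ?B" by auto
    hence S: "(\<Sum>n=1..nat \<lfloor>x\<rfloor>. real (tau k (q n))) = (\<Sum>n\<in>?A. real (tau k (q n))) + (\<Sum>n\<in>?B. real (tau k (q n)))"
      by (metis (no_types, lifting) finite_Un finite_atLeastAtMost sum.union_disjoint disjoint_iff linorder_not_le mem_Collect_eq)
    have q_le: "real (q n) \<le> x / real n" for n unfolding q_def using x1 by simp
    have q_pos: "q n \<ge> 1" if "n \<in> {1..nat \<lfloor>x\<rfloor>}" for n
    proof -
      have "real n \<le> x" using that x1 by (simp add: le_nat_iff le_floor_iff)
      hence "1 \<le> x / real n" using that by simp
      thus ?thesis unfolding q_def by (simp add: le_nat_iff le_floor_iff)
    qed
    have SA: "0 \<le> (\<Sum>n\<in>?A. real (tau k (q n)))" "(\<Sum>n\<in>?A. real (tau k (q n))) \<le> C1 * E"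
    proof -
      show "0 \<le> (\<Sum>n\<in>?A. real (tau k (q n)))" by (intro sum_nonneg) auto
      have "?A \<subseteq> {1..nat \<lfloor>x powr (9/19)\<rfloor>}"
      proof
        fix n assume n: "n \<in> ?A"
        hence n1: "real n \<ge> 1" by simp
        have "real (Z + 1) \<le> real (q n)" using n by (simp only: of_nat_le_iff) simp
        hence "x powr (10/19) \<le> x / real n" using q_le[of n] Zlt by linarith
        hence "real n * x powr (10/19) \<le> x" using n1 by (simp add: field_simps)
        also have "x = x powr (9/19) * x powr (10/19)" using x1 by (simp flip: powr_add)
        finally have "real n \<le> x powr (9/19)" using x1 by simp
        thus "n \<in> {1..nat \<lfloor>x powr (9/19)\<rfloor>}" using n by (simp add: le_nat_iff le_floor_iff)
      qed
      hence "card ?A \<le> nat \<lfloor>x powr (9/19)\<rfloor>" using card_mono[of "{1..nat \<lfloor>x powr (9/19)\<rfloor>}" ?A] by simp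
      hence cA: "real (card ?A) \<le> x powr (9/19)" by (simp add: le_nat_iff le_floor_iff)
      have "(\<Sum>n\<in>?A. real (tau k (q n))) \<le> real (card ?A) * (C1 * x powr e)"
      proof (rule sum_bounded_above)
        fix n assume n: "n \<in> ?A"
        hence "q n > 0" "real n \<ge> 1" using q_pos[of n] by auto
        have "x / real n \<le> x / 1" using x1 \<open>real n \<ge> 1\<close> by (intro divide_left_mono) auto
        hence "real (q n) \<le> x" using q_le[of n] by simp
        hence "real (q n) powr e \<le> x powr e" using e by (intro powr_mono2) auto
        thus "real (tau k (q n)) \<le> C1 * x powr e"
          using C1(2)[OF \<open>q n > 0\<close>] C1(1) by (meson mult_left_mono order_trans zero_le_one)
      qed
      also have "... \<le> x powr (9/19) * (C1 * x powr e)" using cA C1 by (intro mult_right_mono) auto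
      also have "... = C1 * x powr (9/19 + e)" by (simp add: powr_add)
      also have "... \<le> C1 * E" using xe C1 by (intro mult_left_mono) auto
      finally show "(\<Sum>n\<in>?A. real (tau k (q n))) \<le> C1 * E" .
    qed
    define P where "P \<delta> = (\<Sum>d=1..Z. real (tau k d) * (frac (x / (real d + \<delta>)) - 1/2))" for \<delta>
    have P: "\<bar>P \<delta>\<bar> \<le> C2 * E" if "0 \<le> \<delta>" "\<delta> \<le> 1" for \<delta>
      unfolding P_def Z_def E_def using C2(2)[OF x40 that] .
    have "(\<Sum>n\<in>?B. real (tau k (q n))) = (\<Sum>d=1..Z. \<Sum>n | n \<in> ?B \<and> q n = d. real (tau k (q n)))"
      using q_pos by (intro sum.group[symmetric]) auto
    also have "... = (\<Sum>d=1..Z. real (tau k d) * (x / (real d * (real d + 1)) - frac (x / real d) + frac (x / (real d + 1))))"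
    proof (rule sum.cong[OF refl])
      fix d assume d: "d \<in> {1..Z}"
      have set_eq: "{n. n \<in> ?B \<and> q n = d} = {n\<in>{1..nat \<lfloor>x\<rfloor>}. nat \<lfloor>x / real n\<rfloor> = d}" using d by (auto simp: q_def)
      have "(\<Sum>n | n \<in> ?B \<and> q n = d. real (tau k (q n))) = (\<Sum>n | n \<in> ?B \<and> q n = d. real (tau k d))"
        by (intro sum.cong refl) auto
      also have "... = real (tau k d) * real (card {n. n \<in> ?B \<and> q n = d})" by simp
      also have "real (card {n. n \<in> ?B \<and> q n = d}) = x / (real d * (real d + 1)) - frac (x / real d) + frac (x / (real d + 1))"
        unfolding set_eq using d x1 by (intro floor_quotient_fibre_card) auto
      finally show "(\<Sum>n | n \<in> ?B \<and> q n = d. real (tau k (q n)))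
        = real (tau k d) * (x / (real d * (real d + 1)) - frac (x / real d) + frac (x / (real d + 1)))" .
    qed
    \<comment> \<open>The terms 1/2 of the two sawtooth sums cancel.\<close>
    also have "... = x * (\<Sum>d=1..Z. real (tau k d) / (real d * (real d + 1))) - P 0 + P 1"
      unfolding P_def sum_distrib_left sum_subtractf[symmetric] sum.distrib[symmetric]
      by (intro sum.cong refl) (simp add: algebra_simps)
    also have "(\<Sum>d=1..Z. real (tau k d) / (real d * (real d + 1))) = (\<Sum>n<Z. F n)"
      unfolding F_def by (rule sum.reindex_bij_witness[of _ Suc "\<lambda>d. d - 1"]) (auto simp: add.commute)
    finally have SB: "(\<Sum>n\<in>?B. real (tau k (q n))) = x * (\<Sum>n<Z. F n) - P 0 + P 1" .
    have C10: "C1 \<ge> 0" using C1 by simp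
    have tail: "0 \<le> (\<Sum>n. F n) - (\<Sum>n<Z. F n)" "(\<Sum>n. F n) - (\<Sum>n<Z. F n) \<le> 4 * C1 * real (Z + 1) powr (e - 1)"
      unfolding F_def using tau_series_tail(2,3)[OF e(1,2) C1(2) C10] by auto
    have "x * ((\<Sum>n. F n) - (\<Sum>n<Z. F n)) \<le> x * (4 * C1 * real (Z + 1) powr (e - 1))"
      using tail x1 by (intro mult_left_mono) auto
    also have "... \<le> x * (4 * C1 * (x powr (10/19)) powr (e - 1))"
      using Zlt x1 C1 e by (intro mult_left_mono powr_mono2') auto
    \<comment> \<open>The cut at x^(10/19) makes the tail of the series as small as the number
      x^(9/19) of terms with a large quotient.\<close>
    also have "... = 4 * C1 * x powr (9/19 + 10/19 * e)"
    proof -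
      have "x * (x powr (10/19)) powr (e - 1) = x powr 1 * x powr (10/19 * (e - 1))" using x1 by (simp add: powr_powr)
      also have "... = x powr (1 + 10/19 * (e - 1))" by (simp only: powr_add)
      also have "1 + 10/19 * (e - 1) = 9/19 + 10/19 * e" by (simp add: field_simps)
      finally show ?thesis by simp
    qed
    also have "... \<le> 4 * C1 * E"
    proof (rule mult_left_mono)
      have "x powr (9/19 + 10/19 * e) \<le> x powr (9/19 + e)" using x1 e by (intro powr_mono) auto
      thus "x powr (9/19 + 10/19 * e) \<le> E" using xe by linarith
    qed (use C1 in simp)
    finally have T: "x * ((\<Sum>n. F n) - (\<Sum>n<Z. F n)) \<le> 4 * C1 * E" .
    have T0: "0 \<le> x * ((\<Sum>n. F n) - (\<Sum>n<Z. F n))" using tail x1 by simp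
    have "(\<Sum>n=1..nat \<lfloor>x\<rfloor>. real (tau k (q n))) - x * (\<Sum>n. F n)
       = (\<Sum>n\<in>?A. real (tau k (q n))) - x * ((\<Sum>n. F n) - (\<Sum>n<Z. F n)) - P 0 + P 1"
      unfolding S SB by (simp add: algebra_simps)
    also have "\<bar>...\<bar> \<le> C1 * E + 4 * C1 * E + 2 * (C2 * E)"
      using SA T T0 P[of 0] P[of 1] by linarith
    also have "... = (C1 + 4 * C1 + 2 * C2) * E" by (simp add: algebra_simps)
    finally show "\<bar>(\<Sum>n=1..nat \<lfloor>x\<rfloor>. real (tau k (nat \<lfloor>x / real n\<rfloor>)))
      - x * (\<Sum>n. real (tau k (n + 1)) / (real (n + 1) * real (n + 2)))\<bar> \<le> (C1 + 4 * C1 + 2 * C2) * x powr (9/19 + \<epsilon>)"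
      unfolding q_def F_def E_def .
  qed
qed

text \<open>The series starts at index 0, so its index n stands for the integer n + 1. It converges
  by \<open>tau_series_tail\<close>, so the infinite sum is a genuine limit and not a default
  value.\<close>

theorem theorem1:
  fixes k :: nat and \<epsilon> :: real
  assumes "k \<ge> 2" and "\<epsilon> > 0"
  shows "\<exists>C. \<forall>x::real. x \<ge> 2 \<longrightarrow>
           \<bar>(\<Sum>n\<in>{1..nat \<lfloor>x\<rfloor>}. real (tau k (nat \<lfloor>x / real n\<rfloor>)))
             - x * (\<Sum>n. real (tau k (n + 1)) / (real (n + 1) * real (n + 2)))\<bar>
           \<le> C * x powr (9/19 + \<epsilon>)"
proof -
  let ?S = "\<lambda>x :: real. (\<Sum>n\<in>{1..nat \<lfloor>x\<rfloor>}. real (tau k (nat \<lfloor>x / real n\<rfloor>)))"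
  let ?s = "(\<Sum>n. real (tau k (n + 1)) / (real (n + 1) * real (n + 2)))"
  obtain C where C: "C \<ge> 0" "\<And>x. x \<ge> 40 ^ 19 \<Longrightarrow>
    \<bar>?S x
      - x * ?s\<bar> \<le> C * x powr (9/19 + \<epsilon>)"
    using floor_quotient_sum_bound[OF assms(2)] by blast
  obtain C1 where C1: "C1 \<ge> 1" "\<And>n. n > 0 \<Longrightarrow> real (tau k n) \<le> C1 * real n powr 1"
    using tau_bound[of 1] by auto
  define s where "s = ?s"
  define X :: real where "X = 40 ^ 19"
  \<comment> \<open>For 2 <= x < X both the sum and the main term are bounded, and the power of x is
    at least 1; the last two summands of the constant cover this range.\<close>
  define C' where "C' = C + X * (C1 * X) + X * \<bar>s\<bar>"
  have X: "X \<ge> 0" by (simp add: X_def)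
  show ?thesis
  proof (intro exI[of _ C'] allI impI)
    fix x :: real assume x: "x \<ge> 2"
    have p1: "x powr (9/19 + \<epsilon>) \<ge> 1" using x assms by (intro ge_one_powr_ge_zero) auto
    have C'0: "C \<le> C'" "0 \<le> X * (C1 * X) + X * \<bar>s\<bar>" using X C1 by (auto simp: C'_def)
    show "\<bar>?S x
             - x * ?s\<bar>
           \<le> C' * x powr (9/19 + \<epsilon>)"
    proof (cases "x \<ge> X")
      case True
      have "C * x powr (9/19 + \<epsilon>) \<le> C' * x powr (9/19 + \<epsilon>)" using C'0 by (intro mult_right_mono) auto
      thus ?thesis using C(2)[of x] True unfolding X_def by linarith
    next
      case False
      have "?S x \<le> real (card {1..nat \<lfloor>x\<rfloor>}) * (C1 * X)"
      proof (rule sum_bounded_above)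
        fix n assume n: "n \<in> {1..nat \<lfloor>x\<rfloor>}"
        have "real n \<le> x" using n x by (simp add: le_nat_iff le_floor_iff)
        hence "1 \<le> x / real n" using n by simp
        hence pos: "nat \<lfloor>x / real n\<rfloor> > 0" by simp
        have "x / real n \<le> x / 1" using n x by (intro divide_left_mono) auto
        moreover have "real (nat \<lfloor>x / real n\<rfloor>) \<le> x / real n" using x by simp
        ultimately have "real (nat \<lfloor>x / real n\<rfloor>) \<le> X" using False by simp
        hence "C1 * real (nat \<lfloor>x / real n\<rfloor>) \<le> C1 * X" using C1 by (intro mult_left_mono) auto
        thus "real (tau k (nat \<lfloor>x / real n\<rfloor>)) \<le> C1 * X" using C1(2)[OF pos] by simp
      qed
      also have "... \<le> X * (C1 * X)"
      proof (rule mult_right_mono)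
        have "real (nat \<lfloor>x\<rfloor>) \<le> x" using x by simp
        thus "real (card {1..nat \<lfloor>x\<rfloor>}) \<le> X" using False by simp
      qed (use C1 X in auto)
      finally have S: "?S x \<le> X * (C1 * X)" .
      have S0: "0 \<le> ?S x" by (intro sum_nonneg) auto
      have "\<bar>x * s\<bar> \<le> X * \<bar>s\<bar>" unfolding abs_mult using False x by (intro mult_right_mono) auto
      hence "\<bar>?S x - x * s\<bar> \<le> X * (C1 * X) + X * \<bar>s\<bar>"
        using S S0 by linarith
      also have "... \<le> C' * 1" using C(1) by (simp add: C'_def)
      also have "... \<le> C' * x powr (9/19 + \<epsilon>)" using p1 C'0 C(1) by (intro mult_left_mono) auto
      finally show ?thesis unfolding s_def .
    qed
  qed
qed

end
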